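(* Let $W$ be an almost everywhere continuous ring graphon and assume $\mu \in \mathbb{R}$ is an isolated eigenvalue of the graphon Laplacian $\mathcal{L}(W):L^2\to L^2$ with multiplicity $1 \leq m < \infty$. Then there exists $\delta_0 = \delta_0(\mu) > 0$ such that for all $\delta \in (0,\delta_0)$ and $\gamma \in (0,\frac{1}{2})$ there exist $N_0 = N_0(\delta,\gamma) \geq 1$ and $C = C(\gamma) > 0$ such that the following is true for each $N \geq N_0$: 1. There are exactly $m$ eigenvalues of $\mathrm{L}_d^N$, $\lambda_1 \geq \lambda_2 \geq \dots \geq \lambda_m$, such that $\left|\frac{\lambda_k}{N} - \mu\right|<\delta$ for all $k = 1,\dots,m$. 2. There are exactly $m$ eigenvalues of $\mathrm{L}_r^N$, $\hat\lambda_1 \geq \hat\lambda_2 \geq \dots \geq \hat\lambda_m$, such that $\left|\frac{\hat\lambda_k}{N} - \mu\right|<\delta$ for all $k = 1,\dots,m$, with probability at least $1 - 2N e^{-CN^{2\gamma}}$. 3. If $V = [\mathbf{v}_1,\mathbf{v}_2,\dots,\mathbf{v}_m]\in\mathbb{R}^{N\times m}$ and $\hat V = [\hat{\mathbf{v}}_1,\hat{\mathbf{v}}_2,\dots,\hat{\mathbf{v}}_m]\in\mathbb{R}^{N\times m}$ have orthonormal columns satisfying $\mathrm{L}_d^N \mathbf{v}_k = \lambda_k \mathbf{v}_k$ and $\mathrm{L}_r^N \hat{\mathbf{v}}_k = \hat\lambda_k \hat{\mathbf{v}}_k$ for $k = 1,\dots,m$ (with $\lambda_k$, $\hat\lambda_k$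 the eigenvalues from items 1 and 2), then there exists an orthonormal (orthogonal) matrix $\hat O \in \mathbb{R}^{m\times m}$ such that $$\|\hat V\hat O - V\|_F \leq \frac{\sqrt{8m}}{(\delta_0 - \delta)N^{1/2 - \gamma}},$$ where $\|\cdot\|_F$ is the Frobenius matrix norm, with probability at least $1 - 2N e^{-CN^{2\gamma}}$.
   Context: A graphon is a symmetric Lebesgue-measurable function $W:[0,1]^2\to[0,1]$. A ring graphon is a graphon of the form $W(x,y)=R(|x-y|)$ for a 1-periodic function $R:[0,1]\to[0,1]$, so that $W(x,y)$ depends only on $x-y$ modulo 1, i.e. $R(s)=R(1-s)$ for $s\in[0,1]$. Almost everywhere continuous means $W$ is continuous at almost every point of $[0,1]^2$. The graphon Laplacian is the operator on $L^2=L^2([0,1])$ given by $\mathcal{L}(W)f(x)=\int_0^1 W(x,y)(f(y)-f(x))\,dy$. An isolated eigenvalue is an eigenvalue that is an isolated point of the spectrum. For $N\ge 2$, the deterministic weighted adjacency matrix $\mathrm{A}_d^N=[A_{ij}^N]_{1\le i,j\le N}$ has $A_{ij}^N=W(\frac iN,\frac jN)$ for $i\ne j$ and $A_{ii}^N=0$. The random adjacency matrix $\mathrm{A}_r^N=[\xi_{i,j}^N]_{1\le i,j\le N}$ is symmetric with $\xi_{i,i}^N=0$, and the entries $\xi_{i,j}^N\in\{0,1\}$ with $i>j$ are independent with $\mathbb{P}(\xi_{i,j}^N=1)=1-\mathbb{P}(\xi_{i,j}^N=0)=W(\frac iN,\frac jN)$. The graph Laplacians are $\mathrm{L}_d^N=\mathrm{A}_d^N-\mathrm{Deg}(\mathrm{A}_d^N)$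 and $\mathrm{L}_r^N=\mathrm{A}_r^N-\mathrm{Deg}(\mathrm{A}_r^N)$, where $\mathrm{Deg}(\mathrm A)$ is the diagonal matrix of row sums of $\mathrm A$. Eigenvalues are counted with multiplicity. *)

theory Defs
  imports
    "HOL-Probability.Probability"
    "Jordan_Normal_Form.Char_Poly"
begin

text \<open>A graphon is represented by a total function on the plane of which only the values on the
  unit square matter.\<close>

definition graphon :: "(real \<Rightarrow> real \<Rightarrow> real) \<Rightarrow> bool" where
  "graphon W \<longleftrightarrow>
     case_prod W \<in> borel_measurable (lebesgue_on ({0..1} \<times> {0..1})) \<and>
     (\<forall>x\<in>{0..1}. \<forall>y\<in>{0..1}. W x y \<in> {0..1} \<and> W x y = W y x)"

definition ring_graphon :: "(real \<Rightarrow> real \<Rightarrow> real) \<Rightarrow> bool" where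
  "ring_graphon W \<longleftrightarrow> graphon W \<and>
     (\<exists>R. (\<forall>s\<in>{0..1}. R s \<in> {0..1} \<and> R s = R (1 - s)) \<and>
          (\<forall>x\<in>{0..1}. \<forall>y\<in>{0..1}. W x y = R \<bar>x - y\<bar>))"

definition ae_continuous :: "(real \<Rightarrow> real \<Rightarrow> real) \<Rightarrow> bool" where
  "ae_continuous W \<longleftrightarrow>
     (AE p in lebesgue_on ({0..1} \<times> {0..1}).
        continuous (at p within {0..1} \<times> {0..1}) (case_prod W))"

text \<open>The complex space \<open>L\<^sup>2([0,1])\<close> is handled through representatives: its elements are
  square-integrable functions, and every equation between elements is read almost everywhere.
  An operator that is bounded and linear in this sense respects equality almost everywhere.\<close>

abbreviation unit_leb :: "real measure" where
  "unit_leb \<equiv> lebesgue_on {0..1}"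

definition L2 :: "(real \<Rightarrow> complex) set" where
  "L2 = {f. f \<in> borel_measurable unit_leb \<and> integrable unit_leb (\<lambda>x. (cmod (f x))\<^sup>2)}"

definition L2_norm :: "(real \<Rightarrow> complex) \<Rightarrow> real" where
  "L2_norm f = sqrt (LINT x|unit_leb. (cmod (f x))\<^sup>2)"

definition L2_eq :: "(real \<Rightarrow> complex) \<Rightarrow> (real \<Rightarrow> complex) \<Rightarrow> bool" where
  "L2_eq f g \<longleftrightarrow> (AE x in unit_leb. f x = g x)"

definition L2_bounded_linear :: "((real \<Rightarrow> complex) \<Rightarrow> (real \<Rightarrow> complex)) \<Rightarrow> bool" where
  "L2_bounded_linear S \<longleftrightarrow>
     (\<forall>f\<in>L2. S f \<in> L2) \<and>
     (\<forall>f\<in>L2. \<forall>g\<in>L2. L2_eq (S (\<lambda>x. f x + g x)) (\<lambda>x. S f x + S g x)) \<and>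
     (\<forall>c. \<forall>f\<in>L2. L2_eq (S (\<lambda>x. c * f x)) (\<lambda>x. c * S f x)) \<and>
     (\<exists>K. \<forall>f\<in>L2. L2_norm (S f) \<le> K * L2_norm f)"

definition L2_resolvent_set :: "((real \<Rightarrow> complex) \<Rightarrow> (real \<Rightarrow> complex)) \<Rightarrow> complex set" where
  "L2_resolvent_set T =
     {z. \<exists>S. L2_bounded_linear S \<and>
           (\<forall>f\<in>L2. L2_eq (S (\<lambda>x. T f x - z * f x)) f) \<and>
           (\<forall>g\<in>L2. L2_eq (\<lambda>x. T (S g) x - z * S g x) g)}"

definition L2_spectrum :: "((real \<Rightarrow> complex) \<Rightarrow> (real \<Rightarrow> complex)) \<Rightarrow> complex set" where
  "L2_spectrum T = - L2_resolvent_set T"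

definition L2_eigenspace ::
    "((real \<Rightarrow> complex) \<Rightarrow> (real \<Rightarrow> complex)) \<Rightarrow> complex \<Rightarrow> (real \<Rightarrow> complex) set" where
  "L2_eigenspace T z = {f \<in> L2. L2_eq (T f) (\<lambda>x. z * f x)}"

definition L2_eigenvalue :: "((real \<Rightarrow> complex) \<Rightarrow> (real \<Rightarrow> complex)) \<Rightarrow> complex \<Rightarrow> bool" where
  "L2_eigenvalue T z \<longleftrightarrow> (\<exists>f\<in>L2_eigenspace T z. \<not> L2_eq f (\<lambda>x. 0))"

definition L2_isolated_eigenvalue ::
    "((real \<Rightarrow> complex) \<Rightarrow> (real \<Rightarrow> complex)) \<Rightarrow> complex \<Rightarrow> bool" where
  "L2_isolated_eigenvalue T z \<longleftrightarrow> L2_eigenvalue T z \<and> z isolated_in L2_spectrum T"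

text \<open>This is the geometric multiplicity, which for a self-adjoint operator such as the graphon
  Laplacian coincides with the algebraic one. Coefficient families are made extensional so that
  they can be unique.\<close>

definition L2_multiplicity ::
    "((real \<Rightarrow> complex) \<Rightarrow> (real \<Rightarrow> complex)) \<Rightarrow> complex \<Rightarrow> nat \<Rightarrow> bool" where
  "L2_multiplicity T z m \<longleftrightarrow>
     (\<exists>e. (\<forall>k<m. e k \<in> L2_eigenspace T z) \<and>
        (\<forall>f\<in>L2_eigenspace T z.
           \<exists>!c. c \<in> {..<m} \<rightarrow>\<^sub>E UNIV \<and> L2_eq f (\<lambda>x. \<Sum>k<m. c k * e k x)))"

definition graphon_laplacian ::
    "(real \<Rightarrow> real \<Rightarrow> real) \<Rightarrow> (real \<Rightarrow> complex) \<Rightarrow> (real \<Rightarrow> complex)" where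
  "graphon_laplacian W f = (\<lambda>x. LINT y|unit_leb. of_real (W x y) * (f y - f x))"

definition deg_matrix :: "real mat \<Rightarrow> real mat" where
  "deg_matrix A = mat_diag (dim_row A) (\<lambda>i. \<Sum>j<dim_col A. A $$ (i, j))"

definition graph_laplacian :: "real mat \<Rightarrow> real mat" where
  "graph_laplacian A = A - deg_matrix A"

definition orthonormal_columns :: "real mat \<Rightarrow> bool" where
  "orthonormal_columns V \<longleftrightarrow> transpose_mat V * V = 1\<^sub>m (dim_col V)"

definition frobenius_norm :: "real mat \<Rightarrow> real" where
  "frobenius_norm A = sqrt (\<Sum>i<dim_row A. \<Sum>j<dim_col A. (A $$ (i, j))\<^sup>2)"

text \<open>The eigenvalues \<open>x\<close> of an \<open>N \<times> N\<close> matrix with \<open>\<bar>x/N - \<mu>\<bar> < \<delta>\<close>, listed in decreasing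
  order, each repeated according to its multiplicity as a root of the characteristic polynomial.
  The matrices in question are symmetric, so all their eigenvalues are real.\<close>

definition eigenvalues_near :: "real mat \<Rightarrow> real \<Rightarrow> real \<Rightarrow> real list" where
  "eigenvalues_near L \<mu> \<delta> =
     rev (sorted_list_of_multiset
       {# x \<in># proots (char_poly L). \<bar>x / real (dim_row L) - \<mu>\<bar> < \<delta> #})"

definition eigenvector_matrix :: "real mat \<Rightarrow> real list \<Rightarrow> real mat \<Rightarrow> bool" where
  "eigenvector_matrix L ls V \<longleftrightarrow>
     V \<in> carrier_mat (dim_row L) (length ls) \<and> orthonormal_columns V \<and>
     (\<forall>k<length ls. L *\<^sub>v col V k = ls ! k \<cdot>\<^sub>v col V k)"

text \<open>Matrix indices start at 0, so entry \<open>(i, j)\<close> belongs to the sample points \<open>(i+1)/N\<close> and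
  \<open>(j+1)/N\<close>.\<close>

definition sample :: "(real \<Rightarrow> real \<Rightarrow> real) \<Rightarrow> nat \<Rightarrow> nat \<Rightarrow> nat \<Rightarrow> real" where
  "sample W N i j = W (real (i + 1) / real N) (real (j + 1) / real N)"

definition det_adjacency :: "(real \<Rightarrow> real \<Rightarrow> real) \<Rightarrow> nat \<Rightarrow> real mat" where
  "det_adjacency W N = Matrix.mat N N (\<lambda>(i, j). if i = j then 0 else sample W N i j)"

text \<open>Independence is required below the diagonal only; the rest is determined by symmetry.
  The predicate \<open>indep_vars\<close> includes the measurability of these entries.\<close>

definition random_adjacency ::
    "(real \<Rightarrow> real \<Rightarrow> real) \<Rightarrow> nat \<Rightarrow> 'w measure \<Rightarrow> ('w \<Rightarrow> real mat) \<Rightarrow> bool" where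
  "random_adjacency W N M A \<longleftrightarrow>
     prob_space M \<and>
     (\<forall>\<omega>\<in>space M. A \<omega> \<in> carrier_mat N N \<and>
        (\<forall>i<N. A \<omega> $$ (i, i) = 0) \<and>
        (\<forall>i<N. \<forall>j<N. A \<omega> $$ (i, j) \<in> {0, 1} \<and> A \<omega> $$ (i, j) = A \<omega> $$ (j, i))) \<and>
     prob_space.indep_vars M (\<lambda>_. borel) (\<lambda>p \<omega>. A \<omega> $$ p) {(i, j). j < i \<and> i < N} \<and>
     (\<forall>i<N. \<forall>j<i. measure M {\<omega> \<in> space M. A \<omega> $$ (i, j) = 1} = sample W N i j \<and>
                  measure M {\<omega> \<in> space M. A \<omega> $$ (i, j) = 0} = 1 - sample W N i j)"

end

theory Submission
  imports Defs "HOL-Real_Asymp.Real_Asymp"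
begin

text \<open>A ring graphon acts on functions on the circle as a convolution with a kernel \<open>\<rho>\<close>, minus
  multiplication by the constant degree. Hence the Fourier modes are eigenfunctions, with eigenvalues
  \<open>mode_coeff k - mode_coeff 0\<close> where \<open>mode_coeff k\<close> is the \<open>k\<close>-th Fourier coefficient of \<open>\<rho>\<close>. Since the
  Fourier coefficients determine a function (\<open>fourier_uniqueness\<close>), there are no other eigenfunctions:
  the multiplicity of \<open>\<mu>\<close> is the number of modes with this eigenvalue (\<open>multiplicity_modes\<close>). Isolation
  gives a distance \<open>g\<close> from \<open>\<mu>\<close> to the eigenvalues of all other modes (\<open>coeff_gap\<close>). As \<open>m\<close> is finite and
  the coefficients tend to \<open>0\<close>, the accumulation point \<open>- mode_coeff 0\<close> has distance at least \<open>g\<close> too.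

  The sampled Laplacian \<open>L\<^sub>d\<close> is circulant, so that the restrictions of the Fourier modes to the sample
  points diagonalise it (\<open>circulant_eigenvector\<close>). Its eigenvalues divided by \<open>N\<close> are
  \<open>sample_coeff N k - sample_coeff N 0\<close>, where \<open>sample_coeff N k\<close> is the Riemann sum of the integral
  \<open>mode_coeff k\<close> and \<open>k\<close> runs through the residues modulo \<open>N\<close>. Almost everywhere continuity makes these
  Riemann sums converge for each \<open>k\<close> (\<open>riemann_sum_tendsto\<close>). This says nothing about the frequencies
  that grow with \<open>N\<close>; for them one needs that \<open>sample_coeff N k\<close> is small for large \<open>\<bar>k\<bar> \<le> N/2\<close> uniformly
  in \<open>N\<close>, a discrete Riemann-Lebesgue lemma (\<open>discrete_fourier_decay\<close>). Together they show that, for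
  large \<open>N\<close>, exactly \<open>m\<close> eigenvalues of \<open>L\<^sub>d / N\<close> lie within any small \<open>\<delta>\<close> of \<open>\<mu>\<close>, and no others lie
  within the radius \<open>r = g/2\<close> (\<open>sampled_eigenvalues_near\<close>).

  The random Laplacian \<open>L\<^sub>r\<close> differs from \<open>L\<^sub>d\<close> by a symmetric matrix of independent centred bounded
  entries and by the diagonal matrix of its row sums. Hoeffding's inequality, applied to the row sums and
  to the bilinear form of the matrix at the points of a net, bounds the operator norm of \<open>L\<^sub>r - L\<^sub>d\<close> by
  \<open>2 N\<^bsup>1/2 + \<gamma>\<^esup>\<close> with probability at least \<open>1 - 2 N exp (- N\<^bsup>2 \<gamma>\<^esup> / 2)\<close> (\<open>laplacian_concentration\<close>). The
  constant \<open>C = 1/2\<close> therefore serves for all \<open>\<gamma>\<close>.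

  The rest is perturbation theory of symmetric matrices. A perturbation of norm \<open>\<epsilon>\<close> does not reduce the
  number of eigenvalues in an interval if the interval is enlarged by more than \<open>\<epsilon>\<close> on both sides
  (\<open>card_eigenvalues_perturbed\<close>), and \<open>N\<^bsup>1/2 + \<gamma>\<^esup>\<close> is much smaller than the gap of order \<open>r N\<close>. So \<open>L\<^sub>r\<close> has
  \<open>m\<close> eigenvalues near \<open>\<mu> N\<close> as well. An eigenvector of \<open>L\<^sub>d\<close> for one of the \<open>m\<close> eigenvalues satisfies the
  eigenvalue equation of \<open>L\<^sub>r\<close> up to \<open>\<epsilon>\<close>, so that its component in the other spectral subspaces of \<open>L\<^sub>r\<close>
  is at most \<open>\<epsilon>\<close> divided by the gap (\<open>residual_far_component\<close>). The orthogonal polar factor of the matrix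
  of inner products then aligns the two families with squared Frobenius error at most twice the sum of
  these squared components (\<open>orthonormal_alignment\<close>). With the gap \<open>r N / 4\<close> left between the two groups of
  eigenvalues this is the claimed bound for \<open>\<delta>\<^sub>0 = r / 4\<close>.\<close>

section \<open>Spectral theory of real symmetric matrices\<close>

text \<open>Vectors of length \<open>n\<close> are functions on the naturals of which the values below \<open>n\<close> matter, and
  \<open>ip\<close> and \<open>app\<close> are the inner product and the application of a matrix. A family of
  vectors is a function as well, so that it can be extended one vector at a time.\<close>

definition ip :: "nat \<Rightarrow> (nat \<Rightarrow> real) \<Rightarrow> (nat \<Rightarrow> real) \<Rightarrow> real" where
  "ip n x y = (\<Sum>i<n. x i * y i)"

definition app :: "nat \<Rightarrow> (nat \<Rightarrow> nat \<Rightarrow> real) \<Rightarrow> (nat \<Rightarrow> real) \<Rightarrow> nat \<Rightarrow> real" where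
  "app n L x i = (\<Sum>j<n. L i j * x j)"

definition entries :: "real mat \<Rightarrow> nat \<Rightarrow> nat \<Rightarrow> real" where
  "entries A i j = A $$ (i, j)"

definition operator_close :: "nat \<Rightarrow> real \<Rightarrow> (nat \<Rightarrow> nat \<Rightarrow> real) \<Rightarrow> (nat \<Rightarrow> nat \<Rightarrow> real) \<Rightarrow> bool" where
  "operator_close n \<epsilon> K L \<longleftrightarrow>
     (\<forall>x. L2_set (\<lambda>i. app n L x i - app n K x i) {..<n} \<le> \<epsilon> * L2_set x {..<n})"

definition orthonormal_family :: "nat \<Rightarrow> nat \<Rightarrow> (nat \<Rightarrow> nat \<Rightarrow> real) \<Rightarrow> bool" where
  "orthonormal_family n k u \<longleftrightarrow>
     (\<forall>a<k. \<forall>b<k. ip n (u a) (u b) = (if a = b then 1 else 0))"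

definition eigen_family ::
    "nat \<Rightarrow> (nat \<Rightarrow> nat \<Rightarrow> real) \<Rightarrow> nat \<Rightarrow> (nat \<Rightarrow> nat \<Rightarrow> real) \<Rightarrow> (nat \<Rightarrow> real) \<Rightarrow> bool" where
  "eigen_family n L k u l \<longleftrightarrow>
     orthonormal_family n k u \<and> (\<forall>a<k. \<forall>i<n. app n L (u a) i = l a * u a i)"

definition symmetric :: "nat \<Rightarrow> (nat \<Rightarrow> nat \<Rightarrow> real) \<Rightarrow> bool" where
  "symmetric n L \<longleftrightarrow> (\<forall>i<n. \<forall>j<n. L i j = L j i)"

lemma ip_commute: "ip n x y = ip n y x"
  by (simp add: ip_def mult.commute)

lemma ip_diff_left: "ip n (\<lambda>i. x i - y i) z = ip n x z - ip n y z"
  by (simp add: ip_def sum_subtractf left_diff_distrib)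

lemma ip_scale_left: "ip n (\<lambda>i. c * x i) z = c * ip n x z"
  by (simp add: ip_def sum_distrib_left mult.assoc)

lemma ip_scale_right: "ip n z (\<lambda>i. c * x i) = c * ip n z x"
  by (simp add: ip_def sum_distrib_left mult_ac)

lemma ip_sum_left: "ip n (\<lambda>i. \<Sum>a\<in>A. d a * x a i) z = (\<Sum>a\<in>A. d a * ip n (x a) z)"
  unfolding ip_def sum_distrib_right sum_distrib_left
  by (subst sum.swap) (simp add: mult.assoc)

lemma ip_sum_right: "ip n z (\<lambda>i. \<Sum>a\<in>A. d a * x a i) = (\<Sum>a\<in>A. d a * ip n z (x a))"
  by (simp only: ip_commute[of n z] ip_sum_left)

lemma ip_cong: "(\<And>i. i < n \<Longrightarrow> x i = x' i) \<Longrightarrow> (\<And>i. i < n \<Longrightarrow> y i = y' i) \<Longrightarrow> ip n x y = ip n x' y'"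
  by (simp add: ip_def)

lemma ip_self_nonneg: "0 \<le> ip n x x"
  by (simp add: ip_def sum_nonneg)

lemma ip_self_eq_0_iff: "ip n x x = 0 \<longleftrightarrow> (\<forall>i<n. x i = 0)"
  by (auto simp: ip_def sum_nonneg_eq_0_iff)

lemma ip_self_eq_L2_set: "ip n x x = (L2_set x {..<n})\<^sup>2"
  by (simp add: ip_def L2_set_def sum_nonneg power2_eq_square)

lemma app_symmetric:
  assumes "symmetric n L"
  shows "ip n (app n L x) y = ip n x (app n L y)"
proof -
  have "ip n (app n L x) y = (\<Sum>i<n. \<Sum>j<n. L i j * x j * y i)"
    by (simp add: ip_def app_def sum_distrib_right)
  also have "\<dots> = (\<Sum>j<n. \<Sum>i<n. L i j * x j * y i)"
    by (rule sum.swap)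
  also have "\<dots> = (\<Sum>j<n. \<Sum>i<n. x j * (L j i * y i))"
    using assms by (intro sum.cong) (auto simp: symmetric_def)
  finally show ?thesis
    by (simp add: ip_def app_def sum_distrib_left)
qed

lemma operator_close_mono: "operator_close n \<epsilon> K L \<Longrightarrow> \<epsilon> \<le> \<epsilon>' \<Longrightarrow> operator_close n \<epsilon>' K L"
  unfolding operator_close_def by (meson L2_set_nonneg mult_right_mono order_trans)

lemma operator_close_sym: "operator_close n \<epsilon> K L \<Longrightarrow> operator_close n \<epsilon> L K"
  by (simp add: operator_close_def L2_set_def power2_commute)

text \<open>Gaussian elimination of one equation at a time.\<close>

lemma underdetermined_system:
  fixes C :: "'b \<Rightarrow> 'c \<Rightarrow> 'a :: field"
  assumes "finite T" "finite S" "card T < card S"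
  shows "\<exists>d. (\<exists>s\<in>S. d s \<noteq> 0) \<and> (\<forall>t\<in>T. (\<Sum>s\<in>S. d s * C s t) = 0)"
  using assms
proof (induction T arbitrary: S C rule: finite_induct)
  case empty
  then have "S \<noteq> {}" by auto
  then show ?case by (intro exI[of _ "\<lambda>_. 1"]) auto
next
  case (insert t T)
  show ?case
  proof (cases "\<forall>s\<in>S. C s t = 0")
    case True
    moreover have "card T < card S" using insert by simp
    ultimately show ?thesis
      using insert.IH[of S C] insert.prems(1) by auto
  next
    case False
    then obtain s0 where s0: "s0 \<in> S" "C s0 t \<noteq> 0" by auto
    have card: "card T < card (S - {s0})"
      using insert s0 by simp
    define C' where "C' s t' = C s t' - C s t / C s0 t * C s0 t'" for s t'
    obtain d s1 where d: "s1 \<in> S - {s0}" "d s1 \<noteq> 0"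
        "\<And>t'. t' \<in> T \<Longrightarrow> (\<Sum>s\<in>S - {s0}. d s * C' s t') = 0"
      using insert.IH[of "S - {s0}" C'] card insert.prems(1) by auto
    define e where "e = (- (\<Sum>s\<in>S - {s0}. d s * C s t) / C s0 t)"
    define d' where "d' = d(s0 := e)"
    have split: "(\<Sum>s\<in>S. d' s * C s t') = e * C s0 t' + (\<Sum>s\<in>S - {s0}. d s * C s t')" for t'
      using insert.prems(1) s0(1) by (subst sum.remove[of _ s0]) (auto simp: d'_def intro: sum.cong)
    have "(\<Sum>s\<in>S. d' s * C s t') = 0" if "t' \<in> insert t T" for t'
    proof (cases "t' = t")
      case True
      then show ?thesis using s0 by (simp add: split e_def)
    next
      case False
      with that have "t' \<in> T" by simp
      then have "0 = (\<Sum>s\<in>S - {s0}. d s * C s t' - d s * C s t * (C s0 t' / C s0 t))"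
        using d(3)[of t'] by (simp add: C'_def algebra_simps)
      also have "\<dots> = (\<Sum>s\<in>S - {s0}. d s * C s t') - (\<Sum>s\<in>S - {s0}. d s * C s t) * (C s0 t' / C s0 t)"
        by (simp only: sum_subtractf sum_distrib_right)
      also have "\<dots> = e * C s0 t' + (\<Sum>s\<in>S - {s0}. d s * C s t')"
        by (simp add: e_def)
      finally show ?thesis by (simp add: split)
    qed
    moreover have "\<exists>s\<in>S. d' s \<noteq> 0"
      using d(1,2) by (auto simp: d'_def)
    ultimately show ?thesis by blast
  qed
qed

text \<open>Fewer than \<open>n\<close> linear equations in \<open>n\<close> unknowns leave room for one more orthogonal vector.\<close>

lemma orthonormal_extend:
  assumes u: "orthonormal_family n k u" and "k < n"
  shows "\<exists>x. orthonormal_family n (Suc k) (u(k := x))"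
proof -
  obtain d where d: "\<exists>i<n. d i \<noteq> 0" "\<And>a. a < k \<Longrightarrow> (\<Sum>i<n. d i * u a i) = 0"
    using underdetermined_system[of "{..<k}" "{..<n}" "\<lambda>i a. u a i"] \<open>k < n\<close> by auto
  have pos: "ip n d d > 0"
    using d(1) ip_self_nonneg[of n d] ip_self_eq_0_iff[of n d] by fastforce
  define x where "x i = 1 / sqrt (ip n d d) * d i" for i
  have "ip n x (u a) = 0" if "a < k" for a
    using d(2)[OF that] unfolding x_def[abs_def] ip_scale_left by (simp add: ip_def)
  moreover have "ip n x x = 1"
    unfolding x_def[abs_def] ip_scale_left ip_scale_right using pos by simp
  ultimately show ?thesis
    using u unfolding orthonormal_family_def
    by (intro exI[of _ x]) (auto simp: less_Suc_eq ip_commute)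
qed

lemma orthonormal_completion:
  assumes "orthonormal_family n k u" and "k \<le> n"
  shows "\<exists>w. orthonormal_family n n w \<and> (\<forall>a<k. w a = u a)"
  using assms(2,1)
proof (induction k arbitrary: u rule: inc_induct)
  case base
  then show ?case by auto
next
  case (step k)
  obtain x where "orthonormal_family n (Suc k) (u(k := x))"
    using orthonormal_extend[OF step.prems step.hyps(2)] by auto
  from step.IH[OF this] obtain w where
    w: "orthonormal_family n n w" "\<forall>a<Suc k. w a = (u(k := x)) a"
    by auto
  then have "\<forall>a<k. w a = u a" by simp
  with w(1) show ?case by blast
qed

text \<open>A square matrix with orthonormal rows also has orthonormal columns.\<close>

lemma parseval:
  assumes "orthonormal_family n n u"
  shows "ip n x y = (\<Sum>a<n. ip n x (u a) * ip n y (u a))"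
proof -
  define M where "M = Matrix.mat n n (\<lambda>(a, i). u a i)"
  have M: "M \<in> carrier_mat n n" by (simp add: M_def)
  have "M * transpose_mat M = 1\<^sub>m n"
    using assms by (intro eq_matI)
      (auto simp: M_def orthonormal_family_def ip_def scalar_prod_def lessThan_atLeast0)
  then have "transpose_mat M * M = 1\<^sub>m n"
    using mat_mult_left_right_inverse[of M n "transpose_mat M"] M by simp
  then have eq: "(transpose_mat M * M) $$ (i, j) = (if i = j then 1 else 0)" if "i < n" "j < n" for i j
    using that by simp
  have delta: "(\<Sum>a<n. u a i * u a j) = (if i = j then 1 else 0)" if "i < n" "j < n" for i j
    using eq[OF that] that by (simp add: M_def scalar_prod_def lessThan_atLeast0)
  have "(\<Sum>a<n. ip n x (u a) * ip n y (u a))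
      = (\<Sum>a<n. \<Sum>i<n. \<Sum>j<n. x i * y j * (u a i * u a j))"
    by (simp add: ip_def sum_product algebra_simps)
  also have "\<dots> = (\<Sum>i<n. \<Sum>a<n. \<Sum>j<n. x i * y j * (u a i * u a j))"
    by (rule sum.swap)
  also have "\<dots> = (\<Sum>i<n. \<Sum>j<n. \<Sum>a<n. x i * y j * (u a i * u a j))"
    by (intro sum.cong refl sum.swap)
  also have "\<dots> = (\<Sum>i<n. \<Sum>j<n. x i * y j * (if i = j then 1 else 0))"
    by (intro sum.cong refl) (simp add: delta flip: sum_distrib_left)
  also have "\<dots> = ip n x y"
    by (simp add: ip_def if_distrib sum.delta cong: if_cong)
  finally show ?thesis by simp
qed

lemma orthonormal_expansion:
  assumes "orthonormal_family n n u" "i < n"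
  shows "x i = (\<Sum>a<n. ip n x (u a) * u a i)"
proof -
  have ei: "ip n z (\<lambda>j. if j = i then 1 else 0) = z i" for z
    using assms(2) by (simp add: ip_def if_distrib sum.delta cong: if_cong)
  have "x i = ip n x (\<lambda>j. if j = i then 1 else 0)"
    by (simp add: ei)
  also have "\<dots> = (\<Sum>a<n. ip n x (u a) * ip n (\<lambda>j. if j = i then 1 else 0) (u a))"
    by (rule parseval[OF assms(1)])
  finally show ?thesis
    by (simp only: ip_commute[of n "\<lambda>j. if j = i then 1 else 0"] ei)
qed

text \<open>A complex eigenvector exists by the fundamental theorem of algebra. Symmetry makes
  its eigenvalue real, and then its real or its imaginary part is a real eigenvector.\<close>

lemma symmetric_has_eigenvector:
  assumes sym: "symmetric n L" and "0 < n"
  shows "\<exists>r c. (\<exists>i<n. c i \<noteq> 0) \<and> (\<forall>i<n. app n L c i = r * c i)"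
proof -
  define B where "B = Matrix.mat n n (\<lambda>(i, j). complex_of_real (L i j))"
  have B: "B \<in> carrier_mat n n" by (simp add: B_def)
  obtain zs where zs: "char_poly B = (\<Prod>a\<leftarrow>zs. [:- a, 1:])" "length zs = n"
    using char_poly_factorized[OF B] by auto
  then have "hd zs \<in> set zs" using \<open>0 < n\<close> by (cases zs) auto
  then have "poly (char_poly B) (hd zs) = 0"
    unfolding zs(1) by (auto simp: poly_prod_list prod_list_zero_iff image_iff intro!: bexI[of _ "hd zs"])
  then obtain v where "eigenvector B v (hd zs)"
    using eigenvalue_root_char_poly[OF B] by (auto simp: eigenvalue_def)
  then have v: "v \<in> carrier_vec n" "v \<noteq> 0\<^sub>v n" "B *\<^sub>v v = hd zs \<cdot>\<^sub>v v"
    using B by (auto simp: eigenvector_def)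
  define w where "w i = v $ i" for i
  define z where "z = hd zs"
  have eig: "(\<Sum>j<n. of_real (L i j) * w j) = z * w i" if "i < n" for i
  proof -
    have "(B *\<^sub>v v) $ i = z * w i"
      using v that by (simp add: z_def w_def)
    then show ?thesis
      using that v(1) B by (simp add: B_def scalar_prod_def w_def lessThan_atLeast0 row_def)
  qed
  obtain i0 where i0: "i0 < n" "w i0 \<noteq> 0"
    using v(1,2) unfolding w_def by (metis carrier_vecD eq_vecI index_zero_vec(1,2))
  have norm_pos: "(\<Sum>i<n. (cmod (w i))\<^sup>2) > 0"
    using i0 by (intro sum_pos2[of _ i0]) auto
  define q where "q = (\<Sum>i<n. \<Sum>j<n. cnj (w i) * of_real (L i j) * w j)"
  have "q = (\<Sum>i<n. cnj (w i) * (\<Sum>j<n. of_real (L i j) * w j))"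
    by (simp add: q_def sum_distrib_left mult.assoc)
  also have "\<dots> = (\<Sum>i<n. cnj (w i) * (z * w i))"
    using eig by simp
  also have "\<dots> = z * of_real (\<Sum>i<n. (cmod (w i))\<^sup>2)"
    by (simp add: sum_distrib_left complex_norm_square algebra_simps del: of_real_power)
  finally have q: "q = z * of_real (\<Sum>i<n. (cmod (w i))\<^sup>2)" .
  have "cnj q = (\<Sum>i<n. \<Sum>j<n. w i * of_real (L i j) * cnj (w j))"
    by (simp add: q_def)
  also have "\<dots> = (\<Sum>j<n. \<Sum>i<n. w i * of_real (L i j) * cnj (w j))"
    by (rule sum.swap)
  also have "\<dots> = q"
    unfolding q_def using sym
    by (intro sum.cong) (auto simp: symmetric_def algebra_simps)
  finally have "cnj z = z"
    using q norm_pos by (auto simp del: of_real_sum)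
  then have z: "Im z = 0"
    by (metis complex_cnj_cancel_iff Reals_cnj_iff complex_is_Real_iff)
  have re: "app n L (\<lambda>i. Re (w i)) i = Re z * Re (w i)" if "i < n" for i
    using arg_cong[OF eig[OF that], of Re] z by (simp add: app_def)
  have im: "app n L (\<lambda>i. Im (w i)) i = Re z * Im (w i)" if "i < n" for i
    using arg_cong[OF eig[OF that], of Im] z by (simp add: app_def)
  have "Re (w i0) \<noteq> 0 \<or> Im (w i0) \<noteq> 0"
    using i0 by (auto simp: complex_eq_iff)
  then show ?thesis
  proof
    assume "Re (w i0) \<noteq> 0"
    with i0(1) re show ?thesis
      by (intro exI[of _ "Re z"] exI[of _ "\<lambda>i. Re (w i)"]) auto
  next
    assume "Im (w i0) \<noteq> 0"
    with i0(1) im show ?thesis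
      by (intro exI[of _ "Re z"] exI[of _ "\<lambda>i. Im (w i)"]) auto
  qed
qed

text \<open>A symmetric matrix maps the orthogonal complement of a family of its eigenvectors into itself. An
  eigenvector of its restriction to the complement is a further eigenvector.\<close>

lemma eigen_extend:
  assumes sym: "symmetric n L" and u: "eigen_family n L k u l" and "k < n"
  shows "\<exists>x r. eigen_family n L (Suc k) (u(k := x)) (l(k := r))"
proof -
  obtain w where w: "orthonormal_family n n w" "\<forall>a<k. w a = u a"
    using orthonormal_completion[of n k u] u \<open>k < n\<close> by (auto simp: eigen_family_def)
  \<comment> \<open>the compression of \<open>L\<close> to the orthogonal complement of the family\<close>
  define B where "B i j = ip n (w (k + i)) (app n L (w (k + j)))" for i j
  have "symmetric (n - k) B"
    using app_symmetric[OF sym] by (auto simp: symmetric_def B_def ip_commute)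
  then obtain r c where rc: "\<exists>i<n - k. c i \<noteq> 0" "\<And>i. i < n - k \<Longrightarrow> app (n - k) B c i = r * c i"
    using symmetric_has_eigenvector[of "n - k" B] \<open>k < n\<close> by auto
  define y where "y i = (\<Sum>j<n - k. c j * w (k + j) i)" for i
  have wy: "ip n y (w a) = (if a < k then 0 else c (a - k))" if "a < n" for a
  proof -
    have "ip n y (w a) = (\<Sum>j<n - k. c j * ip n (w (k + j)) (w a))"
      unfolding y_def[abs_def] by (rule ip_sum_left)
    also have "\<dots> = (\<Sum>j<n - k. if a = k + j then c j else 0)"
      using w(1) that by (intro sum.cong) (auto simp: orthonormal_family_def)
    also have "\<dots> = (if a < k then 0 else c (a - k))"
    proof (cases "a < k")
      case False
      then have "(\<Sum>j<n - k. if a = k + j then c j else 0) = (\<Sum>j<n - k. if j = a - k then c j else 0)"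
        by (intro sum.cong) auto
      with False that show ?thesis by (simp add: sum.delta)
    qed (auto intro: sum.neutral)
    finally show ?thesis .
  qed
  have app_y: "app n L y i = (\<Sum>j<n - k. c j * app n L (w (k + j)) i)" for i
    unfolding y_def[abs_def] app_def sum_distrib_left
    by (subst sum.swap) (simp add: mult_ac)
  have Ly: "ip n (app n L y) (w a) = r * ip n y (w a)" if "a < n" for a
  proof (cases "a < k")
    case True
    have "ip n (app n L y) (w a) = ip n y (app n L (w a))"
      by (rule app_symmetric[OF sym])
    also have "\<dots> = ip n y (\<lambda>i. l a * w a i)"
      using u w(2) True by (intro ip_cong) (auto simp: eigen_family_def)
    also have "\<dots> = 0"
      using wy[OF that] True by (simp add: ip_scale_right)
    finally show ?thesis using wy[OF that] True by simp
  next
    case False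
    then have "a - k < n - k" using that by simp
    have "ip n (app n L y) (w a) = ip n (\<lambda>i. \<Sum>j<n - k. c j * app n L (w (k + j)) i) (w a)"
      by (simp add: app_y[abs_def])
    also have "\<dots> = app (n - k) B c (a - k)"
      unfolding ip_sum_left using False
      by (simp add: app_def[of "n - k"] B_def mult.commute ip_commute[of n "app n L x" "w a" for x])
    also have "\<dots> = r * ip n y (w a)"
      using rc(2)[OF \<open>a - k < n - k\<close>] wy[OF that] False by simp
    finally show ?thesis .
  qed
  have eig: "app n L y i = r * y i" if "i < n" for i
  proof -
    have "app n L y i = (\<Sum>a<n. ip n (app n L y) (w a) * w a i)"
      by (rule orthonormal_expansion[OF w(1) that])
    also have "\<dots> = r * (\<Sum>a<n. ip n y (w a) * w a i)"
      using Ly by (simp add: sum_distrib_left mult.assoc)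
    also have "\<dots> = r * y i"
      using orthonormal_expansion[OF w(1) that, of y] by simp
    finally show ?thesis .
  qed
  obtain i0 where i0: "i0 < n - k" "c i0 \<noteq> 0" using rc(1) by auto
  have "ip n y (w (k + i0)) \<noteq> 0"
    using wy[of "k + i0"] i0 by simp
  then have "\<not> (\<forall>i<n. y i = 0)"
    by (auto simp: ip_def intro!: sum.neutral)
  then have pos: "ip n y y > 0"
    using ip_self_nonneg[of n y] ip_self_eq_0_iff[of n y] by fastforce
  define x where "x i = 1 / sqrt (ip n y y) * y i" for i
  have "ip n x (u a) = 0" if "a < k" for a
    using wy[of a] that \<open>k < n\<close> w(2) unfolding x_def[abs_def] ip_scale_left by simp
  moreover have "ip n x x = 1"
    unfolding x_def[abs_def] ip_scale_left ip_scale_right using pos by simp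
  moreover have "app n L x i = r * x i" if "i < n" for i
  proof -
    have "app n L x i = 1 / sqrt (ip n y y) * app n L y i"
      by (simp add: app_def x_def sum_distrib_left mult_ac)
    then show ?thesis using eig[OF that] by (simp add: x_def)
  qed
  ultimately have "eigen_family n L (Suc k) (u(k := x)) (l(k := r))"
    using u unfolding eigen_family_def orthonormal_family_def
    by (auto simp: less_Suc_eq ip_commute)
  then show ?thesis by blast
qed

text \<open>The spectral theorem in the form that every orthonormal family of eigenvectors extends to
  an eigenbasis.\<close>

lemma eigen_completion:
  assumes sym: "symmetric n L" and "k \<le> n" and u: "eigen_family n L k u l"
  shows "\<exists>w l'. eigen_family n L n w l' \<and> (\<forall>a<k. w a = u a \<and> l' a = l a)"
  using assms(2,3)
proof (induction k arbitrary: u l rule: inc_induct)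
  case base
  then show ?case by auto
next
  case (step k)
  obtain x r where "eigen_family n L (Suc k) (u(k := x)) (l(k := r))"
    using eigen_extend[OF sym step.prems step.hyps(2)] by auto
  from step.IH[OF this] obtain w l' where
    w: "eigen_family n L n w l'" "\<forall>a<Suc k. w a = (u(k := x)) a \<and> l' a = (l(k := r)) a"
    by auto
  then have "\<forall>a<k. w a = u a \<and> l' a = l a" by simp
  with w(1) show ?case by blast
qed

lemma eigenbasis_exists:
  assumes "symmetric n L"
  shows "\<exists>w l. eigen_family n L n w l"
  using eigen_completion[OF assms, of 0] by (auto simp: eigen_family_def orthonormal_family_def)

lemma orthonormal_sum:
  assumes "orthonormal_family n k u" and "m \<le> k" and "a < m"
  shows "(\<Sum>b<m. d b * ip n (u a) (u b)) = d a"
proof -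
  have "(\<Sum>b<m. d b * ip n (u a) (u b)) = (\<Sum>b<m. if a = b then d b else 0)"
    using assms by (intro sum.cong) (auto simp: orthonormal_family_def)
  then show ?thesis using assms by simp
qed

lemma eigen_quadratic_form:
  assumes sym: "symmetric n L" and u: "eigen_family n L n u l"
  shows "(L2_set (\<lambda>i. app n L x i - c * x i) {..<n})\<^sup>2 = (\<Sum>a<n. (l a - c)\<^sup>2 * (ip n x (u a))\<^sup>2)"
proof -
  have "ip n (\<lambda>i. app n L x i - c * x i) (u a) = (l a - c) * ip n x (u a)" if "a < n" for a
  proof -
    have "ip n (app n L x) (u a) = ip n x (\<lambda>i. l a * u a i)"
      unfolding app_symmetric[OF sym] using u that by (intro ip_cong) (auto simp: eigen_family_def)
    then show ?thesis
      by (simp add: ip_diff_left ip_scale_left ip_scale_right algebra_simps)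
  qed
  then have "ip n (\<lambda>i. app n L x i - c * x i) (\<lambda>i. app n L x i - c * x i)
      = (\<Sum>a<n. ((l a - c) * ip n x (u a)) * ((l a - c) * ip n x (u a)))"
    using u by (subst parseval[of n u]) (auto simp: eigen_family_def)
  then show ?thesis
    by (simp add: ip_self_eq_L2_set power2_eq_square algebra_simps)
qed

section \<open>Perturbation of eigenvalues and eigenvectors\<close>

text \<open>If there were more eigenvalues of \<open>K\<close> near \<open>c\<close> than of \<open>L\<close>, some vector would be a
  combination of the corresponding eigenvectors of \<open>K\<close> and orthogonal to those of \<open>L\<close>; on it
  \<open>K - c\<close> is small and \<open>L - c\<close> is large.\<close>

lemma card_eigenvalues_perturbed:
  assumes K: "symmetric n K" "eigen_family n K n u1 l1"
    and L: "symmetric n L" "eigen_family n L n u2 l2"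
    and close: "operator_close n \<epsilon> K L"
    and r: "0 \<le> r1" "r1 + \<epsilon> < r2" "0 \<le> r2"
  shows "card {a. a < n \<and> \<bar>l1 a - c\<bar> \<le> r1} \<le> card {a. a < n \<and> \<bar>l2 a - c\<bar> < r2}"
proof (rule ccontr)
  define S1 where "S1 = {a. a < n \<and> \<bar>l1 a - c\<bar> \<le> r1}"
  define S2 where "S2 = {a. a < n \<and> \<bar>l2 a - c\<bar> < r2}"
  assume "\<not> ?thesis"
  then have "card S2 < card S1" by (simp add: S1_def S2_def)
  moreover have fin: "finite S1" "finite S2" by (simp_all add: S1_def S2_def)
  ultimately obtain d s where d: "s \<in> S1" "d s \<noteq> 0"
      "\<And>b. b \<in> S2 \<Longrightarrow> (\<Sum>a\<in>S1. d a * ip n (u1 a) (u2 b)) = 0"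
    using underdetermined_system[of S2 S1 "\<lambda>a b. ip n (u1 a) (u2 b)"] by auto
  define x where "x i = (\<Sum>a\<in>S1. d a * u1 a i)" for i
  have x1: "ip n x (u1 a) = (if a \<in> S1 then d a else 0)" if "a < n" for a
  proof -
    have "ip n x (u1 a) = (\<Sum>b\<in>S1. d b * (if b = a then 1 else 0))"
      unfolding x_def[abs_def] ip_sum_left using K(2) that
      by (intro sum.cong) (auto simp: eigen_family_def orthonormal_family_def S1_def)
    then show ?thesis using fin by (simp add: if_distrib sum.delta cong: if_cong)
  qed
  have x2: "ip n x (u2 b) = 0" if "b \<in> S2" for b
    unfolding x_def[abs_def] ip_sum_left using d(3)[OF that] by simp
  have o1: "orthonormal_family n n u1" and o2: "orthonormal_family n n u2"
    using K(2) L(2) by (auto simp: eigen_family_def)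
  have x_norm1: "(L2_set x {..<n})\<^sup>2 = (\<Sum>a<n. (ip n x (u1 a))\<^sup>2)"
    using parseval[OF o1, of x x] by (simp add: ip_self_eq_L2_set power2_eq_square)
  have x_norm2: "(L2_set x {..<n})\<^sup>2 = (\<Sum>a<n. (ip n x (u2 a))\<^sup>2)"
    using parseval[OF o2, of x x] by (simp add: ip_self_eq_L2_set power2_eq_square)
  have "s < n" using d(1) by (simp add: S1_def)
  then have "0 < (ip n x (u1 s))\<^sup>2"
    using x1 d by simp
  also have "\<dots> \<le> (L2_set x {..<n})\<^sup>2"
    unfolding x_norm1 using \<open>s < n\<close> by (intro member_le_sum) auto
  finally have pos: "0 < L2_set x {..<n}"
    by (simp add: L2_set_nonneg less_le)
  have "(L2_set (\<lambda>i. app n K x i - c * x i) {..<n})\<^sup>2 \<le> (\<Sum>a<n. r1\<^sup>2 * (ip n x (u1 a))\<^sup>2)"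
    unfolding eigen_quadratic_form[OF K]
  proof (rule sum_mono)
    fix a assume "a \<in> {..<n}"
    then show "(l1 a - c)\<^sup>2 * (ip n x (u1 a))\<^sup>2 \<le> r1\<^sup>2 * (ip n x (u1 a))\<^sup>2"
      using x1[of a] r(1) by (auto simp: S1_def intro!: mult_right_mono abs_le_square_iff[THEN iffD1])
  qed
  also have "\<dots> = (r1 * L2_set x {..<n})\<^sup>2"
    by (simp add: power_mult_distrib x_norm1 sum_distrib_left)
  finally have small: "L2_set (\<lambda>i. app n K x i - c * x i) {..<n} \<le> r1 * L2_set x {..<n}"
    by (rule power2_le_imp_le) (simp add: r L2_set_nonneg)
  have "(r2 * L2_set x {..<n})\<^sup>2 = (\<Sum>a<n. r2\<^sup>2 * (ip n x (u2 a))\<^sup>2)"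
    by (simp add: power_mult_distrib x_norm2 sum_distrib_left)
  also have "\<dots> \<le> (L2_set (\<lambda>i. app n L x i - c * x i) {..<n})\<^sup>2"
    unfolding eigen_quadratic_form[OF L]
  proof (rule sum_mono)
    fix a assume a: "a \<in> {..<n}"
    show "r2\<^sup>2 * (ip n x (u2 a))\<^sup>2 \<le> (l2 a - c)\<^sup>2 * (ip n x (u2 a))\<^sup>2"
    proof (cases "a \<in> S2")
      case False
      then have "\<bar>r2\<bar> \<le> \<bar>l2 a - c\<bar>" using a r(3) by (auto simp: S2_def)
      then show ?thesis by (intro mult_right_mono) (simp_all add: abs_le_square_iff)
    qed (simp add: x2)
  qed
  finally have large: "r2 * L2_set x {..<n} \<le> L2_set (\<lambda>i. app n L x i - c * x i) {..<n}"
    by (rule power2_le_imp_le) (simp add: L2_set_nonneg)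
  have "L2_set (\<lambda>i. app n L x i - c * x i) {..<n}
      = L2_set (\<lambda>i. (app n L x i - app n K x i) + (app n K x i - c * x i)) {..<n}"
    by simp
  also have "\<dots> \<le> L2_set (\<lambda>i. app n L x i - app n K x i) {..<n} + L2_set (\<lambda>i. app n K x i - c * x i) {..<n}"
    by (rule L2_set_triangle_ineq)
  finally have "r2 * L2_set x {..<n} \<le> \<epsilon> * L2_set x {..<n} + r1 * L2_set x {..<n}"
    using small large close[unfolded operator_close_def, rule_format, of x] by linarith
  then have "r2 * L2_set x {..<n} \<le> (\<epsilon> + r1) * L2_set x {..<n}"
    by (simp only: distrib_right)
  then show False
    using pos r(2) by simp
qed

text \<open>A unit vector that is nearly an eigenvector of \<open>L\<close> has a small component in the spectral
  subspaces of \<open>L\<close> whose eigenvalues are far away.\<close>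

lemma residual_far_component:
  assumes L: "symmetric n L" "eigen_family n L n u l"
    and far: "\<And>a. m \<le> a \<Longrightarrow> a < n \<Longrightarrow> g \<le> \<bar>l a - c\<bar>" and "0 < g" "m \<le> n"
    and res: "L2_set (\<lambda>i. app n L x i - c * x i) {..<n} \<le> \<epsilon>"
  shows "(\<Sum>a\<in>{m..<n}. (ip n x (u a))\<^sup>2) \<le> (\<epsilon> / g)\<^sup>2"
proof -
  have "g\<^sup>2 * (\<Sum>a\<in>{m..<n}. (ip n x (u a))\<^sup>2) \<le> (\<Sum>a\<in>{m..<n}. (l a - c)\<^sup>2 * (ip n x (u a))\<^sup>2)"
    unfolding sum_distrib_left
  proof (rule sum_mono)
    fix a assume "a \<in> {m..<n}"
    then have "\<bar>g\<bar> \<le> \<bar>l a - c\<bar>" using far[of a] \<open>0 < g\<close> by auto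
    then show "g\<^sup>2 * (ip n x (u a))\<^sup>2 \<le> (l a - c)\<^sup>2 * (ip n x (u a))\<^sup>2"
      by (intro mult_right_mono) (simp_all add: abs_le_square_iff)
  qed
  also have "\<dots> \<le> (\<Sum>a<n. (l a - c)\<^sup>2 * (ip n x (u a))\<^sup>2)"
    by (rule sum_mono2) auto
  also have "\<dots> = (L2_set (\<lambda>i. app n L x i - c * x i) {..<n})\<^sup>2"
    by (rule eigen_quadratic_form[OF L, symmetric])
  also have "\<dots> \<le> \<epsilon>\<^sup>2"
    using res by (intro power_mono L2_set_nonneg)
  finally show ?thesis
    using \<open>0 < g\<close> by (simp add: power_divide pos_le_divide_eq mult.commute)
qed

text \<open>The orthogonal matrix that best aligns the first \<open>m\<close> vectors of \<open>u\<close> with \<open>v\<close> is the orthogonal polar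
  factor of the matrix \<open>B\<close> of their inner products. With an eigenbasis \<open>h\<close> of \<open>B\<^sup>T B\<close> and its eigenvalues
  \<open>d\<close>, the polar factor maps \<open>h c\<close> to \<open>B (h c) / sqrt (d c)\<close>, and \<open>1 - d c\<close> is the squared distance of the
  combination of the \<open>v k\<close> with coefficients \<open>h c\<close> from the span of those vectors of \<open>u\<close>. The squared error
  is therefore \<open>2 (\<Sum>c. 1 - sqrt (d c)) \<le> 2 (\<Sum>c. 1 - d c)\<close>.\<close>

lemma orthonormal_alignment:
  assumes u: "orthonormal_family n n u" and "m \<le> n"
    and v: "orthonormal_family n m v"
    and s: "(\<Sum>k<m. \<Sum>a\<in>{m..<n}. (ip n (v k) (u a))\<^sup>2) \<le> s" "s < 1"
  shows "\<exists>Q. (\<forall>k<m. \<forall>k'<m. (\<Sum>a<m. Q a k * Q a k') = (if k = k' then 1 else 0)) \<and>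
             (\<Sum>i<n. \<Sum>k<m. ((\<Sum>a<m. u a i * Q a k) - v k i)\<^sup>2) \<le> 2 * s"
proof -
  define B where "B a k = ip n (v k) (u a)" for a k
  define G where "G k k' = (\<Sum>a<m. B a k * B a k')" for k k'
  have "symmetric m G" by (simp add: symmetric_def G_def mult.commute)
  then obtain h d where hd: "eigen_family m G m h d"
    using eigenbasis_exists by blast
  then have h: "orthonormal_family m m h" by (simp add: eigen_family_def)
  \<comment> \<open>\<open>Bh c\<close> is \<open>B (h c)\<close>; these vectors are orthogonal with squared lengths \<open>d c\<close>\<close>
  define Bh where "Bh c a = (\<Sum>k<m. B a k * h c k)" for c a
  have Bh_ip: "(\<Sum>a<m. Bh c a * Bh c' a) = (if c = c' then d c else 0)" if "c < m" "c' < m" for c c'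
  proof -
    have "(\<Sum>a<m. Bh c a * Bh c' a) = (\<Sum>a<m. \<Sum>k<m. \<Sum>k'<m. h c k * (B a k * B a k' * h c' k'))"
      unfolding Bh_def sum_product by (intro sum.cong refl) (simp add: mult_ac)
    also have "\<dots> = (\<Sum>k<m. \<Sum>a<m. \<Sum>k'<m. h c k * (B a k * B a k' * h c' k'))"
      by (rule sum.swap)
    also have "\<dots> = (\<Sum>k<m. \<Sum>k'<m. \<Sum>a<m. h c k * (B a k * B a k' * h c' k'))"
      by (intro sum.cong refl sum.swap)
    also have "\<dots> = ip m (h c) (app m G (h c'))"
      by (simp add: ip_def app_def G_def sum_distrib_left sum_distrib_right)
    also have "\<dots> = ip m (h c) (\<lambda>k. d c' * h c' k)"
      using hd that by (intro ip_cong) (auto simp: eigen_family_def)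
    also have "\<dots> = (if c = c' then d c else 0)"
      using h that by (simp add: ip_scale_right orthonormal_family_def)
    finally show ?thesis .
  qed
  \<comment> \<open>\<open>t c\<close> below is the squared distance of this combination from the span of the first \<open>m\<close> vectors \<open>u a\<close>\<close>
  define y where "y c i = (\<Sum>k<m. h c k * v k i)" for c i
  have y_u: "ip n (y c) (u a) = (\<Sum>k<m. h c k * B a k)" for c a
    unfolding y_def[abs_def] ip_sum_left by (simp add: B_def)
  have y_u': "ip n (y c) (u a) = Bh c a" for c a
    by (simp add: y_u Bh_def mult.commute)
  have y_norm: "ip n (y c) (y c) = 1" if "c < m" for c
  proof -
    have "ip n (y c) (y c) = (\<Sum>k<m. h c k * (\<Sum>k'<m. h c k' * ip n (v k) (v k')))"
      unfolding y_def[abs_def] ip_sum_left ip_sum_right by simp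
    also have "\<dots> = (\<Sum>k<m. h c k * h c k)"
      by (intro sum.cong refl) (simp add: orthonormal_sum[OF v order_refl])
    finally show ?thesis
      using h that by (simp add: orthonormal_family_def ip_def)
  qed
  define t where "t c = (\<Sum>a\<in>{m..<n}. (ip n (y c) (u a))\<^sup>2)" for c
  have d_t: "d c = 1 - t c" if "c < m" for c
  proof -
    have "1 = (\<Sum>a<n. (ip n (y c) (u a))\<^sup>2)"
      using parseval[OF u, of "y c" "y c"] y_norm[OF that] by (simp add: power2_eq_square)
    also have "{..<n} = {..<m} \<union> {m..<n}" using \<open>m \<le> n\<close> by auto
    also have "(\<Sum>a\<in>\<dots>. (ip n (y c) (u a))\<^sup>2) = (\<Sum>a<m. (Bh c a)\<^sup>2) + t c"
      by (subst sum.union_disjoint) (auto simp: t_def y_u')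
    also have "(\<Sum>a<m. (Bh c a)\<^sup>2) = d c"
      using Bh_ip[OF that that] by (simp add: power2_eq_square)
    finally show ?thesis by simp
  qed
  have t_nonneg: "0 \<le> t c" for c by (simp add: t_def sum_nonneg)
  have "(\<Sum>c<m. t c) = (\<Sum>a\<in>{m..<n}. \<Sum>c<m. (ip n (y c) (u a))\<^sup>2)"
    unfolding t_def by (rule sum.swap)
  also have "\<dots> = (\<Sum>a\<in>{m..<n}. \<Sum>k<m. (B a k)\<^sup>2)"
  proof (rule sum.cong)
    fix a
    have "(\<Sum>k<m. (B a k)\<^sup>2) = ip m (B a) (B a)"
      by (simp add: ip_def power2_eq_square)
    also have "\<dots> = (\<Sum>c<m. ip m (B a) (h c) * ip m (B a) (h c))"
      by (rule parseval[OF h])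
    also have "\<dots> = (\<Sum>c<m. (ip n (y c) (u a))\<^sup>2)"
      unfolding y_u by (simp add: ip_def power2_eq_square mult.commute)
    finally show "(\<Sum>c<m. (ip n (y c) (u a))\<^sup>2) = (\<Sum>k<m. (B a k)\<^sup>2)" by simp
  qed simp
  also have "\<dots> = (\<Sum>k<m. \<Sum>a\<in>{m..<n}. (ip n (v k) (u a))\<^sup>2)"
    unfolding B_def by (rule sum.swap)
  finally have t_sum: "(\<Sum>c<m. t c) \<le> s" using s(1) by simp
  have t_less: "t c < 1" if "c < m" for c
  proof -
    have "t c \<le> (\<Sum>c<m. t c)" using that t_nonneg by (intro member_le_sum) auto
    then show ?thesis using t_sum s(2) by simp
  qed
  have d_pos: "0 < d c" "d c \<le> 1" if "c < m" for c
    using d_t[OF that] t_less[OF that] t_nonneg[of c] by auto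
  \<comment> \<open>the hypothesis \<open>s < 1\<close> makes all \<open>d c\<close> positive\<close>
  define f where "f c a = Bh c a / sqrt (d c)" for c a
  have f: "orthonormal_family m m f"
    unfolding orthonormal_family_def
  proof (intro allI impI)
    fix a b assume ab: "a < m" "b < m"
    have "ip m (f a) (f b) = (\<Sum>i<m. Bh a i * Bh b i) / (sqrt (d a) * sqrt (d b))"
      by (simp add: ip_def f_def sum_divide_distrib)
    then show "ip m (f a) (f b) = (if a = b then 1 else 0)"
      using ab d_pos[of a] by (cases "a = b") (simp_all add: Bh_ip)
  qed
  define Q where "Q a k = (\<Sum>c<m. f c a * h c k)" for a k
  have h_delta: "(\<Sum>c<m. h c k * h c k') = (if k = k' then 1 else 0)" if "k < m" "k' < m" for k k'
  proof -
    define E where "E k j = (if j = k then 1 else 0 :: real)" for k j :: nat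
    have E: "ip m (E i) z = z i" if "i < m" for z i
      using that by (simp add: ip_def E_def if_distrib[of "\<lambda>t. t * _"] sum.delta cong: if_cong)
    have "E k' k = (\<Sum>c<m. h c k * h c k')"
      using parseval[OF h, of "E k" "E k'"] by (simp only: E[OF that(1)] E[OF that(2)])
    then show ?thesis by (simp add: E_def)
  qed
  have Q_orth: "(\<Sum>a<m. Q a k * Q a k') = (if k = k' then 1 else 0)" if k: "k < m" "k' < m" for k k'
  proof -
    have "(\<Sum>a<m. Q a k * Q a k') = ip m (\<lambda>a. \<Sum>c<m. h c k * f c a) (\<lambda>a. \<Sum>c<m. h c k' * f c a)"
      by (simp add: ip_def Q_def mult.commute)
    also have "\<dots> = (\<Sum>c<m. h c k * (\<Sum>c'<m. h c' k' * ip m (f c) (f c')))"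
      unfolding ip_sum_left ip_sum_right by simp
    also have "\<dots> = (\<Sum>c<m. h c k * h c k')"
      by (intro sum.cong refl) (simp add: orthonormal_sum[OF f order_refl])
    finally show ?thesis using h_delta[OF k] by simp
  qed
  \<comment> \<open>the error in the basis \<open>h\<close>, which has the same Frobenius norm as the error to be bounded\<close>
  define z where "z c i = (\<Sum>a<m. f c a * u a i) - y c i" for c i
  have z_expand: "(\<Sum>c<m. h c k * z c i) = (\<Sum>a<m. u a i * Q a k) - v k i" if "k < m" for k i
  proof -
    have "(\<Sum>c<m. h c k * y c i) = (\<Sum>c<m. \<Sum>k'<m. h c k * h c k' * v k' i)"
      by (simp add: y_def sum_distrib_left mult.assoc)
    also have "\<dots> = (\<Sum>k'<m. (\<Sum>c<m. h c k * h c k') * v k' i)"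
      by (subst sum.swap) (simp add: sum_distrib_right)
    also have "\<dots> = (\<Sum>k'<m. if k' = k then v k' i else 0)"
      using that by (intro sum.cong refl) (simp add: h_delta)
    also have "\<dots> = v k i"
      using that by (simp add: sum.delta)
    finally have 1: "(\<Sum>c<m. h c k * y c i) = v k i" .
    have "(\<Sum>c<m. h c k * (\<Sum>a<m. f c a * u a i)) = (\<Sum>c<m. \<Sum>a<m. u a i * (f c a * h c k))"
      by (simp add: sum_distrib_left mult_ac)
    also have "\<dots> = (\<Sum>a<m. u a i * Q a k)"
      by (subst sum.swap) (simp add: Q_def sum_distrib_left)
    finally show ?thesis
      using 1 by (simp add: z_def right_diff_distrib sum_subtractf)
  qed
  have z_norm: "ip n (z c) (z c) \<le> 2 * t c" if c: "c < m" for c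
  proof -
    define F where "F i = (\<Sum>a<m. f c a * u a i)" for i
    have "ip n F F = (\<Sum>a<m. f c a * (\<Sum>a'<m. f c a' * ip n (u a) (u a')))"
      unfolding F_def[abs_def] ip_sum_left ip_sum_right by simp
    also have "\<dots> = (\<Sum>a<m. f c a * f c a)"
      by (intro sum.cong refl) (simp add: orthonormal_sum[OF u \<open>m \<le> n\<close>])
    also have "\<dots> = 1"
      using f c by (simp add: orthonormal_family_def ip_def)
    finally have FF: "ip n F F = 1" .
    have "ip n F (y c) = (\<Sum>a<m. f c a * Bh c a)"
      unfolding F_def[abs_def] ip_sum_left by (simp add: ip_commute[of n "u _" "y c"] y_u')
    also have "\<dots> = d c / sqrt (d c)"
      using Bh_ip[OF c c] by (simp add: f_def flip: sum_divide_distrib)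
    also have "\<dots> = sqrt (d c)"
      using d_pos[OF c] by (simp add: real_div_sqrt)
    finally have Fy: "ip n F (y c) = sqrt (d c)" .
    have "ip n (z c) (z c) = ip n F F - 2 * ip n F (y c) + ip n (y c) (y c)"
      by (simp add: z_def[abs_def] F_def ip_def sum_subtractf sum.distrib algebra_simps
          sum_distrib_left power2_eq_square)
    also have "\<dots> = 2 - 2 * sqrt (d c)"
      using FF Fy y_norm[OF c] by simp
    also have "\<dots> \<le> 2 * t c"
    proof -
      have "d c = sqrt (d c) * sqrt (d c)" using d_pos[OF c] by simp
      also have "\<dots> \<le> sqrt (d c) * 1"
        using d_pos[OF c] by (intro mult_left_mono) auto
      finally show ?thesis using d_t[OF c] by simp
    qed
    finally show ?thesis .
  qed
  have "(\<Sum>i<n. \<Sum>k<m. ((\<Sum>a<m. u a i * Q a k) - v k i)\<^sup>2) = (\<Sum>i<n. \<Sum>c<m. (z c i)\<^sup>2)"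
  proof (rule sum.cong)
    fix i
    have "(\<Sum>k<m. ((\<Sum>a<m. u a i * Q a k) - v k i)\<^sup>2) = ip m (\<lambda>k. \<Sum>c<m. z c i * h c k) (\<lambda>k. \<Sum>c<m. z c i * h c k)"
      using z_expand[symmetric] by (simp add: ip_def power2_eq_square mult.commute)
    also have "\<dots> = (\<Sum>c<m. z c i * (\<Sum>c'<m. z c' i * ip m (h c) (h c')))"
      unfolding ip_sum_left ip_sum_right by simp
    also have "\<dots> = (\<Sum>c<m. z c i * z c i)"
      by (intro sum.cong refl) (simp add: orthonormal_sum[OF h order_refl])
    finally show "(\<Sum>k<m. ((\<Sum>a<m. u a i * Q a k) - v k i)\<^sup>2) = (\<Sum>c<m. (z c i)\<^sup>2)"
      by (simp add: power2_eq_square)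
  qed simp
  also have "\<dots> = (\<Sum>c<m. ip n (z c) (z c))"
    by (subst sum.swap) (simp add: ip_def power2_eq_square)
  also have "\<dots> \<le> (\<Sum>c<m. 2 * t c)"
    using z_norm by (intro sum_mono) auto
  also have "\<dots> \<le> 2 * s"
    using t_sum by (simp flip: sum_distrib_left)
  finally show ?thesis
    using Q_orth by blast
qed

section \<open>Characteristic polynomials and eigenvector matrices\<close>

text \<open>Multiplicities of eigenvalues are read off from any diagonalisation.\<close>

lemma proots_char_poly_diagonalised:
  fixes A P Q :: "'a :: field mat"
  assumes A: "A \<in> carrier_mat n n" and P: "P \<in> carrier_mat n n" and Q: "Q \<in> carrier_mat n n"
    and PQ: "P * Q = 1\<^sub>m n"
    and eig: "\<And>i a. i < n \<Longrightarrow> a < n \<Longrightarrow> (\<Sum>j<n. A $$ (i, j) * P $$ (j, a)) = l a * P $$ (i, a)"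
  shows "proots (char_poly A) = image_mset l (mset_set {..<n})"
proof -
  define D where "D = mat_diag n l"
  have D: "D \<in> carrier_mat n n" by (simp add: D_def)
  have AP: "A * P = P * D"
    using A P eig unfolding D_def
    by (intro eq_matI) (auto simp: mat_diag_mult_right scalar_prod_def lessThan_atLeast0 mult.commute)
  have QP: "Q * P = 1\<^sub>m n"
    using mat_mult_left_right_inverse[OF P Q PQ] .
  have "A = A * (P * Q)" using A by (simp add: PQ)
  also have "\<dots> = P * D * Q" using A P Q by (simp flip: AP)
  finally have "similar_mat A D"
    unfolding similar_mat_def using A P Q D PQ QP
    by (intro exI[of _ P] exI[of _ Q] similar_mat_witI[of P Q n]) auto
  then have "char_poly A = char_poly D" by (rule char_poly_similar)
  also have "\<dots> = (\<Prod>a\<leftarrow>diag_mat D. [:- a, 1:])"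
    by (rule char_poly_upper_triangular[OF D]) (auto simp: D_def mat_diag_def)
  also have "diag_mat D = map l [0..<n]"
    unfolding diag_mat_def by (auto simp: D_def mat_diag_def)
  also have "(\<Prod>a\<leftarrow>map l [0..<n]. [:- a, 1:]) = (\<Prod>i<n. [:- l i, 1:])"
    using prod.distinct_set_conv_list[of "[0..<n]" "\<lambda>i. [:- l i, 1:]"]
    by (simp add: o_def lessThan_atLeast0)
  finally have "proots (char_poly A) = (\<Sum>i<n. {#l i#})"
    by (simp add: proots_prod)
  also have "\<dots> = image_mset l (mset_set {..<n})"
    by (induction n) (simp_all add: lessThan_Suc)
  finally show ?thesis .
qed

lemma proots_eigen_family:
  assumes A: "A \<in> carrier_mat n n" and u: "eigen_family n (entries A) n u l"
  shows "proots (char_poly A) = image_mset l (mset_set {..<n})"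
proof (rule proots_char_poly_diagonalised[OF A])
  define P where "P = Matrix.mat n n (\<lambda>(i, a). u a i)"
  show P: "P \<in> carrier_mat n n" "transpose_mat P \<in> carrier_mat n n" by (auto simp: P_def)
  have "transpose_mat P * P = 1\<^sub>m n"
    using u by (intro eq_matI)
      (auto simp: P_def eigen_family_def orthonormal_family_def ip_def scalar_prod_def lessThan_atLeast0)
  then show "P * transpose_mat P = 1\<^sub>m n"
    using mat_mult_left_right_inverse[OF P(2,1)] by simp
  show "(\<Sum>j<n. A $$ (i, j) * P $$ (j, a)) = l a * P $$ (i, a)" if "i < n" "a < n" for i a
    using u that by (auto simp: P_def eigen_family_def app_def entries_def)
qed

definition num_near :: "nat \<Rightarrow> (nat \<Rightarrow> real) \<Rightarrow> real \<Rightarrow> real \<Rightarrow> nat" where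
  "num_near n l \<mu> \<delta> = card {a. a < n \<and> \<bar>l a / real n - \<mu>\<bar> < \<delta>}"

lemma length_eigenvalues_near:
  assumes "A \<in> carrier_mat n n" and "proots (char_poly A) = image_mset l (mset_set {..<n})"
  shows "length (eigenvalues_near A \<mu> \<delta>) = num_near n l \<mu> \<delta>"
proof -
  have "length (eigenvalues_near A \<mu> \<delta>) = size {# x \<in># image_mset l (mset_set {..<n}). \<bar>x / real n - \<mu>\<bar> < \<delta> #}"
    using assms by (simp add: eigenvalues_near_def flip: size_mset)
  also have "\<dots> = card {a \<in> {..<n}. \<bar>l a / real n - \<mu>\<bar> < \<delta>}"
    by (simp add: filter_mset_image_mset filter_mset_mset_set)
  finally show ?thesis by (simp add: num_near_def)
qed

lemma eigenvalues_near_nth: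
  assumes "k < length (eigenvalues_near A \<mu> \<delta>)"
  shows "\<bar>eigenvalues_near A \<mu> \<delta> ! k / real (dim_row A) - \<mu>\<bar> < \<delta>"
proof -
  have "eigenvalues_near A \<mu> \<delta> ! k \<in> set (eigenvalues_near A \<mu> \<delta>)"
    using assms by (rule nth_mem)
  then show ?thesis by (simp add: eigenvalues_near_def)
qed

lemma eigenvector_matrix_eigen_family:
  assumes A: "A \<in> carrier_mat n n" and V: "eigenvector_matrix A ls V"
  shows "V \<in> carrier_mat n (length ls)"
    and "eigen_family n (entries A) (length ls) (\<lambda>k i. V $$ (i, k)) (\<lambda>k. ls ! k)"
proof -
  show carr: "V \<in> carrier_mat n (length ls)"
    using A V by (simp add: eigenvector_matrix_def)
  have orth: "transpose_mat V * V = 1\<^sub>m (length ls)"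
    using V carr by (simp add: eigenvector_matrix_def orthonormal_columns_def)
  have "ip n (\<lambda>i. V $$ (i, a)) (\<lambda>i. V $$ (i, b)) = (if a = b then 1 else 0)"
    if "a < length ls" "b < length ls" for a b
  proof -
    have "(transpose_mat V * V) $$ (a, b) = ip n (\<lambda>i. V $$ (i, a)) (\<lambda>i. V $$ (i, b))"
      using that carr by (simp add: scalar_prod_def ip_def lessThan_atLeast0)
    then show ?thesis using that by (simp add: orth)
  qed
  moreover have "app n (entries A) (\<lambda>i. V $$ (i, k)) i = ls ! k * V $$ (i, k)"
    if "k < length ls" "i < n" for k i
  proof -
    have "(A *\<^sub>v col V k) $ i = (ls ! k \<cdot>\<^sub>v col V k) $ i"
      using V that by (simp add: eigenvector_matrix_def)
    then show ?thesis
      using that carr A by (simp add: app_def entries_def scalar_prod_def lessThan_atLeast0)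
  qed
  ultimately show "eigen_family n (entries A) (length ls) (\<lambda>k i. V $$ (i, k)) (\<lambda>k. ls ! k)"
    by (simp add: eigen_family_def orthonormal_family_def)
qed

section \<open>Concentration of the random Laplacian\<close>

definition below_diagonal :: "nat \<Rightarrow> (nat \<times> nat) set" where
  "below_diagonal N = {(i, j). j < i \<and> i < N}"

lemma finite_below_diagonal [simp]: "finite (below_diagonal N)"
  by (rule finite_subset[of _ "{..<N} \<times> {..<N}"]) (auto simp: below_diagonal_def)

lemma sum_square_split:
  fixes f :: "nat \<Rightarrow> nat \<Rightarrow> 'a :: comm_monoid_add"
  shows "(\<Sum>i<N. \<Sum>j<N. f i j) = (\<Sum>(i, j)\<in>below_diagonal N. f i j + f j i) + (\<Sum>i<N. f i i)"
proof -
  have "{..<N} \<times> {..<N} = (below_diagonal N \<union> prod.swap ` below_diagonal N) \<union> (\<lambda>i. (i, i)) ` {..<N}"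
    by (auto simp: below_diagonal_def image_iff)
  then have "(\<Sum>i<N. \<Sum>j<N. f i j)
      = (\<Sum>(i, j)\<in>(below_diagonal N \<union> prod.swap ` below_diagonal N) \<union> (\<lambda>i. (i, i)) ` {..<N}. f i j)"
    by (simp add: sum.cartesian_product)
  also have "\<dots> = (\<Sum>(i, j)\<in>below_diagonal N \<union> prod.swap ` below_diagonal N. f i j) + (\<Sum>i<N. f i i)"
    using finite_below_diagonal[of N, unfolded below_diagonal_def]
    by (subst sum.union_disjoint) (auto simp: below_diagonal_def sum.reindex inj_on_def)
  also have "(\<Sum>(i, j)\<in>below_diagonal N \<union> prod.swap ` below_diagonal N. f i j)
      = (\<Sum>(i, j)\<in>below_diagonal N. f i j) + (\<Sum>(i, j)\<in>below_diagonal N. f j i)"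
    using finite_below_diagonal[of N, unfolded below_diagonal_def]
    by (subst sum.union_disjoint) (auto simp: below_diagonal_def sum.reindex inj_on_def case_prod_unfold)
  finally show ?thesis
    by (simp add: sum.distrib case_prod_unfold)
qed

locale random_graph =
  fixes W :: "real \<Rightarrow> real \<Rightarrow> real" and N :: nat and M :: "'w measure" and A :: "'w \<Rightarrow> real mat"
  assumes graphon: "graphon W" and random: "random_adjacency W N M A"
begin

sublocale prob_space M
  using random by (simp add: random_adjacency_def)

lemma A_carrier: "\<omega> \<in> space M \<Longrightarrow> A \<omega> \<in> carrier_mat N N"
  and A_diag: "\<omega> \<in> space M \<Longrightarrow> i < N \<Longrightarrow> A \<omega> $$ (i, i) = 0"
  and A_range: "\<omega> \<in> space M \<Longrightarrow> i < N \<Longrightarrow> j < N \<Longrightarrow> A \<omega> $$ (i, j) \<in> {0, 1}"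
  and A_sym: "\<omega> \<in> space M \<Longrightarrow> i < N \<Longrightarrow> j < N \<Longrightarrow> A \<omega> $$ (i, j) = A \<omega> $$ (j, i)"
  using random by (auto simp: random_adjacency_def)

lemma indep: "indep_vars (\<lambda>_. borel) (\<lambda>p \<omega>. A \<omega> $$ p) (below_diagonal N)"
  using random by (simp add: random_adjacency_def below_diagonal_def)

lemma A_measurable: "p \<in> below_diagonal N \<Longrightarrow> (\<lambda>\<omega>. A \<omega> $$ p) \<in> borel_measurable M"
  using indep by (auto simp: indep_vars_def)

text \<open>The matrix takes finitely many values and is determined by its entries below the diagonal,
  so that every property of it is an event.\<close>

lemma event_measurable: "{\<omega> \<in> space M. P (A \<omega>)} \<in> sets M"
proof -
  define F where "F = below_diagonal N \<rightarrow>\<^sub>E {0, 1 :: real}"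
  define code where "code \<omega> = restrict (\<lambda>p. A \<omega> $$ p) (below_diagonal N)" for \<omega>
  define decode where "decode c = Matrix.mat N N (\<lambda>(i, j). if i = j then 0 else if j < i then c (i, j) else c (j, i))"
    for c :: "nat \<times> nat \<Rightarrow> real"
  have decode: "decode (code \<omega>) = A \<omega>" if "\<omega> \<in> space M" for \<omega>
  proof (rule eq_matI)
    fix i j assume "i < dim_row (A \<omega>)" "j < dim_col (A \<omega>)"
    with A_carrier[OF that] have "i < N" "j < N" by auto
    then show "decode (code \<omega>) $$ (i, j) = A \<omega> $$ (i, j)"
      using that A_diag[OF that, of i] A_sym[OF that, of i j]
      by (auto simp: decode_def code_def below_diagonal_def)
  qed (use A_carrier[OF that] in \<open>auto simp: decode_def\<close>)
  have code: "code \<omega> \<in> F" if "\<omega> \<in> space M" for \<omega>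
    unfolding code_def F_def
  proof (rule restrict_PiE_iff[THEN iffD2], rule ballI)
    fix p assume "p \<in> below_diagonal N"
    then show "A \<omega> $$ p \<in> {0, 1}"
      using A_range[OF that, of "fst p" "snd p"] by (simp add: below_diagonal_def case_prod_unfold)
  qed
  have "{\<omega> \<in> space M. P (A \<omega>)}
      = (\<Union>c\<in>{c \<in> F. P (decode c)}. {\<omega> \<in> space M. \<forall>p\<in>below_diagonal N. A \<omega> $$ p = c p})"
    (is "?L = ?R")
  proof (intro equalityI subsetI)
    fix \<omega> assume "\<omega> \<in> ?L"
    then show "\<omega> \<in> ?R"
      using code[of \<omega>] decode[of \<omega>] by (auto intro!: bexI[of _ "code \<omega>"] simp: code_def)
  next
    fix \<omega> assume "\<omega> \<in> ?R"
    then obtain c where c: "c \<in> F" "P (decode c)" "\<omega> \<in> space M" "\<forall>p\<in>below_diagonal N. A \<omega> $$ p = c p"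
      by auto
    then have "code \<omega> = c"
      by (auto simp: code_def F_def fun_eq_iff restrict_def PiE_def extensional_def)
    with decode[OF c(3)] c show "\<omega> \<in> ?L" by auto
  qed
  also have "\<dots> \<in> sets M"
  proof (intro sets.finite_UN)
    have "finite F"
      unfolding F_def by (rule finite_PiE) simp_all
    then show "finite {c \<in> F. P (decode c)}" by simp
    show "{\<omega> \<in> space M. \<forall>p\<in>below_diagonal N. A \<omega> $$ p = c p} \<in> sets M" for c
      using A_measurable by (intro sets.sets_Collect_finite_All) (auto intro!: borel_measurable_eq)
  qed
  finally show ?thesis .
qed

lemma sample_range: "i < N \<Longrightarrow> j < N \<Longrightarrow> sample W N i j \<in> {0..1}"
  and sample_sym: "i < N \<Longrightarrow> j < N \<Longrightarrow> sample W N i j = sample W N j i"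
  using graphon by (auto simp: graphon_def sample_def)

lemma expectation_A:
  assumes "p \<in> below_diagonal N"
  shows "expectation (\<lambda>\<omega>. A \<omega> $$ p) = sample W N (fst p) (snd p)"
proof -
  have p: "snd p < fst p" "fst p < N" using assms by (auto simp: below_diagonal_def)
  define S where "S = {\<omega> \<in> space M. A \<omega> $$ p = 1}"
  have "S \<in> sets M" unfolding S_def by (rule event_measurable)
  have "expectation (\<lambda>\<omega>. A \<omega> $$ p) = expectation (indicator S)"
    using A_range[of _ "fst p" "snd p"] p
    by (intro Bochner_Integration.integral_cong) (auto simp: S_def indicator_def)
  also have "\<dots> = prob S"
    using \<open>S \<in> sets M\<close> by simp
  also have "\<dots> = sample W N (fst p) (snd p)"
    using random p by (cases p) (auto simp: S_def random_adjacency_def)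
  finally show ?thesis .
qed

definition noise :: "'w \<Rightarrow> nat \<Rightarrow> nat \<Rightarrow> real" where
  "noise \<omega> i j = (if i = j then 0 else A \<omega> $$ (i, j) - sample W N i j)"

lemma abs_noise_le: "\<omega> \<in> space M \<Longrightarrow> i < N \<Longrightarrow> j < N \<Longrightarrow> \<bar>noise \<omega> i j\<bar> \<le> 1"
  using A_range[of \<omega> i j] sample_range[of i j] by (auto simp: noise_def)

text \<open>The noise is symmetric with zero diagonal, so that a linear form in it is a sum over the independent
  entries below the diagonal with coefficients \<open>b i j + b j i\<close>. The squares of these sum to at most
  \<open>2 s\<close>, which is what enters Hoeffding's inequality.\<close>

lemma noise_linear_deviation:
  assumes s: "(\<Sum>i<N. \<Sum>j<N. (b i j)\<^sup>2) \<le> s" "0 < s" and "0 < t"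
  shows "prob {\<omega> \<in> space M. t \<le> \<bar>\<Sum>i<N. \<Sum>j<N. b i j * noise \<omega> i j\<bar>} \<le> 2 * exp (- t\<^sup>2 / s)"
proof -
  define c where "c p = b (fst p) (snd p) + b (snd p) (fst p)" for p
  define X where "X p \<omega> = c p * A \<omega> $$ p" for p \<omega>
  define m where "m = (\<Sum>p\<in>below_diagonal N. expectation (X p))"
  have m: "m = (\<Sum>p\<in>below_diagonal N. c p * sample W N (fst p) (snd p))"
    by (simp add: m_def X_def[abs_def] expectation_A)
  have dev: "(\<Sum>i<N. \<Sum>j<N. b i j * noise \<omega> i j) = (\<Sum>p\<in>below_diagonal N. X p \<omega>) - m"
    if "\<omega> \<in> space M" for \<omega>
  proof -
    have "(\<Sum>i<N. \<Sum>j<N. b i j * noise \<omega> i j)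
        = (\<Sum>p\<in>below_diagonal N. c p * (A \<omega> $$ p - sample W N (fst p) (snd p)))"
      unfolding sum_square_split using A_sym[OF that] sample_sym
      by (auto simp: noise_def c_def below_diagonal_def algebra_simps intro!: sum.cong)
    then show ?thesis
      by (simp add: m X_def right_diff_distrib sum_subtractf)
  qed
  define v where "v = (\<Sum>p\<in>below_diagonal N. (max 0 (c p) - min 0 (c p))\<^sup>2)"
  have v: "v = (\<Sum>p\<in>below_diagonal N. (c p)\<^sup>2)"
    unfolding v_def by (intro sum.cong) (auto simp: max_def min_def)
  have "v \<le> (\<Sum>(i, j)\<in>below_diagonal N. 2 * (b i j)\<^sup>2 + 2 * (b j i)\<^sup>2)"
    unfolding v c_def case_prod_unfold
  proof (rule sum_mono)
    fix p
    have "0 \<le> (b (fst p) (snd p) - b (snd p) (fst p))\<^sup>2" by simp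
    then show "(b (fst p) (snd p) + b (snd p) (fst p))\<^sup>2
        \<le> 2 * (b (fst p) (snd p))\<^sup>2 + 2 * (b (snd p) (fst p))\<^sup>2"
      by (simp add: power2_eq_square algebra_simps)
  qed
  also have "\<dots> \<le> \<dots> + (\<Sum>i<N. 2 * (b i i)\<^sup>2)"
    by (simp add: sum_nonneg)
  also have "\<dots> = (\<Sum>i<N. \<Sum>j<N. 2 * (b i j)\<^sup>2)"
    by (simp only: sum_square_split[of "\<lambda>i j. 2 * (b i j)\<^sup>2" N])
  also have "\<dots> \<le> 2 * s"
    using s(1) by (simp flip: sum_distrib_left)
  finally have v_le: "v \<le> 2 * s" .
  have event: "{\<omega> \<in> space M. t \<le> \<bar>\<Sum>i<N. \<Sum>j<N. b i j * noise \<omega> i j\<bar>}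
      = {\<omega> \<in> space M. \<bar>(\<Sum>p\<in>below_diagonal N. X p \<omega>) - m\<bar> \<ge> t}"
    using dev by (intro Collect_cong) auto
  show ?thesis
  \<comment> \<open>the bound of Hoeffding's inequality has \<open>v\<close> in a denominator\<close>
  proof (cases "v = 0")
    case True
    then have "\<forall>p\<in>below_diagonal N. c p = 0"
      unfolding v by (simp add: sum_nonneg_eq_0_iff)
    then have "{\<omega> \<in> space M. \<bar>(\<Sum>p\<in>below_diagonal N. X p \<omega>) - m\<bar> \<ge> t} = {}"
      using \<open>0 < t\<close> by (auto simp: X_def m)
    then show ?thesis unfolding event by (simp only: measure_empty) simp
  next
    case False
    then have v_pos: "0 < v" unfolding v by (simp add: sum_nonneg less_le)
    interpret Hoeffding_ineq M "below_diagonal N" X "\<lambda>p. min 0 (c p)" "\<lambda>p. max 0 (c p)" m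
    proof unfold_locales
      show "indep_vars (\<lambda>_. borel) X (below_diagonal N)"
        unfolding X_def using indep by (rule indep_vars_compose2[where Y = "\<lambda>p x. c p * x"]) simp
      show "AE \<omega> in M. X p \<omega> \<in> {min 0 (c p)..max 0 (c p)}" if "p \<in> below_diagonal N" for p
      proof (rule AE_I2)
        fix \<omega> assume "\<omega> \<in> space M"
        then have "A \<omega> $$ p \<in> {0, 1}"
          using A_range[of \<omega> "fst p" "snd p"] that by (auto simp: below_diagonal_def)
        then show "X p \<omega> \<in> {min 0 (c p)..max 0 (c p)}" by (auto simp: X_def)
      qed
    qed (simp_all add: m_def)
    have "prob {\<omega> \<in> space M. \<bar>(\<Sum>p\<in>below_diagonal N. X p \<omega>) - m\<bar> \<ge> t} \<le> 2 * exp (-2 * t\<^sup>2 / v)"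
      using Hoeffding_ineq_abs_ge[of t] \<open>0 < t\<close> v_pos by (simp add: v_def)
    also have "\<dots> \<le> 2 * exp (- t\<^sup>2 / s)"
    proof -
      have "t\<^sup>2 * v \<le> t\<^sup>2 * (2 * s)" using v_le by (intro mult_left_mono) auto
      then show ?thesis using v_pos s(2) by (simp add: field_simps)
    qed
    finally show ?thesis unfolding event .
  qed
qed

end

text \<open>A matrix with entries bounded by \<open>1\<close> changes its bilinear form by at most \<open>3\<close> when two vectors of
  length at most \<open>1\<close> are rounded to multiples of \<open>1/N\<^sup>2\<close>. The rounded vectors may be longer, but their
  squared length is at most \<open>4\<close>. The logarithm of the number of pairs of rounded vectors is of order
  \<open>N ln N\<close>, which the exponent \<open>N\<^bsup>1 + 2 \<gamma>\<^esup>\<close> of the tail bound absorbs.\<close>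

definition net :: "nat \<Rightarrow> (nat \<Rightarrow> int) set" where
  "net N = {z \<in> {..<N} \<rightarrow>\<^sub>E {- int (N\<^sup>2)..int (N\<^sup>2)}. (\<Sum>i<N. (z i / real (N\<^sup>2))\<^sup>2) \<le> 4}"

lemma finite_net: "finite (net N)"
  and card_net: "card (net N) \<le> (2 * N\<^sup>2 + 1) ^ N"
proof -
  have fin: "finite ({..<N} \<rightarrow>\<^sub>E {- int (N\<^sup>2)..int (N\<^sup>2)})"
    by (intro finite_PiE) auto
  then show "finite (net N)"
    by (rule finite_subset[rotated]) (auto simp: net_def)
  have "card (net N) \<le> card ({..<N} \<rightarrow>\<^sub>E {- int (N\<^sup>2)..int (N\<^sup>2)})"
    using fin by (intro card_mono) (auto simp: net_def)
  also have "nat (2 * int (N\<^sup>2) + 1) = 2 * N\<^sup>2 + 1" by linarith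
  then have "card ({..<N} \<rightarrow>\<^sub>E {- int (N\<^sup>2)..int (N\<^sup>2)}) = (2 * N\<^sup>2 + 1) ^ N"
    by (simp add: card_PiE del: of_nat_power)
  finally show "card (net N) \<le> (2 * N\<^sup>2 + 1) ^ N" .
qed

lemma abs_le_1_of_sum_squares:
  fixes x :: "nat \<Rightarrow> real"
  assumes "(\<Sum>i<N. (x i)\<^sup>2) \<le> 1" and "i < N"
  shows "\<bar>x i\<bar> \<le> 1"
proof -
  have "(x i)\<^sup>2 \<le> (\<Sum>i<N. (x i)\<^sup>2)" using assms(2) by (intro member_le_sum) auto
  then show ?thesis using assms(1) by (simp flip: abs_square_le_1)
qed

lemma net_rounding:
  fixes x :: "nat \<Rightarrow> real"
  assumes x: "(\<Sum>i<N. (x i)\<^sup>2) \<le> 1" and "0 < N"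
  obtains z where "z \<in> net N" "\<And>i. i < N \<Longrightarrow> \<bar>x i - z i / real (N\<^sup>2)\<bar> \<le> 1 / real (N\<^sup>2)"
proof
  define n where "n = N\<^sup>2"
  define z where "z = restrict (\<lambda>i. \<lfloor>x i * n\<rfloor>) {..<N}"
  have "N \<le> n" using \<open>0 < N\<close> by (simp add: n_def power2_eq_square)
  then have n: "1 \<le> real n" "real N \<le> real n" using \<open>0 < N\<close> by linarith+
  have near: "\<bar>x i - z i / n\<bar> \<le> 1 / n" if "i < N" for i
  proof -
    have "\<bar>x i * n - z i\<bar> \<le> 1"
      using that by (simp add: z_def) linarith
    then have "\<bar>(x i * n - z i) / n\<bar> \<le> 1 / n"
      using n by (simp add: abs_divide divide_right_mono)
    then show ?thesis using n by (simp add: diff_divide_distrib)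
  qed
  then show "\<bar>x i - z i / real (N\<^sup>2)\<bar> \<le> 1 / real (N\<^sup>2)" if "i < N" for i
    using that by (simp add: n_def)
  have range: "z i \<in> {- int n..int n}" if "i < N" for i
  proof -
    have "\<bar>x i * n\<bar> \<le> 1 * real n"
      unfolding abs_mult using abs_le_1_of_sum_squares[OF x that] by (intro mult_mono) auto
    then have "- int n \<le> \<lfloor>x i * n\<rfloor>" "\<lfloor>x i * n\<rfloor> \<le> \<lfloor>real n\<rfloor>"
      by (simp add: le_floor_iff, intro floor_mono) simp
    then show ?thesis using that by (simp add: z_def)
  qed
  have "(\<Sum>i<N. (z i / n)\<^sup>2) \<le> (\<Sum>i<N. 2 * (x i)\<^sup>2 + 2 * (1 / n))"
  proof (rule sum_mono)
    fix i assume "i \<in> {..<N}"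
    define e where "e = z i / n - x i"
    have "\<bar>e\<bar> \<le> 1 / n"
      using near[of i] \<open>i \<in> {..<N}\<close> by (simp add: e_def abs_minus_commute)
    moreover have "1 / n \<le> 1" using n by simp
    ultimately have "\<bar>e\<bar> * \<bar>e\<bar> \<le> 1 * (1 / n)" by (intro mult_mono) auto
    moreover have "(x i + e)\<^sup>2 \<le> 2 * (x i)\<^sup>2 + 2 * e\<^sup>2"
      using zero_le_power2[of "x i - e"] by (simp add: power2_eq_square algebra_simps)
    ultimately show "(z i / n)\<^sup>2 \<le> 2 * (x i)\<^sup>2 + 2 * (1 / n)"
      by (simp add: e_def power2_eq_square)
  qed
  also have "\<dots> = 2 * (\<Sum>i<N. (x i)\<^sup>2) + 2 * (real N / n)"
    by (simp add: sum.distrib sum_distrib_left)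
  also have "\<dots> \<le> 2 * 1 + 2 * 1"
    using x n by (intro add_mono mult_left_mono) auto
  finally show "z \<in> net N"
    using range by (auto simp: net_def z_def n_def)
qed

lemma bilinear_form_net:
  fixes E :: "nat \<Rightarrow> nat \<Rightarrow> real"
  assumes E: "\<And>i j. i < N \<Longrightarrow> j < N \<Longrightarrow> \<bar>E i j\<bar> \<le> 1" and "0 < N"
    and net: "\<And>y x. y \<in> net N \<Longrightarrow> x \<in> net N \<Longrightarrow>
      \<bar>\<Sum>i<N. \<Sum>j<N. (y i / real (N\<^sup>2)) * (x j / real (N\<^sup>2)) * E i j\<bar> \<le> t"
    and y: "(\<Sum>i<N. (y i)\<^sup>2) \<le> 1" and x: "(\<Sum>i<N. (x i)\<^sup>2) \<le> 1"
  shows "\<bar>\<Sum>i<N. \<Sum>j<N. y i * x j * E i j\<bar> \<le> t + 3"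
proof -
  define n where "n = real (N\<^sup>2)"
  have n: "1 \<le> n" using \<open>0 < N\<close> by (simp add: n_def)
  obtain y' where y': "y' \<in> net N" "\<And>i. i < N \<Longrightarrow> \<bar>y i - y' i / n\<bar> \<le> 1 / n"
    using net_rounding[OF y \<open>0 < N\<close>] unfolding n_def by blast
  obtain x' where x': "x' \<in> net N" "\<And>i. i < N \<Longrightarrow> \<bar>x i - x' i / n\<bar> \<le> 1 / n"
    using net_rounding[OF x \<open>0 < N\<close>] unfolding n_def by blast
  define v w where "v i = y' i / n" and "w i = x' i / n" for i
  have "\<bar>(\<Sum>i<N. \<Sum>j<N. y i * x j * E i j) - (\<Sum>i<N. \<Sum>j<N. v i * w j * E i j)\<bar>
      = \<bar>\<Sum>i<N. \<Sum>j<N. (y i * x j - v i * w j) * E i j\<bar>"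
    by (simp add: sum_subtractf left_diff_distrib)
  also have "\<dots> \<le> (\<Sum>i<N. \<Sum>j<N. 3 / n)"
  proof (intro order_trans[OF sum_abs] sum_mono)
    fix i j assume "i \<in> {..<N}" "j \<in> {..<N}"
    then have ij: "i < N" "j < N" by auto
    have close: "\<bar>y i - v i\<bar> \<le> 1 / n" "\<bar>x j - w j\<bar> \<le> 1 / n"
      using y'(2)[OF ij(1)] x'(2)[OF ij(2)] by (auto simp: v_def w_def)
    moreover have "1 / n \<le> 1" using n by simp
    moreover note abs_le_1_of_sum_squares[OF y ij(1)] abs_le_1_of_sum_squares[OF x ij(2)]
    ultimately have "\<bar>v i\<bar> \<le> 2" "\<bar>x j\<bar> \<le> 1" by linarith+
    have "y i * x j - v i * w j = (y i - v i) * x j + v i * (x j - w j)"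
      by (simp add: algebra_simps)
    also have "\<bar>\<dots>\<bar> \<le> \<bar>y i - v i\<bar> * \<bar>x j\<bar> + \<bar>v i\<bar> * \<bar>x j - w j\<bar>"
      by (metis abs_mult abs_triangle_ineq)
    also have "\<dots> \<le> (1 / n) * 1 + 2 * (1 / n)"
      using close \<open>\<bar>v i\<bar> \<le> 2\<close> \<open>\<bar>x j\<bar> \<le> 1\<close> n by (intro add_mono mult_mono) auto
    finally have "\<bar>y i * x j - v i * w j\<bar> * \<bar>E i j\<bar> \<le> 3 / n * 1"
      using E[OF ij] n by (intro mult_mono) auto
    then show "\<bar>(y i * x j - v i * w j) * E i j\<bar> \<le> 3 / n"
      by (simp add: abs_mult)
  qed
  also have "\<dots> = 3" using \<open>0 < N\<close> by (simp add: n_def power2_eq_square)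
  finally show ?thesis
    using net[OF y'(1) x'(1)] unfolding v_def w_def n_def by linarith
qed

text \<open>Testing the bilinear form with the normalised image vector gives the operator norm.\<close>

lemma operator_bound_from_bilinear_form:
  fixes E :: "nat \<Rightarrow> nat \<Rightarrow> real"
  assumes bil: "\<And>y x. (\<Sum>i<N. (y i)\<^sup>2) \<le> 1 \<Longrightarrow> (\<Sum>i<N. (x i)\<^sup>2) \<le> 1 \<Longrightarrow>
      \<bar>\<Sum>i<N. \<Sum>j<N. y i * x j * E i j\<bar> \<le> K"
  shows "L2_set (app N E x) {..<N} \<le> K * L2_set x {..<N}"
proof (cases "L2_set x {..<N} = 0 \<or> L2_set (app N E x) {..<N} = 0")
  case True
  have "0 \<le> K" using bil[of "\<lambda>_. 0" "\<lambda>_. 0"] by simp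
  have "L2_set (app N E x) {..<N} = 0" if "L2_set x {..<N} = 0"
  proof -
    have "\<forall>i<N. x i = 0" using that by (simp add: L2_set_eq_0_iff)
    then show ?thesis by (simp add: app_def L2_set_eq_0_iff)
  qed
  with True \<open>0 \<le> K\<close> show ?thesis by (auto simp: L2_set_nonneg)
next
  case False
  define a where "a = L2_set x {..<N}"
  define b where "b = L2_set (app N E x) {..<N}"
  have ab: "a > 0" "b > 0" using False by (auto simp: a_def b_def less_le L2_set_nonneg)
  have a2: "a\<^sup>2 = (\<Sum>i<N. (x i)\<^sup>2)" and b2: "b\<^sup>2 = (\<Sum>i<N. (app N E x i)\<^sup>2)"
    by (simp_all add: a_def b_def L2_set_def sum_nonneg)
  have "\<bar>\<Sum>i<N. \<Sum>j<N. (app N E x i / b) * (x j / a) * E i j\<bar> \<le> K"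
    using ab by (intro bil) (simp_all add: power_divide a2[symmetric] b2[symmetric] flip: sum_divide_distrib)
  also have "(\<Sum>i<N. \<Sum>j<N. (app N E x i / b) * (x j / a) * E i j)
      = (\<Sum>i<N. app N E x i * (\<Sum>j<N. E i j * x j)) / (a * b)"
    by (simp add: sum_divide_distrib sum_distrib_left algebra_simps)
  also have "\<dots> = b / a"
    using ab by (simp add: app_def[symmetric] power2_eq_square flip: b2[unfolded power2_eq_square])
  finally have "b / a \<le> K" using ab by simp
  then show ?thesis using ab by (simp add: pos_divide_le_eq a_def b_def)
qed

lemma graph_laplacian_app:
  assumes "A \<in> carrier_mat N N" "i < N"
  shows "app N (entries (graph_laplacian A)) x i
    = app N (entries A) x i - (\<Sum>j<N. A $$ (i, j)) * x i"
proof -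
  have "app N (entries (graph_laplacian A)) x i
      = (\<Sum>j<N. A $$ (i, j) * x j - (if j = i then (\<Sum>k<N. A $$ (i, k)) * x i else 0))"
    using assms unfolding app_def entries_def
    by (intro sum.cong) (auto simp: graph_laplacian_def deg_matrix_def mat_diag_def left_diff_distrib)
  then show ?thesis
    using assms(2) by (simp add: sum_subtractf sum.delta app_def entries_def)
qed

abbreviation sampled_laplacian :: "(real \<Rightarrow> real \<Rightarrow> real) \<Rightarrow> nat \<Rightarrow> real mat" where
  "sampled_laplacian W N \<equiv> graph_laplacian (det_adjacency W N)"

abbreviation laplacian_close :: "(real \<Rightarrow> real \<Rightarrow> real) \<Rightarrow> nat \<Rightarrow> real \<Rightarrow> real mat \<Rightarrow> bool" where
  "laplacian_close W N \<epsilon> B \<equiv>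
     operator_close N \<epsilon> (entries (sampled_laplacian W N)) (entries (graph_laplacian B))"

context random_graph
begin

lemma laplacian_deviation_app:
  assumes "\<omega> \<in> space M" "i < N"
  shows "app N (entries (graph_laplacian (A \<omega>))) x i
      - app N (entries (sampled_laplacian W N)) x i
    = app N (noise \<omega>) x i - (\<Sum>j<N. noise \<omega> i j) * x i"
proof -
  have noise: "noise \<omega> i j = A \<omega> $$ (i, j) - det_adjacency W N $$ (i, j)" if "j < N" for j
    using assms that A_diag by (auto simp: noise_def det_adjacency_def)
  have "det_adjacency W N \<in> carrier_mat N N" by (simp add: det_adjacency_def)
  from graph_laplacian_app[OF this assms(2)] graph_laplacian_app[OF A_carrier[OF assms(1)] assms(2)]
  show ?thesis
    by (simp add: app_def entries_def noise sum_subtractf left_diff_distrib)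
qed

text \<open>The two Laplacians differ by the noise matrix minus the diagonal matrix of its row sums. The net
  controls the first, and the second acts on each coordinate separately.\<close>

lemma laplacian_close_of_noise_bounds:
  assumes \<omega>: "\<omega> \<in> space M" and "0 < N" "0 \<le> r"
    and net: "\<And>y x. y \<in> net N \<Longrightarrow> x \<in> net N \<Longrightarrow>
      \<bar>\<Sum>i<N. \<Sum>j<N. (y i / real (N\<^sup>2)) * (x j / real (N\<^sup>2)) * noise \<omega> i j\<bar> \<le> t"
    and rows: "\<And>i. i < N \<Longrightarrow> \<bar>\<Sum>j<N. noise \<omega> i j\<bar> \<le> r"
  shows "laplacian_close W N (t + 3 + r) (A \<omega>)"
  unfolding operator_close_def
proof
  fix x
  have "L2_set (\<lambda>i. app N (entries (graph_laplacian (A \<omega>))) x i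
      - app N (entries (sampled_laplacian W N)) x i) {..<N}
    = L2_set (\<lambda>i. app N (noise \<omega>) x i + - (\<Sum>j<N. noise \<omega> i j) * x i) {..<N}"
    using \<omega> by (intro L2_set_cong) (auto simp: laplacian_deviation_app)
  also have "\<dots> \<le> L2_set (app N (noise \<omega>) x) {..<N} + L2_set (\<lambda>i. - (\<Sum>j<N. noise \<omega> i j) * x i) {..<N}"
    by (rule L2_set_triangle_ineq)
  also have "L2_set (app N (noise \<omega>) x) {..<N} \<le> (t + 3) * L2_set x {..<N}"
    using abs_noise_le net \<omega> \<open>0 < N\<close>
    by (intro operator_bound_from_bilinear_form bilinear_form_net) auto
  also have "L2_set (\<lambda>i. - (\<Sum>j<N. noise \<omega> i j) * x i) {..<N} = L2_set (\<lambda>i. \<bar>\<Sum>j<N. noise \<omega> i j\<bar> * \<bar>x i\<bar>) {..<N}"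
    by (simp add: L2_set_def power_mult_distrib)
  also have "\<dots> \<le> L2_set (\<lambda>i. r * \<bar>x i\<bar>) {..<N}"
    using rows by (intro L2_set_mono mult_right_mono) auto
  also have "\<dots> = r * L2_set x {..<N}"
    using \<open>0 \<le> r\<close> by (subst L2_set_right_distrib[symmetric]) (simp_all add: L2_set_def)
  finally show "L2_set (\<lambda>i. app N (entries (graph_laplacian (A \<omega>))) x i
      - app N (entries (sampled_laplacian W N)) x i) {..<N}
    \<le> (t + 3 + r) * L2_set x {..<N}"
    by (simp add: algebra_simps)
qed

text \<open>A row sum is a linear form in the noise as well, with \<open>N\<close> coefficients \<open>1\<close>. On the net the
  coefficients \<open>y i * x j\<close> have square sum at most \<open>4 * 4\<close>.\<close>

lemma laplacian_deviation_prob: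
  assumes "0 < N" and t: "0 < t" "0 < r"
  shows "prob {\<omega> \<in> space M. laplacian_close W N (t + 3 + r) (A \<omega>)}
    \<ge> 1 - (2 * real (2 * N\<^sup>2 + 1) ^ (2 * N) * exp (- t\<^sup>2 / 16) + 2 * real N * exp (- r\<^sup>2 / N))"
    (is "prob ?good \<ge> 1 - (?bils + ?rows)")
proof -
  define c where "c q i j = (fst q i / real (N\<^sup>2)) * (snd q j / real (N\<^sup>2))"
    for q :: "(nat \<Rightarrow> int) \<times> (nat \<Rightarrow> int)" and i j :: nat
  define d where "d k i j = (if i = k then 1 else 0 :: real)" for k i j :: nat
  define bad where "bad b s = {\<omega> \<in> space M. s \<le> \<bar>\<Sum>i<N. \<Sum>j<N. b i j * noise \<omega> i j\<bar>}" for b s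
  have bad_event [simp]: "bad b s \<in> events" for b s
    unfolding bad_def noise_def[abs_def]
    by (rule event_measurable[of "\<lambda>B. s \<le> \<bar>\<Sum>i<N. \<Sum>j<N. b i j * (if i = j then 0 else B $$ (i, j) - sample W N i j)\<bar>"])
  let ?Q = "net N \<times> net N"
  let ?bad = "(\<Union>q\<in>?Q. bad (c q) t) \<union> (\<Union>k\<in>{..<N}. bad (d k) r)"
  have prob_bil: "prob (bad (c q) t) \<le> 2 * exp (- t\<^sup>2 / 16)" if "q \<in> ?Q" for q
    unfolding bad_def
  proof (rule noise_linear_deviation)
    have "(\<Sum>i<N. \<Sum>j<N. (c q i j)\<^sup>2) = (\<Sum>i<N. (fst q i / real (N\<^sup>2))\<^sup>2) * (\<Sum>j<N. (snd q j / real (N\<^sup>2))\<^sup>2)"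
      unfolding c_def sum_product power_mult_distrib ..
    also have "\<dots> \<le> 4 * 4"
      using that unfolding net_def mem_Times_iff mem_Collect_eq
      by (intro mult_mono) (simp_all only: sum_nonneg zero_le_power2 zero_le_numeral)
    finally show "(\<Sum>i<N. \<Sum>j<N. (c q i j)\<^sup>2) \<le> 16" by simp
  qed (use t in auto)
  have d_sum: "(\<Sum>i<N. \<Sum>j<N. d k i j * f i j) = (\<Sum>j<N. f k j)" if "k < N" for k and f :: "nat \<Rightarrow> nat \<Rightarrow> real"
  proof -
    have "(\<Sum>i<N. \<Sum>j<N. d k i j * f i j) = (\<Sum>i<N. if i = k then (\<Sum>j<N. f i j) else 0)"
      by (intro sum.cong) (auto simp: d_def)
    then show ?thesis using that by (simp add: sum.delta)
  qed
  have prob_row: "prob (bad (d k) r) \<le> 2 * exp (- r\<^sup>2 / N)" if "k \<in> {..<N}" for k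
    unfolding bad_def
  proof (rule noise_linear_deviation)
    have "(\<Sum>i<N. \<Sum>j<N. (d k i j)\<^sup>2) = (\<Sum>i<N. \<Sum>j<N. d k i j * 1)"
      by (intro sum.cong) (auto simp: d_def)
    then show "(\<Sum>i<N. \<Sum>j<N. (d k i j)\<^sup>2) \<le> N"
      using that d_sum[of k "\<lambda>_ _. 1"] by simp
  qed (use t \<open>0 < N\<close> in auto)
  have "space M - ?good \<subseteq> ?bad"
  proof (rule subsetI, rule ccontr)
    fix \<omega> assume \<omega>: "\<omega> \<in> space M - ?good" and none: "\<omega> \<notin> ?bad"
    have "laplacian_close W N (t + 3 + r) (A \<omega>)"
    proof (rule laplacian_close_of_noise_bounds)
      fix y x assume "y \<in> net N" "x \<in> net N"
      then have "\<omega> \<notin> bad (c (y, x)) t" using none by blast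
      then show "\<bar>\<Sum>i<N. \<Sum>j<N. (y i / real (N\<^sup>2)) * (x j / real (N\<^sup>2)) * noise \<omega> i j\<bar> \<le> t"
        using \<omega> by (simp add: bad_def c_def)
    next
      fix i assume "i < N"
      moreover from this have "\<omega> \<notin> bad (d i) r" using none by blast
      ultimately show "\<bar>\<Sum>j<N. noise \<omega> i j\<bar> \<le> r" using \<omega> by (simp add: bad_def d_sum)
    qed (use \<omega> t \<open>0 < N\<close> in auto)
    with \<omega> show False by simp
  qed
  moreover have "?bad \<in> events"
    using finite_net by (intro sets.Un sets.finite_UN) simp_all
  ultimately have "prob (space M - ?good) \<le> prob ?bad"
    by (rule finite_measure_mono)
  also have "\<dots> \<le> prob (\<Union>q\<in>?Q. bad (c q) t) + prob (\<Union>k\<in>{..<N}. bad (d k) r)"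
    using finite_net by (intro measure_Un_le sets.finite_UN) simp_all
  also have "\<dots> \<le> (\<Sum>q\<in>?Q. prob (bad (c q) t)) + (\<Sum>k<N. prob (bad (d k) r))"
    using finite_net by (intro add_mono finite_measure_subadditive_finite) auto
  also have "\<dots> \<le> (\<Sum>q\<in>?Q. 2 * exp (- t\<^sup>2 / 16)) + (\<Sum>k<N. 2 * exp (- r\<^sup>2 / N))"
    by (intro add_mono sum_mono prob_bil prob_row)
  also have "\<dots> = real (card (net N) * card (net N)) * (2 * exp (- t\<^sup>2 / 16)) + ?rows"
    by (simp add: card_cartesian_product)
  also have "\<dots> \<le> real ((2 * N\<^sup>2 + 1) ^ N * (2 * N\<^sup>2 + 1) ^ N) * (2 * exp (- t\<^sup>2 / 16)) + ?rows"
    by (intro add_right_mono mult_right_mono of_nat_mono mult_mono card_net) simp_all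
  also have "real ((2 * N\<^sup>2 + 1) ^ N * (2 * N\<^sup>2 + 1) ^ N) = real (2 * N\<^sup>2 + 1) ^ (2 * N)"
    by (simp only: of_nat_mult of_nat_power mult_2[of N] power_add)
  finally have "prob (space M - ?good) \<le> ?bils + ?rows"
    by (simp only: mult_ac)
  then show ?thesis
    using prob_compl[OF event_measurable[of "laplacian_close W N (t + 3 + r)"]] by simp
qed

end

text \<open>The probability allowed for failure is split equally between the two kinds of bad events. The first
  conjunct leaves room for the rounding error \<open>3\<close>.\<close>

lemma eventually_tail_bound:
  fixes \<gamma> :: real
  assumes "0 < \<gamma>"
  shows "\<forall>\<^sub>F N in sequentially. 6 \<le> real N powr (1/2 + \<gamma>) \<and>
    2 * real (2 * N\<^sup>2 + 1) ^ (2 * N) * exp (- (real N powr (1/2 + \<gamma>) / 2)\<^sup>2 / 16)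
      + 2 * real N * exp (- (real N powr (1/2 + \<gamma>))\<^sup>2 / N)
    \<le> 2 * real N * exp (- (1/2) * real N powr (2 * \<gamma>))"
proof -
  have "\<forall>\<^sub>F x in at_top. 6 \<le> x powr (1/2 + \<gamma>)" and
    "\<forall>\<^sub>F x in at_top. 2 * exp (2 * x * ln (2 * x\<^sup>2 + 1) - x powr (1 + 2 * \<gamma>) / 64) \<le> x * exp (- (1/2) * x powr (2 * \<gamma>))" and
    "\<forall>\<^sub>F x in at_top. 2 * exp (- (x powr (2 * \<gamma>))) \<le> exp (- (1/2) * x powr (2 * \<gamma>))"
    using assms by real_asymp+
  then have "\<forall>\<^sub>F x in at_top. 6 \<le> x powr (1/2 + \<gamma>) \<and>
      2 * exp (2 * x * ln (2 * x\<^sup>2 + 1) - x powr (1 + 2 * \<gamma>) / 64) \<le> x * exp (- (1/2) * x powr (2 * \<gamma>)) \<and>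
      2 * exp (- (x powr (2 * \<gamma>))) \<le> exp (- (1/2) * x powr (2 * \<gamma>)) \<and> 0 < x"
    using eventually_gt_at_top[of "0 :: real"] by eventually_elim auto
  from eventually_compose_filterlim[OF this filterlim_real_sequentially]
  show ?thesis
  proof eventually_elim
    case (elim N)
    then have N: "0 < real N" by simp
    have sq: "(real N powr (1/2 + \<gamma>))\<^sup>2 = real N powr (1 + 2 * \<gamma>)"
      by (simp add: power2_eq_square algebra_simps flip: powr_add)
    have "real N powr (1 + 2 * \<gamma>) / N = real N powr (2 * \<gamma>)"
      using N by (simp add: powr_add)
    then have row: "2 * real N * exp (- (real N powr (1/2 + \<gamma>))\<^sup>2 / N) \<le> N * exp (- (1/2) * real N powr (2 * \<gamma>))"
      using mult_left_mono[OF conjunct1[OF conjunct2[OF conjunct2[OF elim]]], of "real N"] N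
      by (simp add: sq mult_ac)
    have "0 < 2 * (real N)\<^sup>2 + 1" by (simp add: add_nonneg_pos)
    then have "real (2 * N\<^sup>2 + 1) ^ (2 * N) = exp (2 * real N * ln (2 * (real N)\<^sup>2 + 1))"
      using exp_of_nat_mult[of "2 * N" "ln (2 * (real N)\<^sup>2 + 1)"] by (simp add: algebra_simps)
    moreover have "- (real N powr (1/2 + \<gamma>) / 2)\<^sup>2 / 16 = - (real N powr (1 + 2 * \<gamma>) / 64)"
      by (simp add: power_divide sq)
    ultimately have "2 * real (2 * N\<^sup>2 + 1) ^ (2 * N) * exp (- (real N powr (1/2 + \<gamma>) / 2)\<^sup>2 / 16)
        = 2 * exp (2 * real N * ln (2 * (real N)\<^sup>2 + 1) - real N powr (1 + 2 * \<gamma>) / 64)"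
      by (simp only: mult.assoc exp_add[symmetric]) (simp add: algebra_simps)
    with row elim show ?case by linarith
  qed
qed

text \<open>The union bound over the net costs a factor \<open>(2 N\<^sup>2 + 1)\<^bsup>2 N\<^esup>\<close>, which is negligible against
  \<open>exp (- N\<^bsup>1 + 2 \<gamma>\<^esup> / 64)\<close>. The row sums of the deviation, which are sums of only \<open>N\<close> terms,
  determine the tail and the factor \<open>2 N\<close>.\<close>

lemma laplacian_concentration:
  assumes "graphon W" and "0 < \<gamma>"
  shows "\<exists>N1. \<forall>N\<ge>N1. \<forall>(M :: 'w measure) A. random_adjacency W N M A \<longrightarrow>
    measure M {\<omega> \<in> space M. laplacian_close W N (2 * real N powr (1/2 + \<gamma>)) (A \<omega>)}
    \<ge> 1 - 2 * real N * exp (- (1/2) * real N powr (2 * \<gamma>))"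
proof -
  obtain N2 where N2: "\<forall>N\<ge>N2. 6 \<le> real N powr (1/2 + \<gamma>) \<and>
    2 * real (2 * N\<^sup>2 + 1) ^ (2 * N) * exp (- (real N powr (1/2 + \<gamma>) / 2)\<^sup>2 / 16)
      + 2 * real N * exp (- (real N powr (1/2 + \<gamma>))\<^sup>2 / N)
    \<le> 2 * real N * exp (- (1/2) * real N powr (2 * \<gamma>))"
    using eventually_tail_bound[OF assms(2)] unfolding eventually_sequentially by (rule exE)
  show ?thesis
  proof (intro exI[of _ "max 1 N2"] allI impI)
    fix N :: nat and M :: "'w measure" and A
    assume N: "max 1 N2 \<le> N" and "random_adjacency W N M A"
    then interpret random_graph W N M A
      using assms(1) by unfold_locales
    define t where "t = real N powr (1/2 + \<gamma>)"
    have t: "6 \<le> t" using N2 N by (simp add: t_def)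
    have mono: "laplacian_close W N (t / 2 + 3 + t) B \<Longrightarrow> laplacian_close W N (2 * t) B" for B
    proof (rule operator_close_mono)
      show "t / 2 + 3 + t \<le> 2 * t" using t by simp
    qed
    have "1 - 2 * real N * exp (- (1/2) * real N powr (2 * \<gamma>))
      \<le> 1 - (2 * real (2 * N\<^sup>2 + 1) ^ (2 * N) * exp (- (t / 2)\<^sup>2 / 16) + 2 * real N * exp (- t\<^sup>2 / N))"
      using N2[rule_format, of N] N unfolding t_def by linarith
    also have "\<dots> \<le> prob {\<omega> \<in> space M. laplacian_close W N (t / 2 + 3 + t) (A \<omega>)}"
      using N t by (intro laplacian_deviation_prob) auto
    also have "\<dots> \<le> prob {\<omega> \<in> space M. laplacian_close W N (2 * t) (A \<omega>)}"
      using mono event_measurable by (intro finite_measure_mono) auto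
    finally show "1 - 2 * real N * exp (- (1/2) * real N powr (2 * \<gamma>))
      \<le> prob {\<omega> \<in> space M. laplacian_close W N (2 * real N powr (1/2 + \<gamma>)) (A \<omega>)}"
      unfolding t_def .
  qed
qed

section \<open>Riemann sums of almost everywhere continuous functions\<close>

abbreviation sample_mean :: "nat \<Rightarrow> (real \<Rightarrow> 'a) \<Rightarrow> 'a :: real_vector" where
  "sample_mean N h \<equiv> (\<Sum>j<N. h (real j / real N)) /\<^sub>R real N"

definition step_approx :: "(real \<Rightarrow> 'a) \<Rightarrow> nat \<Rightarrow> real \<Rightarrow> 'a" where
  "step_approx h n s = h (of_int \<lfloor>n * s\<rfloor> / n)"

lemma step_approx_measurable [measurable]:
  "step_approx (h :: real \<Rightarrow> 'a :: topological_space) n \<in> borel_measurable borel"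
proof -
  have "(\<lambda>s. \<lfloor>real n * s\<rfloor>) \<in> measurable borel (count_space UNIV)"
    by measurable
  then have "(\<lambda>i :: int. h (of_int i / n)) \<circ> (\<lambda>s. \<lfloor>real n * s\<rfloor>) \<in> borel_measurable borel"
    by (rule measurable_comp) simp
  then show ?thesis by (simp add: step_approx_def[abs_def] o_def)
qed

lemma step_point_tendsto: "(\<lambda>n. of_int \<lfloor>real n * s\<rfloor> / real n) \<longlonglongrightarrow> s"
proof (rule tendsto_sandwich[of "\<lambda>n. s - 1 / real n" _ _ "\<lambda>n. s"])
  show "\<forall>\<^sub>F n in sequentially. s - 1 / real n \<le> of_int \<lfloor>real n * s\<rfloor> / real n"
    using eventually_gt_at_top[of 0]
  proof eventually_elim
    case (elim n)
    have "real n * s - 1 \<le> of_int \<lfloor>real n * s\<rfloor>" by linarith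
    then have "(real n * s - 1) / n \<le> of_int \<lfloor>real n * s\<rfloor> / n"
      by (intro divide_right_mono) auto
    then show ?case using elim by (simp add: diff_divide_distrib)
  qed
  show "\<forall>\<^sub>F n in sequentially. of_int \<lfloor>real n * s\<rfloor> / real n \<le> s"
    using eventually_gt_at_top[of 0]
  proof eventually_elim
    case (elim n)
    have "of_int \<lfloor>real n * s\<rfloor> / n \<le> (real n * s) / n"
      by (intro divide_right_mono) auto
    then show ?case using elim by simp
  qed
  show "(\<lambda>n. s - 1 / real n) \<longlonglongrightarrow> s"
    using tendsto_diff[OF tendsto_const lim_1_over_n, of s] by simp
qed simp

lemma step_approx_tendsto:
  assumes "isCont h s"
  shows "(\<lambda>n. step_approx h n s) \<longlonglongrightarrow> h s"
  unfolding step_approx_def using isCont_tendsto_compose[OF assms step_point_tendsto] by simp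

lemma step_point_range:
  assumes "0 \<le> s" "s < 1"
  shows "of_int \<lfloor>real n * s\<rfloor> / real n \<in> {0..1}"
proof (cases "n = 0")
  case False
  then have "real n * s < real n" using assms by simp
  then have "\<lfloor>real n * s\<rfloor> < int n" by (simp add: floor_less_iff)
  then have "of_int \<lfloor>real n * s\<rfloor> \<le> real n" by linarith
  then show ?thesis using False assms by simp
qed simp

lemma AE_not_endpoints: "AE s in lborel. s \<noteq> (a :: real)"
proof -
  have "{a} \<in> null_sets lborel" by (simp add: null_sets_def)
  then show ?thesis by (rule AE_I') auto
qed

lemma bounded_set_integrable:
  fixes g :: "real \<Rightarrow> 'a :: {banach, second_countable_topology}"
  assumes [measurable]: "g \<in> borel_measurable borel" and "\<And>s. s \<in> {0..1} \<Longrightarrow> norm (g s) \<le> B"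
  shows "set_integrable lborel {0..1} g"
  unfolding set_integrable_def
proof (rule Bochner_Integration.integrable_bound)
  show "integrable lborel (\<lambda>s. indicator {0..1 :: real} s *\<^sub>R B)"
    by (intro integrable_scaleR_left) simp
  show "AE s in lborel. norm (indicator {0..1} s *\<^sub>R g s) \<le> norm (indicator {0..1} s *\<^sub>R B)"
    using assms(2) by (intro AE_I2) (auto simp: indicator_def intro: order_trans[OF _ abs_ge_self])
qed simp

text \<open>Almost everywhere continuity is what makes the step functions that interpolate the samples
  converge almost everywhere; \<open>g\<close> stands for a Borel version of \<open>h\<close>.\<close>

lemma riemann_sum_tendsto:
  fixes h g :: "real \<Rightarrow> 'a :: euclidean_space"
  assumes bound: "\<And>s. s \<in> {0..1} \<Longrightarrow> norm (h s) \<le> B"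
    and g[measurable]: "g \<in> borel_measurable borel"
    and ae: "AE s in lborel. s \<in> {0<..<1} \<longrightarrow> isCont h s \<and> g s = h s"
  shows "(\<lambda>N. sample_mean N h) \<longlonglongrightarrow> (LINT s:{0..1}|lborel. g s)"
proof -
  have "(\<lambda>N. \<integral>s. indicator {0..<1} s *\<^sub>R step_approx h N s \<partial>lborel) \<longlonglongrightarrow> (\<integral>s. indicator {0..1} s *\<^sub>R g s \<partial>lborel)"
  proof (rule integral_dominated_convergence[where w = "\<lambda>s. indicator {0..1} s * B"])
    show "AE s in lborel. (\<lambda>N. indicator {0..<1} s *\<^sub>R step_approx h N s) \<longlonglongrightarrow> indicator {0..1} s *\<^sub>R g s"
      using ae AE_not_endpoints[of 0] AE_not_endpoints[of 1]
    proof eventually_elim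
      case (elim s)
      show ?case
      proof (cases "s \<in> {0<..<1}")
        case True
        with elim show ?thesis using step_approx_tendsto[of s h] by simp
      next
        case False
        with elim have "s \<notin> {0..1}" "s \<notin> {0..<1}" by auto
        then show ?thesis by simp
      qed
    qed
    have "0 \<le> B" using bound[of 0] norm_ge_zero[of "h 0"] by (simp del: norm_ge_zero)
    then show "AE s in lborel. norm (indicator {0..<1} s *\<^sub>R step_approx h N s) \<le> indicator {0..1} s * B" for N
      using bound step_point_range by (intro AE_I2) (auto simp: indicator_def step_approx_def)
    show "integrable lborel (\<lambda>s. indicator {0..1 :: real} s * B)"
      by (intro integrable_mult_left) simp
  qed simp_all
  moreover have "\<forall>\<^sub>F N in sequentially. (\<integral>s. indicator {0..<1} s *\<^sub>R step_approx h N s \<partial>lborel) = sample_mean N h"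
    using eventually_gt_at_top[of 0]
  proof eventually_elim
    case (elim N)
    have "indicator {0..<1} s *\<^sub>R step_approx h N s = (\<Sum>j<N. indicator {real j / N..<(real j + 1) / N} s *\<^sub>R h (real j / real N))" for s
    proof (cases "s \<in> {0..<1}")
      case True
      define q where "q = nat \<lfloor>real N * s\<rfloor>"
      have "0 \<le> \<lfloor>real N * s\<rfloor>" using True by simp
      then have q: "real q = of_int \<lfloor>real N * s\<rfloor>" by (simp add: q_def)
      have "real N * s < real N" using True elim by simp
      then have "q < N" using q by linarith
      have "s \<in> {real j / N..<(real j + 1) / N} \<longleftrightarrow> j = q" for j
      proof -
        have "s \<in> {real j / N..<(real j + 1) / N} \<longleftrightarrow> \<lfloor>real N * s\<rfloor> = int j"
          using elim by (simp add: floor_eq_iff field_simps)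
        then show ?thesis using q by linarith
      qed
      then have "(\<Sum>j<N. indicator {real j / N..<(real j + 1) / N} s *\<^sub>R h (real j / real N)) = (\<Sum>j<N. if j = q then h (real j / real N) else 0)"
        by (intro sum.cong) (simp_all add: indicator_def)
      then show ?thesis
        using True \<open>q < N\<close> q by (simp add: step_approx_def sum.delta)
    next
      case False
      have "s \<notin> {real j / N..<(real j + 1) / N}" if "j < N" for j
      proof
        assume *: "s \<in> {real j / N..<(real j + 1) / N}"
        have "0 \<le> real j / N" by simp
        also have "\<dots> \<le> s" using * by simp
        finally have "0 \<le> s" .
        moreover have "(real j + 1) / N \<le> 1" using that elim by simp
        ultimately show False using * False by auto
      qed
      then have "(\<Sum>j<N. indicator {real j / N..<(real j + 1) / N} s *\<^sub>R h (real j / real N)) = 0"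
        by (intro sum.neutral) simp
      then show ?thesis using False by simp
    qed
    then have "(\<integral>s. indicator {0..<1} s *\<^sub>R step_approx h N s \<partial>lborel)
        = (\<Sum>j<N. \<integral>s. indicator {real j / N..<(real j + 1) / N} s *\<^sub>R h (real j / real N) \<partial>lborel)"
      using elim by (simp only:)
        (intro Bochner_Integration.integral_sum integrable_scaleR_left,
          simp add: integrable_indicator_iff divide_right_mono)
    also have "\<dots> = (\<Sum>j<N. h (real j / real N) /\<^sub>R real N)"
      using elim by (intro sum.cong refl) (simp add: divide_right_mono add_divide_distrib inverse_eq_divide)
    finally show ?case by (simp add: scaleR_sum_right)
  qed
  ultimately show ?thesis
    unfolding set_lebesgue_integral_def by (rule Lim_transform_eventually)
qed

text \<open>At a point of continuity \<open>R\<close> is the limit of the step functions that sample it, and these are Borel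
  functions whatever \<open>R\<close> is. Clipping the limit keeps its values in the unit interval where the step
  functions do not converge, and evaluation at \<open>frac s\<close> makes it periodic.\<close>

lemma borel_version:
  fixes R :: "real \<Rightarrow> real"
  assumes R: "\<And>s. s \<in> {0..1} \<Longrightarrow> R s \<in> {0..1}"
    and ae: "AE s in lborel. s \<in> {0<..<1} \<longrightarrow> isCont R s"
  obtains \<rho> where "\<rho> \<in> borel_measurable borel" "\<And>s. \<rho> s \<in> {0..1}" "\<And>s. \<rho> (s + 1) = \<rho> s"
    "AE s in lborel. s \<in> {0<..<1} \<longrightarrow> isCont R s \<and> \<rho> s = R s"
proof
  define \<rho> where "\<rho> s = max 0 (min 1 (lim (\<lambda>n. step_approx R n (frac s))))" for s
  have [measurable]: "(frac :: real \<Rightarrow> real) \<in> borel_measurable borel"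
    unfolding frac_def[abs_def] by measurable
  show "\<rho> \<in> borel_measurable borel"
    unfolding \<rho>_def[abs_def] by measurable
  show "\<rho> s \<in> {0..1}" for s by (simp add: \<rho>_def)
  show "\<rho> (s + 1) = \<rho> s" for s by (simp add: \<rho>_def frac_1_eq)
  show "AE s in lborel. s \<in> {0<..<1} \<longrightarrow> isCont R s \<and> \<rho> s = R s"
    using ae
  proof eventually_elim
    case (elim s)
    show ?case
    proof
      assume s: "s \<in> {0<..<1}"
      then have "frac s = s" by (simp add: frac_eq)
      then have "lim (\<lambda>n. step_approx R n (frac s)) = R s"
        using elim s step_approx_tendsto[of s R] by (simp add: limI)
      then show "isCont R s \<and> \<rho> s = R s" using elim s R[of s] by (simp add: \<rho>_def)
    qed
  qed
qed

section \<open>Decay of discrete Fourier coefficients\<close>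

lemma sin_ge_half:
  assumes "0 \<le> x" "x \<le> pi / 2"
  shows "x / 2 \<le> sin x"
proof -
  have "x \<le> 16/10" using assms pi_approx by simp
  then have "x\<^sup>2 \<le> (16/10)\<^sup>2" using assms by (intro power_mono) auto
  then have "x * x\<^sup>2 \<le> x * 3" using assms by (intro mult_left_mono) (auto simp: power2_eq_square)
  moreover have "\<bar>sin x - x\<bar> \<le> x ^ 3 / 6"
    using Maclaurin_sin_bound[of x 3] assms
    by (simp add: sin_coeff_def numeral_eq_Suc inverse_eq_divide)
  moreover have "x - sin x \<le> \<bar>sin x - x\<bar>" by linarith
  ultimately show ?thesis by (simp add: power2_eq_square power3_eq_cube mult.assoc)
qed

text \<open>The lower bound keeps \<open>1 - z\<close> away from \<open>0\<close> in proportion to the frequency, up to frequency \<open>N/2\<close>.\<close>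

lemma cmod_one_minus_cis:
  assumes "\<bar>t\<bar> \<le> pi"
  shows "\<bar>t\<bar> / 2 \<le> cmod (1 - cis t)"
proof -
  have "(cmod (1 - cis t))\<^sup>2 = (1 - cos t)\<^sup>2 + (sin t)\<^sup>2"
    by (simp add: cmod_power2)
  also have "\<dots> = 2 - 2 * cos t"
    using sin_cos_squared_add[of t] by (simp add: power2_eq_square algebra_simps)
  also have "\<dots> = (2 * sin (\<bar>t\<bar> / 2))\<^sup>2"
    using cos_double_sin[of "\<bar>t\<bar> / 2"] by (simp add: power_mult_distrib)
  finally have "cmod (1 - cis t) = \<bar>2 * sin (\<bar>t\<bar> / 2)\<bar>"
    by (metis abs_norm_cancel power2_abs power2_eq_iff_nonneg norm_ge_zero abs_ge_zero)
  moreover have "\<bar>t\<bar> / 2 / 2 \<le> sin (\<bar>t\<bar> / 2)"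
    using assms by (intro sin_ge_half) auto
  ultimately show ?thesis by linarith
qed

text \<open>Summation by parts: a sequence with few jumps has small Fourier coefficients.\<close>

lemma geometric_sum_by_parts:
  fixes z :: complex and c :: "nat \<Rightarrow> complex"
  assumes "cmod z = 1" and "\<And>j. j \<le> N \<Longrightarrow> cmod (c j) \<le> B"
  shows "cmod ((1 - z) * (\<Sum>j<N. c j * z ^ j)) \<le> 2 * B + (\<Sum>j<N. cmod (c (Suc j) - c j))"
proof -
  have "(1 - z) * (\<Sum>j<N. c j * z ^ j) = c 0 - c N * z ^ N + (\<Sum>j<N. (c (Suc j) - c j) * z ^ Suc j)"
  proof (induction N)
    case (Suc N)
    define T where "T = (\<Sum>j<N. (c (Suc j) - c j) * z ^ Suc j)"
    have "(1 - z) * (\<Sum>j<Suc N. c j * z ^ j) = (1 - z) * (\<Sum>j<N. c j * z ^ j) + (1 - z) * (c N * z ^ N)"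
      by (simp add: distrib_left)
    also have "\<dots> = c 0 - c N * z ^ N + T + (1 - z) * (c N * z ^ N)"
      unfolding Suc.IH T_def ..
    also have "\<dots> = c 0 - c (Suc N) * z ^ Suc N + (T + (c (Suc N) - c N) * z ^ Suc N)"
      by (simp add: algebra_simps)
    finally show ?case by (simp add: T_def)
  qed simp
  also have "cmod \<dots> \<le> (cmod (c 0) + cmod (c N * z ^ N)) + (\<Sum>j<N. cmod ((c (Suc j) - c j) * z ^ Suc j))"
    by (intro order_trans[OF norm_triangle_ineq] add_mono norm_triangle_ineq4 norm_sum)
  also have "\<dots> = cmod (c 0) + cmod (c N) + (\<Sum>j<N. cmod (c (Suc j) - c j))"
    using assms(1) by (simp add: norm_mult norm_power)
  finally show ?thesis using assms(2)[of 0] assms(2)[of N] by simp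
qed

text \<open>A step function with \<open>n\<close> steps has at most \<open>n\<close> jumps among its \<open>N\<close> samples, however large \<open>N\<close> is.\<close>

lemma step_approx_fourier_sum:
  fixes h :: "real \<Rightarrow> complex"
  assumes bound: "\<And>s. s \<in> {0..1} \<Longrightarrow> cmod (h s) \<le> B" and "0 < n" "0 < N"
    and k: "k \<noteq> 0" "2 * \<bar>k\<bar> \<le> int N"
  shows "cmod (sample_mean N (\<lambda>s. step_approx h n s * cis (2 * pi * k * s))) \<le> 2 * B * (1 + n) / \<bar>k\<bar>"
proof -
  have N: "real N > 0" using \<open>0 < N\<close> by simp
  have B: "0 \<le> B" using bound[of 0] norm_ge_zero[of "h 0"] by (simp del: norm_ge_zero)
  define z where "z = cis (2 * pi * k / N)"
  define q where "q j = \<lfloor>real n * (real j / N)\<rfloor>" for j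
  define c where "c j = h (of_int (q j) / n)" for j
  have q_mono: "q j \<le> q (Suc j)" for j
    unfolding q_def using N by (intro floor_mono mult_left_mono divide_right_mono) auto
  have q_range: "of_int (q j) / real n \<in> {0..1}" if "j \<le> N" for j
  proof -
    have "real n * (real j / N) \<le> real n * 1" using that N by (intro mult_left_mono) auto
    then have "q j \<le> int n" unfolding q_def by linarith
    moreover have "0 \<le> q j" using N by (simp add: q_def)
    ultimately show ?thesis using \<open>0 < n\<close> by simp
  qed
  have c_bound: "cmod (c j) \<le> B" if "j \<le> N" for j
    using bound[OF q_range[OF that]] by (simp add: c_def)
  have "(\<Sum>j<N. cmod (c (Suc j) - c j)) \<le> (\<Sum>j<N. 2 * B * of_int (q (Suc j) - q j))"
  proof (rule sum_mono)
    fix j assume j: "j \<in> {..<N}"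
    show "cmod (c (Suc j) - c j) \<le> 2 * B * of_int (q (Suc j) - q j)"
    proof (cases "q (Suc j) = q j")
      case False
      then have "1 \<le> real_of_int (q (Suc j) - q j)" using q_mono[of j] by linarith
      then have "2 * B * 1 \<le> 2 * B * of_int (q (Suc j) - q j)"
        using B by (intro mult_left_mono) auto
      moreover have "cmod (c (Suc j) - c j) \<le> B + B"
        using j c_bound[of j] c_bound[of "Suc j"] by (intro order_trans[OF norm_triangle_ineq4]) auto
      ultimately show ?thesis by simp
    qed (simp add: c_def)
  qed
  also have "\<dots> = 2 * B * of_int (\<Sum>j<N. q (Suc j) - q j)"
    by (simp add: sum_distrib_left)
  also have "(\<Sum>j<N. q (Suc j) - q j) = int n"
    using N by (subst sum_lessThan_telescope) (simp add: q_def)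
  finally have jumps: "(\<Sum>j<N. cmod (c (Suc j) - c j)) \<le> 2 * B * n" by simp
  have pow: "cis (2 * pi * k * (real j / real N)) = z ^ j" for j :: nat
  proof -
    have "2 * pi * k * (real j / real N) = real j * (2 * pi * k / N)" by simp
    then show ?thesis by (simp only: z_def Complex.DeMoivre)
  qed
  have S: "(\<Sum>j<N. step_approx h n (real j / real N) * cis (2 * pi * k * (real j / real N))) = (\<Sum>j<N. c j * z ^ j)"
    unfolding pow by (simp add: step_approx_def c_def q_def)
  have "cmod z = 1" by (simp add: z_def)
  have "pi * \<bar>k\<bar> / N \<le> cmod (1 - z)"
  proof -
    have "2 * \<bar>of_int k\<bar> \<le> real N" using k(2) by linarith
    then have "\<bar>2 * pi * k / N\<bar> \<le> pi"
      using N by (simp add: abs_mult pos_divide_le_eq mult.commute)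
    from cmod_one_minus_cis[OF this] show ?thesis
      using N by (simp add: z_def abs_mult)
  qed
  moreover have "\<bar>k\<bar> / N \<le> pi * \<bar>k\<bar> / N"
    using mult_right_mono[of 1 pi "\<bar>real_of_int k\<bar>"] pi_gt3 N by (intro divide_right_mono) auto
  ultimately have "\<bar>k\<bar> / N \<le> cmod (1 - z)" by linarith
  then have "\<bar>k\<bar> / N * cmod (\<Sum>j<N. c j * z ^ j) \<le> cmod ((1 - z) * (\<Sum>j<N. c j * z ^ j))"
    unfolding norm_mult by (intro mult_right_mono) auto
  also have "\<dots> \<le> 2 * B + 2 * B * n"
    using geometric_sum_by_parts[of z N c B] \<open>cmod z = 1\<close> c_bound jumps by fastforce
  finally have "\<bar>k\<bar> * (cmod (\<Sum>j<N. c j * z ^ j) / N) \<le> 2 * B * (1 + n)"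
    by (simp add: algebra_simps)
  moreover have "cmod ((\<Sum>j<N. c j * z ^ j) /\<^sub>R real N) = cmod (\<Sum>j<N. c j * z ^ j) / N"
    by (simp add: divide_inverse mult.commute)
  moreover have "0 < real_of_int \<bar>k\<bar>" using k(1) by simp
  ultimately show ?thesis
    unfolding S by (simp only: pos_le_divide_eq mult.commute)
qed

text \<open>A Riemann-Lebesgue lemma that is uniform in \<open>N\<close>. The function is replaced by a step function that does
  not depend on \<open>N\<close> or \<open>k\<close>. For \<open>\<bar>k\<bar> \<le> N/2\<close> the coefficients of the step function are of order \<open>1/\<bar>k\<bar>\<close>, and
  those of the error are at most its mean absolute value at the sample points, which is again a Riemann sum.\<close>

lemma discrete_fourier_decay:
  fixes h g :: "real \<Rightarrow> complex"
  assumes bound: "\<And>s. s \<in> {0..1} \<Longrightarrow> cmod (h s) \<le> B"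
    and g[measurable]: "g \<in> borel_measurable borel" and g_bound: "\<And>s. cmod (g s) \<le> B"
    and ae: "AE s in lborel. s \<in> {0<..<1} \<longrightarrow> isCont h s \<and> g s = h s"
    and "0 < \<epsilon>"
  obtains K N0 where "0 < K" "\<And>N k. N0 \<le> N \<Longrightarrow> K \<le> \<bar>k\<bar> \<Longrightarrow> 2 * \<bar>k\<bar> \<le> int N \<Longrightarrow>
    cmod (sample_mean N (\<lambda>s. h s * cis (2 * pi * k * s))) < \<epsilon>"
proof -
  have B: "0 \<le> B" using g_bound[of 0] norm_ge_zero[of "g 0"] by (simp del: norm_ge_zero)
  have "(\<lambda>n. \<integral>s. indicator {0..1} s *\<^sub>R cmod (g s - step_approx h n s) \<partial>lborel) \<longlonglongrightarrow> (\<integral>s. 0 \<partial>(lborel :: real measure))"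
  proof (rule integral_dominated_convergence[where w = "\<lambda>s. indicator {0..1} s * (2 * B)"])
    show "AE s in lborel. (\<lambda>n. indicator {0..1} s *\<^sub>R cmod (g s - step_approx h n s)) \<longlonglongrightarrow> 0"
      using ae AE_not_endpoints[of 0] AE_not_endpoints[of 1]
    proof eventually_elim
      case (elim s)
      show ?case
      proof (cases "s \<in> {0<..<1}")
        case True
        with elim have "(\<lambda>n. g s - step_approx h n s) \<longlonglongrightarrow> g s - h s"
          by (intro tendsto_diff tendsto_const step_approx_tendsto) auto
        then have "(\<lambda>n. cmod (g s - step_approx h n s)) \<longlonglongrightarrow> 0"
          using tendsto_norm elim True by fastforce
        then show ?thesis using True by simp
      next
        case False
        with elim have "s \<notin> {0..1}" by auto
        then show ?thesis by simp
      qed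
    qed
    show "AE s in lborel. norm (indicator {0..1} s *\<^sub>R cmod (g s - step_approx h n s)) \<le> indicator {0..1} s * (2 * B)" for n
      using AE_not_endpoints[of 1]
    proof eventually_elim
      case (elim s)
      have "cmod (g s - step_approx h n s) \<le> B + B" if "0 \<le> s" "s < 1"
        using g_bound[of s] bound[OF step_point_range[OF that, of n]]
        by (intro order_trans[OF norm_triangle_ineq4]) (simp add: step_approx_def)
      then show ?case using elim by (auto simp: indicator_def)
    qed
    show "integrable lborel (\<lambda>s. indicator {0..1 :: real} s * (2 * B))"
      by (intro integrable_mult_left) simp
  qed simp_all
  then have "\<forall>\<^sub>F n in sequentially. (\<integral>s. indicator {0..1} s *\<^sub>R cmod (g s - step_approx h n s) \<partial>lborel) < \<epsilon> / 2 \<and> 0 < n"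
    using order_tendstoD(2)[of _ "0 :: real" sequentially "\<epsilon> / 2"] \<open>0 < \<epsilon>\<close> eventually_gt_at_top[of "0 :: nat"]
    by (auto intro!: eventually_conj)
  then obtain n where n: "(\<integral>s. indicator {0..1} s *\<^sub>R cmod (g s - step_approx h n s) \<partial>lborel) < \<epsilon> / 2" "0 < n"
    by (auto simp: eventually_sequentially)
  \<comment> \<open>the approximation error is itself almost everywhere continuous, hence its Riemann sums are small\<close>
  have "(\<lambda>N. sample_mean N (\<lambda>s. cmod (h s - step_approx h n s)))
      \<longlonglongrightarrow> (LINT s:{0..1}|lborel. cmod (g s - step_approx h n s))"
  proof (rule riemann_sum_tendsto)
    show "norm (cmod (h s - step_approx h n s)) \<le> 2 * B" if "s \<in> {0..1}" for s
    proof -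
      have "of_int \<lfloor>real n * s\<rfloor> / real n \<in> {0..1}"
        using that step_point_range[of s n] \<open>0 < n\<close> by (cases "s = 1") auto
      then have "cmod (step_approx h n s) \<le> B" using bound by (simp add: step_approx_def)
      then show ?thesis using bound[OF that] norm_triangle_ineq4[of "h s" "step_approx h n s"] by simp
    qed
    have "AE s in lborel. \<forall>i\<in>{0..n}. s \<noteq> real i / n"
      by (intro AE_finite_allI AE_not_endpoints) simp
    with ae show "AE s in lborel. s \<in> {0<..<1} \<longrightarrow> isCont (\<lambda>s. cmod (h s - step_approx h n s)) s \<and>
        cmod (g s - step_approx h n s) = cmod (h s - step_approx h n s)"
    proof eventually_elim
      case (elim s)
      show ?case
      proof
        assume s: "s \<in> {0<..<1}"
        have "real n * s \<notin> \<int>"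
        proof
          assume "real n * s \<in> \<int>"
          then obtain i where i: "real n * s = of_int i" by (auto elim: Ints_cases)
          have "0 \<le> real n * s" "real n * s \<le> real n * 1" using s by (simp, intro mult_left_mono) auto
          then have "0 \<le> i" "i \<le> int n" using i by auto
          then have "s = real (nat i) / n" "nat i \<in> {0..n}" using i \<open>0 < n\<close> by (auto simp: field_simps)
          with elim show False by blast
        qed
        then have "isCont (\<lambda>x. real_of_int \<lfloor>x\<rfloor>) (real n * s)"
          using continuous_floor[of "real n * s"] by (simp add: o_def)
        then have fl: "isCont (\<lambda>s. real_of_int \<lfloor>real n * s\<rfloor>) s"
          by (rule isCont_o2[rotated]) simp
        have "\<forall>\<^sub>F x in at s. real_of_int \<lfloor>real n * x\<rfloor> = of_int \<lfloor>real n * s\<rfloor>"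
        proof -
          have "\<forall>\<^sub>F x in at s. dist (real_of_int \<lfloor>real n * x\<rfloor>) (of_int \<lfloor>real n * s\<rfloor>) < 1"
            using fl by (auto simp: isCont_def dest: tendstoD[of _ _ _ 1])
          then show ?thesis by eventually_elim (simp add: dist_real_def)
        qed
        then have "\<forall>\<^sub>F x in at s. step_approx h n s = step_approx h n x"
          by eventually_elim (simp add: step_approx_def)
        then have "isCont (step_approx h n) s"
          unfolding isCont_def by (rule Lim_transform_eventually[OF tendsto_const])
        then show "isCont (\<lambda>s. cmod (h s - step_approx h n s)) s \<and>
            cmod (g s - step_approx h n s) = cmod (h s - step_approx h n s)"
          using elim s by (intro conjI isCont_norm isCont_diff) auto
      qed
    qed
  qed simp
  then have "\<forall>\<^sub>F N in sequentially. sample_mean N (\<lambda>s. cmod (h s - step_approx h n s)) < \<epsilon> / 2"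
    using n(1) by (intro order_tendstoD(2)) (auto simp: set_lebesgue_integral_def)
  then obtain N0 where N0: "\<And>N. N0 \<le> N \<Longrightarrow> sample_mean N (\<lambda>s. cmod (h s - step_approx h n s)) < \<epsilon> / 2"
    by (auto simp: eventually_sequentially)
  define K where "K = max 1 (\<lceil>4 * B * (1 + n) / \<epsilon>\<rceil>)"
  show ?thesis
  proof
    show "0 < K" by (simp add: K_def)
    fix N :: nat and k :: int
    assume N: "N0 \<le> N" and k: "K \<le> \<bar>k\<bar>" "2 * \<bar>k\<bar> \<le> int N"
    define e where "e j = cis (2 * pi * k * (real j / N))" for j :: nat
    have k0: "k \<noteq> 0" "0 < N" using k by (auto simp: K_def)
    have "4 * B * (1 + n) / \<epsilon> \<le> \<bar>k\<bar>"
      using k(1) unfolding K_def by linarith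
    then have "2 * B * (1 + n) / \<bar>k\<bar> \<le> \<epsilon> / 2"
      using \<open>0 < \<epsilon>\<close> k0(1) by (simp add: field_simps)
    then have 1: "cmod ((\<Sum>j<N. step_approx h n (real j / real N) * e j) /\<^sub>R real N) \<le> \<epsilon> / 2"
      using step_approx_fourier_sum[of h B n N k] bound n(2) k0 k(2) unfolding e_def by fastforce
    have "cmod ((\<Sum>j<N. (h (real j / real N) - step_approx h n (real j / real N)) * e j) /\<^sub>R real N)
        \<le> sample_mean N (\<lambda>s. cmod (h s - step_approx h n s))"
      by (auto simp: e_def norm_mult intro!: mult_left_mono order_trans[OF norm_sum])
    then have 2: "cmod ((\<Sum>j<N. (h (real j / real N) - step_approx h n (real j / real N)) * e j) /\<^sub>R real N) < \<epsilon> / 2"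
      using N0[OF N] by linarith
    have eq: "(\<Sum>j<N. h (real j / real N) * e j) /\<^sub>R real N
        = (\<Sum>j<N. step_approx h n (real j / real N) * e j) /\<^sub>R real N + (\<Sum>j<N. (h (real j / real N) - step_approx h n (real j / real N)) * e j) /\<^sub>R real N"
      by (simp add: scaleR_add_right[symmetric] sum.distrib[symmetric] algebra_simps)
    have "cmod ((\<Sum>j<N. h (real j / real N) * e j) /\<^sub>R real N) < \<epsilon>"
      unfolding eq using norm_triangle_ineq[of "(\<Sum>j<N. step_approx h n (real j / real N) * e j) /\<^sub>R real N"
        "(\<Sum>j<N. (h (real j / real N) - step_approx h n (real j / real N)) * e j) /\<^sub>R real N"] 1 2
      by linarith
    then show "cmod (sample_mean N (\<lambda>s. h s * cis (2 * pi * k * s))) < \<epsilon>"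
      by (simp add: e_def)
  qed
qed

section \<open>The kernel of a ring graphon as a periodic function\<close>

lemma AE_unit_leb: "(AE x in unit_leb. P x) \<longleftrightarrow> (AE x in lborel. x \<in> {0..1} \<longrightarrow> P x)"
  by (simp add: AE_restrict_space_iff AE_completion_iff)

lemma AE_lborel_affine:
  fixes P :: "real \<Rightarrow> bool"
  assumes "AE x in lborel. P x" and "c \<noteq> 0"
  shows "AE x in lborel. P (t + c * x)"
proof -
  have "AE x in density (distr lborel borel (\<lambda>x. t + c * x)) (\<lambda>_. \<bar>c\<bar>). P x"
    using assms by (subst lborel_real_affine[of c t, symmetric])
  then have "AE x in distr lborel borel (\<lambda>x. t + c * x). P x"
    using assms(2) by (simp add: AE_density)
  then show ?thesis
    by (rule AE_distrD[rotated]) simp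
qed

lemma AE_ex_in_interval:
  assumes "AE x in lborel. P x" and "a < (b :: real)"
  shows "\<exists>x. a < x \<and> x < b \<and> P x"
proof (rule ccontr)
  assume none: "\<not> ?thesis"
  have "AE x in lborel. x \<notin> {a<..<b}"
    using assms(1) none by (auto elim!: eventually_mono)
  then have "{a<..<b} \<in> null_sets lborel"
    by (subst AE_iff_null_sets) simp_all
  then show False using assms(2) by (simp add: null_sets_def)
qed

text \<open>On almost every vertical line the graphon is continuous almost everywhere, and along such a
  line it is \<open>R\<close> up to a reflection. One line reaches the distances up to \<open>1/2\<close>, and the symmetry
  \<open>R s = R (1 - s)\<close> gives the others.\<close>

lemma ring_graphon_kernel:
  assumes "ring_graphon W" and "ae_continuous W"
  obtains R where "\<And>s. s \<in> {0..1} \<Longrightarrow> R s \<in> {0..1}" "\<And>s. s \<in> {0..1} \<Longrightarrow> R s = R (1 - s)"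
    "\<And>x y. x \<in> {0..1} \<Longrightarrow> y \<in> {0..1} \<Longrightarrow> W x y = R \<bar>x - y\<bar>"
    "AE s in lborel. s \<in> {0<..<1} \<longrightarrow> isCont R s"
proof -
  obtain R where R: "\<And>s. s \<in> {0..1} \<Longrightarrow> R s \<in> {0..1}" "\<And>s. s \<in> {0..1} \<Longrightarrow> R s = R (1 - s)"
    and W: "\<And>x y. x \<in> {0..1} \<Longrightarrow> y \<in> {0..1} \<Longrightarrow> W x y = R \<bar>x - y\<bar>"
    using assms(1) unfolding ring_graphon_def by blast
  let ?Q = "{0..1} \<times> {0..1} :: (real \<times> real) set"
  have "?Q = cbox (0, 0) (1, 1)"
    unfolding cbox_Pair_eq by simp
  then have "?Q \<in> sets lebesgue" by simp
  then have "AE p in lborel. p \<in> ?Q \<longrightarrow> continuous (at p within ?Q) (case_prod W)"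
    using assms(2) by (simp add: ae_continuous_def AE_restrict_space_iff AE_completion_iff)
  then have "AE x in lborel. AE y in lborel. (x, y) \<in> ?Q \<longrightarrow> continuous (at (x, y) within ?Q) (case_prod W)"
    by (subst (asm) lborel_prod[symmetric]) (rule lborel_pair.AE_pair)
  then have "\<exists>x>0. x < 1 \<and> (AE y in lborel. (x, y) \<in> ?Q \<longrightarrow> continuous (at (x, y) within ?Q) (case_prod W))"
    by (rule AE_ex_in_interval) simp
  then obtain x0 where x0: "0 < x0" "x0 < 1"
    and ae: "AE y in lborel. (x0, y) \<in> ?Q \<longrightarrow> continuous (at (x0, y) within ?Q) (case_prod W)"
    by blast
  have cont: "isCont R s"
    if s: "0 < s" "x0 + \<sigma> * s \<in> {0<..<1}" and \<sigma>: "\<bar>\<sigma>\<bar> = 1"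
      and c: "continuous (at (x0, x0 + \<sigma> * s) within ?Q) (case_prod W)" for s \<sigma>
  proof -
    have nbhd: "\<forall>\<^sub>F t in at s. 0 < t \<and> x0 + \<sigma> * t \<in> {0<..<1}"
    proof -
      have "open ({0<..} \<inter> (\<lambda>t. x0 + \<sigma> * t) -` {0<..<1})"
        by (intro open_Int open_greaterThan open_vimage open_greaterThanLessThan continuous_intros)
      then have "\<forall>\<^sub>F t in nhds s. t \<in> {0<..} \<inter> (\<lambda>t. x0 + \<sigma> * t) -` {0<..<1}"
        using s by (intro eventually_nhds_in_open) auto
      then show ?thesis by (auto simp: eventually_at_filter elim: eventually_mono)
    qed
    have W_line: "case_prod W (x0, x0 + \<sigma> * t) = R t" if "0 < t" "x0 + \<sigma> * t \<in> {0<..<1}" for t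
      using that x0 \<sigma> W[of x0 "x0 + \<sigma> * t"] by (simp add: abs_mult)
    have "filterlim (\<lambda>t. (x0, x0 + \<sigma> * t)) (at (x0, x0 + \<sigma> * s) within ?Q) (at s)"
      unfolding filterlim_at
    proof
      show "((\<lambda>t. (x0, x0 + \<sigma> * t)) \<longlongrightarrow> (x0, x0 + \<sigma> * s)) (at s)"
        by (intro tendsto_intros)
      show "\<forall>\<^sub>F t in at s. (x0, x0 + \<sigma> * t) \<in> ?Q \<and> (x0, x0 + \<sigma> * t) \<noteq> (x0, x0 + \<sigma> * s)"
        using nbhd eventually_neq_at_within[of s s]
        by eventually_elim (use x0 \<sigma> in auto)
    qed
    from filterlim_compose[OF c[unfolded continuous_within] this]
    have "((\<lambda>t. case_prod W (x0, x0 + \<sigma> * t)) \<longlongrightarrow> R s) (at s)"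
      using W_line[OF s] by simp
    then have "(R \<longlongrightarrow> R s) (at s)"
    proof (rule Lim_transform_eventually)
      show "\<forall>\<^sub>F t in at s. case_prod W (x0, x0 + \<sigma> * t) = R t"
        using nbhd by eventually_elim (use W_line in blast)
    qed
    then show ?thesis by (simp add: isCont_def)
  qed
  have nz: "(1 :: real) \<noteq> 0" "(-1 :: real) \<noteq> 0" by simp_all
  have "AE s in lborel. 0 < s \<and> x0 + s \<in> {0<..<1} \<longrightarrow> isCont R s"
    using AE_lborel_affine[OF ae nz(1), of x0]
    by eventually_elim (use cont[of _ 1] x0 in auto)
  moreover have "AE s in lborel. 0 < s \<and> x0 - s \<in> {0<..<1} \<longrightarrow> isCont R s"
    using AE_lborel_affine[OF ae nz(2), of x0]
    by eventually_elim (use cont[of _ "-1"] x0 in auto)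
  ultimately have half: "AE s in lborel. s \<in> {0<..<1/2} \<longrightarrow> isCont R s"
  proof eventually_elim
    case (elim s)
    show ?case
    proof
      assume s: "s \<in> {0<..<1/2}"
      show "isCont R s"
      proof (cases "x0 < 1/2")
        case True
        then have "0 < s \<and> x0 + s \<in> {0<..<1}" using s x0 by auto
        with elim(1) show ?thesis by blast
      next
        case False
        then have "0 < s \<and> x0 - s \<in> {0<..<1}" using s x0 by auto
        with elim(2) show ?thesis by blast
      qed
    qed
  qed
  have refl: "isCont R s" if "isCont R (1 - s)" "s \<in> {0<..<1}" for s
  proof -
    have "(\<lambda>t. R (1 - t)) \<midarrow>s\<rightarrow> R (1 - s)"
      by (rule isCont_tendsto_compose[OF that(1)]) (intro tendsto_intros)
    moreover have "\<forall>\<^sub>F t in at s. R (1 - t) = R t"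
    proof -
      have "\<forall>\<^sub>F t in nhds s. t \<in> {0<..<1}"
        using that(2) by (intro eventually_nhds_in_open) auto
      then have "\<forall>\<^sub>F t in at s. t \<in> {0<..<1}"
        by (auto simp: eventually_at_filter elim: eventually_mono)
      then show ?thesis
      proof eventually_elim
        case (elim t)
        then show ?case using R(2)[of t] by simp
      qed
    qed
    ultimately have "R \<midarrow>s\<rightarrow> R (1 - s)" by (rule Lim_transform_eventually)
    then show ?thesis using R(2)[of s] that(2) by (simp add: isCont_def)
  qed
  have "AE s in lborel. s \<in> {0<..<1} \<longrightarrow> isCont R s"
    using half AE_lborel_affine[OF half nz(2), of 1] AE_not_endpoints[of "1/2"]
  proof eventually_elim
    case (elim s)
    show ?case
    proof
      assume s: "s \<in> {0<..<1}"
      show "isCont R s"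
      proof (cases "s < 1/2")
        case True
        with s elim(1) show ?thesis by simp
      next
        case False
        with s elim(3) have "1 + (-1) * s \<in> {0<..<1/2}" by auto
        with elim(2) have "isCont R (1 - s)" by simp
        then show ?thesis using s by (rule refl)
      qed
    qed
  qed
  with R W show ?thesis by (rule that)
qed

abbreviation unit_integral :: "(real \<Rightarrow> 'a) \<Rightarrow> 'a :: {banach, second_countable_topology}" where
  "unit_integral g \<equiv> (LINT s:{0..1}|lborel. g s)"

lemma unit_integral_cong_AE:
  fixes F G :: "real \<Rightarrow> 'a :: {banach, second_countable_topology}"
  assumes "F \<in> borel_measurable borel" "G \<in> borel_measurable borel"
    and "AE x in lborel. x \<in> {0..1} \<longrightarrow> F x = G x"
  shows "unit_integral F = unit_integral G"
  unfolding set_lebesgue_integral_def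
proof (rule integral_cong_AE)
  show "AE x in lborel. indicator {0..1} x *\<^sub>R F x = indicator {0..1} x *\<^sub>R G x"
    using assms(3) by eventually_elim (auto simp: indicator_def)
qed (use assms(1,2) in simp_all)

lemma lebesgue_measurable_AE_eq:
  fixes F G :: "real \<Rightarrow> 'a :: topological_space"
  assumes G: "G \<in> borel_measurable lborel" and eq: "AE x in lborel. F x = G x"
  shows "F \<in> borel_measurable lebesgue"
proof (rule measurableI)
  fix A :: "'a set" assume A: "A \<in> sets borel"
  show "F -` A \<inter> space lebesgue \<in> sets lebesgue"
  proof (rule completion.in_sets_AE)
    show "AE x in lebesgue. x \<in> G -` A \<inter> space lborel \<longleftrightarrow> x \<in> F -` A \<inter> space lebesgue"
      unfolding AE_completion_iff using eq by eventually_elim simp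
    show "G -` A \<inter> space lborel \<in> sets lebesgue"
      using measurable_sets[OF G A] by simp
  qed simp
qed simp

lemma integral_unit_leb:
  fixes F G :: "real \<Rightarrow> 'a :: {banach, second_countable_topology}"
  assumes G: "G \<in> borel_measurable borel" and eq: "AE x in lborel. x \<in> {0..1} \<longrightarrow> F x = G x"
  shows "(LINT x|unit_leb. F x) = unit_integral G"
proof -
  have eq': "AE x in lborel. indicator {0..1} x *\<^sub>R F x = indicator {0..1} x *\<^sub>R G x"
    using eq by eventually_elim (auto simp: indicator_def)
  have G': "(\<lambda>x. indicator {0..1} x *\<^sub>R G x) \<in> borel_measurable lborel"
    using G by simp
  have "(LINT x|unit_leb. F x) = (\<integral>x. indicator {0..1} x *\<^sub>R F x \<partial>lebesgue)"
    by (rule integral_restrict_space) simp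
  also have "\<dots> = (\<integral>x. indicator {0..1} x *\<^sub>R G x \<partial>lebesgue)"
    using lebesgue_measurable_AE_eq[OF G' eq'] lebesgue_measurable_AE_eq[OF G', of "\<lambda>x. indicator {0..1} x *\<^sub>R G x"] eq'
    by (intro integral_cong_AE) (auto simp: AE_completion_iff)
  also have "\<dots> = (\<integral>x. indicator {0..1} x *\<^sub>R G x \<partial>lborel)"
    by (rule integral_completion[OF G'])
  finally show ?thesis by (simp add: set_lebesgue_integral_def)
qed

text \<open>Fubini's theorem and the substitution rules concern Borel functions, so that Lebesgue measurable
  functions are replaced by almost everywhere equal Borel functions under all integrals.\<close>

lemma borel_representative:
  fixes f :: "real \<Rightarrow> complex"
  assumes "f \<in> borel_measurable unit_leb"
  obtains f' where "f' \<in> borel_measurable borel" "AE x in lborel. x \<in> {0..1} \<longrightarrow> f x = f' x"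
proof -
  have "(\<lambda>x. indicator {0..1} x *\<^sub>R f x) \<in> borel_measurable lebesgue"
    using assms by (subst (asm) borel_measurable_restrict_space_iff) auto
  then have "(\<lambda>x. Re (indicator {0..1} x *\<^sub>R f x)) \<in> borel_measurable lebesgue"
    "(\<lambda>x. Im (indicator {0..1} x *\<^sub>R f x)) \<in> borel_measurable lebesgue"
    by measurable
  from this[THEN completion_ex_borel_measurable_real]
  obtain u v where u: "u \<in> borel_measurable lborel" "AE x in lborel. Re (indicator {0..1} x *\<^sub>R f x) = u x"
    and v: "v \<in> borel_measurable lborel" "AE x in lborel. Im (indicator {0..1} x *\<^sub>R f x) = v x"
    by (elim bexE)
  show ?thesis
  proof (rule that)
    show "(\<lambda>x. Complex (u x) (v x)) \<in> borel_measurable borel"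
      using u(1) v(1) by (simp add: Complex_eq)
    show "AE x in lborel. x \<in> {0..1} \<longrightarrow> f x = Complex (u x) (v x)"
      using u(2) v(2) by eventually_elim (auto simp: complex_eq_iff)
  qed
qed

section \<open>Integrals of periodic functions and Fourier modes\<close>

text \<open>The piece of the interval that the shift moves below \<open>0\<close> is brought back by one period.\<close>

lemma unit_integral_periodic_shift:
  fixes g :: "real \<Rightarrow> complex"
  assumes g[measurable]: "g \<in> borel_measurable borel" and per: "\<And>s. g (s + 1) = g s"
    and bound: "\<And>s. cmod (g s) \<le> B" and x: "x \<in> {0..1}"
  shows "unit_integral (\<lambda>y. g (y - x)) = unit_integral g"
proof -
  have int: "integrable lborel (\<lambda>s. indicator {a..<b} s *\<^sub>R g s)" for a b :: real
  proof (rule Bochner_Integration.integrable_bound)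
    have "integrable lborel (indicator {a..<b} :: real \<Rightarrow> real)"
      by (cases "a \<le> b") (simp_all add: integrable_indicator_iff)
    then show "integrable lborel (\<lambda>s. indicator {a..<b} s *\<^sub>R B)"
      by (intro integrable_scaleR_left)
    show "AE s in lborel. norm (indicator {a..<b} s *\<^sub>R g s) \<le> norm (indicator {a..<b} s *\<^sub>R B)"
      using bound by (intro AE_I2) (auto simp: indicator_def intro: order_trans[OF _ abs_ge_self])
  qed simp
  have half_open: "unit_integral F = (\<integral>s. indicator {0..<1} s *\<^sub>R F s \<partial>lborel)"
    if "F \<in> borel_measurable borel" for F :: "real \<Rightarrow> complex"
    unfolding set_lebesgue_integral_def
  proof (rule integral_cong_AE)
    show "AE s in lborel. indicator {0..1} s *\<^sub>R F s = indicator {0..<1} s *\<^sub>R F s"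
      using AE_not_endpoints[of 1] by eventually_elim (auto simp: indicator_def)
  qed (use that in simp_all)
  have "unit_integral (\<lambda>y. g (y - x)) = (\<integral>y. indicator {0..<1} y *\<^sub>R g (y - x) \<partial>lborel)"
    by (rule half_open) simp
  also have "\<dots> = (\<integral>s. indicator {0..<1} (x + 1 * s) *\<^sub>R g (x + 1 * s - x) \<partial>lborel)"
    by (subst lborel_integral_real_affine[where c = 1 and t = x]) simp_all
  also have "\<dots> = (\<integral>s. indicator {-x..<0} s *\<^sub>R g s + indicator {0..<1 - x} s *\<^sub>R g s \<partial>lborel)"
    using x by (intro Bochner_Integration.integral_cong refl) (auto simp: indicator_def)
  also have "\<dots> = (\<integral>s. indicator {-x..<0} s *\<^sub>R g s \<partial>lborel) + (\<integral>s. indicator {0..<1 - x} s *\<^sub>R g s \<partial>lborel)"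
    by (intro Bochner_Integration.integral_add int)
  also have "(\<integral>s. indicator {-x..<0} s *\<^sub>R g s \<partial>lborel)
      = (\<integral>s. indicator {-x..<0} (-1 + 1 * s) *\<^sub>R g (-1 + 1 * s) \<partial>lborel)"
    by (subst lborel_integral_real_affine[where c = 1 and t = "-1"]) simp_all
  also have "\<dots> = (\<integral>s. indicator {1 - x..<1} s *\<^sub>R g s \<partial>lborel)"
    using per[of "s - 1" for s] by (intro Bochner_Integration.integral_cong refl) (auto simp: indicator_def)
  also have "\<dots> + (\<integral>s. indicator {0..<1 - x} s *\<^sub>R g s \<partial>lborel)
      = (\<integral>s. indicator {1 - x..<1} s *\<^sub>R g s + indicator {0..<1 - x} s *\<^sub>R g s \<partial>lborel)"
    by (intro Bochner_Integration.integral_add[symmetric] int)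
  also have "\<dots> = (\<integral>s. indicator {0..<1} s *\<^sub>R g s \<partial>lborel)"
    using x by (intro Bochner_Integration.integral_cong refl) (auto simp: indicator_def)
  also have "\<dots> = unit_integral g"
    by (rule half_open[symmetric]) simp
  finally show ?thesis .
qed

lemma unit_integral_periodic_reflect:
  fixes g :: "real \<Rightarrow> complex"
  assumes g[measurable]: "g \<in> borel_measurable borel" and per: "\<And>s. g (s + 1) = g s"
    and bound: "\<And>s. cmod (g s) \<le> B" and y: "y \<in> {0..1}"
  shows "unit_integral (\<lambda>x. g (y - x)) = unit_integral g"
proof -
  have per': "g (- (s + 1)) = g (- s)" for s
    using per[of "- s - 1"] by simp
  have "unit_integral (\<lambda>x. g (- (x - y))) = unit_integral (\<lambda>s. g (- s))"
    using per' bound y by (intro unit_integral_periodic_shift[where g = "\<lambda>s. g (- s)"]) auto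
  also have "\<dots> = (\<integral>s. indicator {0..1} (1 + (-1) * s) *\<^sub>R g (- (1 + (-1) * s)) \<partial>lborel)"
    unfolding set_lebesgue_integral_def
    by (subst lborel_integral_real_affine[where c = "-1" and t = 1]) simp_all
  also have "\<dots> = unit_integral g"
    unfolding set_lebesgue_integral_def using per[of "s - 1" for s]
    by (intro Bochner_Integration.integral_cong refl) (auto simp: indicator_def)
  finally show ?thesis by simp
qed

definition fourier_mode :: "int \<Rightarrow> real \<Rightarrow> complex" where
  "fourier_mode k s = cis (2 * pi * k * s)"

lemma fourier_mode_measurable [measurable]: "fourier_mode k \<in> borel_measurable borel"
  unfolding fourier_mode_def[abs_def] by (intro borel_measurable_continuous_onI continuous_intros)

lemma norm_fourier_mode [simp]: "cmod (fourier_mode k s) = 1"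
  by (simp add: fourier_mode_def)

lemma fourier_mode_add: "fourier_mode k (s + t) = fourier_mode k s * fourier_mode k t"
  by (simp add: fourier_mode_def cis_mult algebra_simps)

lemma fourier_mode_mult: "fourier_mode k s * fourier_mode l s = fourier_mode (k + l) s"
  by (simp add: fourier_mode_def cis_mult algebra_simps)

lemma fourier_mode_0 [simp]: "fourier_mode 0 s = 1" "fourier_mode k 0 = 1"
  by (simp_all add: fourier_mode_def)

lemma fourier_mode_int: "fourier_mode k (of_int n) = 1"
proof -
  have "fourier_mode k (of_int n) = cis (2 * pi * of_int (k * n))"
    by (simp add: fourier_mode_def mult.assoc)
  then show ?thesis by (simp only: cis_multiple_2pi Ints_of_int)
qed

lemma fourier_mode_periodic: "fourier_mode k (s + 1) = fourier_mode k s"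
  using fourier_mode_int[of k 1] by (simp add: fourier_mode_add)

lemma fourier_mode_uminus: "fourier_mode (- k) s = fourier_mode k (- s)"
  by (simp add: fourier_mode_def)

text \<open>A translation multiplies a Fourier mode by a constant but preserves its integral.\<close>

lemma unit_integral_fourier_mode: "unit_integral (fourier_mode k) = (if k = 0 then 1 else 0)"
proof (cases "k = 0")
  case True
  have "unit_integral (\<lambda>_. 1 :: complex) = 1" by (simp add: set_lebesgue_integral_def)
  with True show ?thesis by (simp add: fourier_mode_0(1)[abs_def])
next
  case False
  \<comment> \<open>half a wavelength, which changes the sign of the mode\<close>
  define x where "x = 1 / (2 * \<bar>real_of_int k\<bar>)"
  have x: "x \<in> {0..1}" using False by (auto simp: x_def divide_le_eq)
  have "2 * pi * k * (- x) = - sgn (real_of_int k) * pi"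
    using False by (simp add: x_def sgn_if)
  then have "fourier_mode k (- x) = cis (- sgn (real_of_int k) * pi)"
    by (simp only: fourier_mode_def)
  also have "\<dots> = -1"
    using False by (cases "0 < k") (auto simp: complex_eq_iff sgn_if)
  finally have neg: "fourier_mode k (- x) = -1" .
  have "unit_integral (fourier_mode k) = unit_integral (\<lambda>y. fourier_mode k (y - x))"
    using x by (intro unit_integral_periodic_shift[where B = 1, symmetric]) (auto simp: fourier_mode_periodic)
  also have "\<dots> = unit_integral (\<lambda>y. - fourier_mode k y)"
    using neg fourier_mode_add[of k _ "- x"] by simp
  also have "\<dots> = - unit_integral (fourier_mode k)"
    by (simp add: set_lebesgue_integral_def)
  finally show ?thesis using False by simp
qed

section \<open>Uniqueness of Fourier coefficients\<close>

lemma set_integrable_bounded_mult: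
  fixes g :: "real \<Rightarrow> complex"
  assumes g: "set_integrable lborel A g" and h: "h \<in> borel_measurable borel" and A: "A \<in> sets borel"
    and bound: "\<And>s. cmod (h s) \<le> B"
  shows "set_integrable lborel A (\<lambda>s. g s * h s)"
proof -
  have "integrable lborel (\<lambda>s. (indicator A s *\<^sub>R g s) * h s)"
  proof (rule Bochner_Integration.integrable_bound)
    show "integrable lborel (\<lambda>s. B * cmod (indicator A s *\<^sub>R g s))"
      using g by (intro integrable_mult_right integrable_norm) (simp add: set_integrable_def)
    show "(\<lambda>s. (indicator A s *\<^sub>R g s) * h s) \<in> borel_measurable lborel"
      using g h by (intro borel_measurable_times) (auto simp: set_integrable_def dest: borel_measurable_integrable)
    have bound': "cmod (z * h s) \<le> \<bar>B * cmod z\<bar>" for z s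
    proof -
      have "cmod z * cmod (h s) \<le> cmod z * B" by (intro mult_left_mono bound) simp
      then show ?thesis by (simp add: norm_mult mult.commute)
    qed
    show "AE s in lborel. norm ((indicator A s *\<^sub>R g s) * h s) \<le> norm (B * cmod (indicator A s *\<^sub>R g s))"
      unfolding real_norm_def by (intro AE_I2 bound')
  qed
  then show ?thesis by (simp add: set_integrable_def)
qed

text \<open>All Fourier coefficients of the product \<open>g h\<close> vanish. Quantifying over all \<open>k\<close> makes this stable under
  multiplication of \<open>h\<close> by a mode.\<close>

definition trig_orthogonal :: "(real \<Rightarrow> complex) \<Rightarrow> (real \<Rightarrow> complex) \<Rightarrow> bool" where
  "trig_orthogonal g h \<longleftrightarrow> h \<in> borel_measurable borel \<and> (\<exists>B. \<forall>x. cmod (h x) \<le> B) \<and>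
     (\<forall>k. unit_integral (\<lambda>x. g x * (h x * fourier_mode k x)) = 0)"

lemma trig_orthogonal_integrable:
  assumes g: "set_integrable lborel {0..1} g" and h: "trig_orthogonal g h"
  shows "set_integrable lborel {0..1} (\<lambda>x. g x * (h x * fourier_mode k x))"
proof -
  obtain B where B: "\<And>x. cmod (h x) \<le> B" using h by (auto simp: trig_orthogonal_def)
  show ?thesis
    using h by (intro set_integrable_bounded_mult[OF g, where B = B])
      (auto simp: trig_orthogonal_def norm_mult B)
qed

lemma trig_orthogonal_add:
  assumes g: "set_integrable lborel {0..1} g" and h: "trig_orthogonal g h" "trig_orthogonal g h'"
  shows "trig_orthogonal g (\<lambda>x. h x + h' x)"
proof -
  obtain B B' where "\<And>x. cmod (h x) \<le> B" "\<And>x. cmod (h' x) \<le> B'"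
    using h by (auto simp: trig_orthogonal_def)
  then have "cmod (h x + h' x) \<le> B + B'" for x
    by (meson add_mono norm_triangle_le)
  moreover have "unit_integral (\<lambda>x. g x * ((h x + h' x) * fourier_mode k x)) = 0" for k
    using set_integral_add(2)[OF trig_orthogonal_integrable[OF g h(1)] trig_orthogonal_integrable[OF g h(2)], of k k] h
    by (simp add: trig_orthogonal_def distrib_left distrib_right)
  ultimately show ?thesis using h unfolding trig_orthogonal_def by auto
qed

lemma trig_orthogonal_mult_mode:
  assumes h: "trig_orthogonal g h"
  shows "trig_orthogonal g (\<lambda>x. h x * (c * fourier_mode j x))"
proof -
  obtain B where "\<And>x. cmod (h x) \<le> B" using h by (auto simp: trig_orthogonal_def)
  then have "cmod (h x * (c * fourier_mode j x)) \<le> B * cmod c" for x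
    by (simp add: norm_mult mult_right_mono)
  moreover have "unit_integral (\<lambda>x. g x * (h x * (c * fourier_mode j x) * fourier_mode k x)) = 0" for k
  proof -
    have "(\<lambda>x. g x * (h x * (c * fourier_mode j x) * fourier_mode k x))
        = (\<lambda>x. c * (g x * (h x * fourier_mode (j + k) x)))"
      by (simp add: fun_eq_iff flip: fourier_mode_mult)
    then show ?thesis using h by (simp add: trig_orthogonal_def)
  qed
  moreover have "(\<lambda>x. h x * (c * fourier_mode j x)) \<in> borel_measurable borel"
    using h by (intro borel_measurable_times) (auto simp: trig_orthogonal_def)
  ultimately show ?thesis unfolding trig_orthogonal_def by blast
qed

text \<open>Polynomials in \<open>cos\<close> and \<open>sin\<close> are handled one factor at a time: the orthogonality to all
  modes survives multiplication by a polynomial on the circle.\<close>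

lemma trig_orthogonal_polynomial:
  fixes p :: "complex \<Rightarrow> real"
  assumes g: "set_integrable lborel {0..1} g" and p: "real_polynomial_function p" and h: "trig_orthogonal g h"
  shows "trig_orthogonal g (\<lambda>x. h x * of_real (p (fourier_mode 1 x)))"
  using p h
proof (induction p arbitrary: h rule: real_polynomial_function.induct)
  case (linear p)
  \<comment> \<open>\<open>cos\<close> and \<open>sin\<close> as combinations of the modes \<open>1\<close> and \<open>-1\<close>\<close>
  define \<alpha> where "\<alpha> = (of_real (p 1) - \<i> * of_real (p \<i>)) / 2"
  define \<beta> where "\<beta> = (of_real (p 1) + \<i> * of_real (p \<i>)) / 2"
  have p: "of_real (p (fourier_mode 1 x)) = \<alpha> * fourier_mode 1 x + \<beta> * fourier_mode (-1) x" for x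
  proof -
    interpret bounded_linear p by (rule linear.hyps)
    define c where "c = cos (2 * pi * x)"
    define s where "s = sin (2 * pi * x)"
    have m: "fourier_mode 1 x = Complex c s" "fourier_mode (-1) x = Complex c (- s)"
      by (simp_all add: fourier_mode_def c_def s_def complex_eq_iff)
    have "Complex c s = c *\<^sub>R 1 + s *\<^sub>R \<i>" by (simp add: complex_eq_iff)
    then have "p (fourier_mode 1 x) = c * p 1 + s * p \<i>" by (simp add: m add scaleR)
    then show ?thesis
      unfolding m by (auto simp: \<alpha>_def \<beta>_def complex_eq_iff field_simps)
  qed
  show ?case
    unfolding p distrib_left
    by (intro trig_orthogonal_add[OF g] trig_orthogonal_mult_mode linear.prems)
next
  case (const c)
  then show ?case using trig_orthogonal_mult_mode[of g h "of_real c" 0] by simp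
next
  case (add p q)
  then show ?case unfolding of_real_add distrib_left by (intro trig_orthogonal_add[OF g])
next
  case (mult p q)
  have "trig_orthogonal g (\<lambda>x. h x * of_real (p (fourier_mode 1 x)) * of_real (q (fourier_mode 1 x)))"
    by (intro mult.IH(2) mult.IH(1) mult.prems)
  then show ?case by (simp add: mult.assoc)
qed

text \<open>By the Stone-Weierstrass theorem a continuous function on the circle is a uniform limit of polynomials
  in the coordinates, and these have integral zero against \<open>g\<close>.\<close>

lemma continuous_orthogonal:
  fixes \<phi> :: "complex \<Rightarrow> real"
  assumes g: "set_integrable lborel {0..1} g" and zero: "\<And>k. unit_integral (\<lambda>x. g x * fourier_mode k x) = 0"
    and \<phi>: "continuous_on UNIV \<phi>"
  shows "unit_integral (\<lambda>x. g x * of_real (\<phi> (fourier_mode 1 x))) = 0"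
proof -
  have sphere: "fourier_mode 1 x \<in> sphere 0 1" for x by simp
  have compact: "compact (sphere 0 1 :: complex set)" by simp
  have \<phi>_meas: "(\<lambda>x. of_real (\<phi> (fourier_mode 1 x)) :: complex) \<in> borel_measurable borel"
  proof -
    have "\<phi> \<in> borel_measurable borel" using \<phi> by (rule borel_measurable_continuous_onI)
    then show ?thesis by measurable
  qed
  have "bounded (\<phi> ` sphere 0 1)"
    using compact_imp_bounded[OF compact_continuous_image[OF continuous_on_subset[OF \<phi>] compact]] by simp
  then have "\<exists>B. \<forall>z\<in>sphere 0 1. norm (\<phi> z) \<le> B"
    by (simp add: bounded_iff)
  then obtain B where B: "\<And>z. z \<in> sphere 0 1 \<Longrightarrow> norm (\<phi> z) \<le> B" by blast
  have g\<phi>: "set_integrable lborel {0..1} (\<lambda>x. g x * of_real (\<phi> (fourier_mode 1 x)))"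
    using B by (intro set_integrable_bounded_mult[OF g \<phi>_meas, where B = B]) auto
  have bound: "cmod (unit_integral (\<lambda>x. g x * of_real (\<phi> (fourier_mode 1 x)))) \<le> e * unit_integral (\<lambda>x. cmod (g x))"
    if "0 < e" for e
  proof -
    obtain p where p: "real_polynomial_function p" "\<And>z. z \<in> sphere 0 1 \<Longrightarrow> \<bar>\<phi> z - p z\<bar> < e"
      using Stone_Weierstrass_real_polynomial_function[OF compact continuous_on_subset[OF \<phi> subset_UNIV] \<open>0 < e\<close>] by blast
    have "trig_orthogonal g (\<lambda>_. 1)"
      using zero by (auto simp: trig_orthogonal_def intro!: exI[of _ 1])
    from trig_orthogonal_polynomial[OF g p(1) this]
    have tp: "trig_orthogonal g (\<lambda>x. of_real (p (fourier_mode 1 x)))" by simp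
    then have "unit_integral (\<lambda>x. g x * (of_real (p (fourier_mode 1 x)) * fourier_mode 0 x)) = 0"
      unfolding trig_orthogonal_def by blast
    then have p0: "unit_integral (\<lambda>x. g x * of_real (p (fourier_mode 1 x))) = 0" by simp
    have gp: "set_integrable lborel {0..1} (\<lambda>x. g x * of_real (p (fourier_mode 1 x)))"
      using trig_orthogonal_integrable[OF g tp, of 0] by simp
    have "unit_integral (\<lambda>x. g x * of_real (\<phi> (fourier_mode 1 x)))
        = unit_integral (\<lambda>x. g x * of_real (\<phi> (fourier_mode 1 x)) - g x * of_real (p (fourier_mode 1 x)))"
      using p0 by (subst set_integral_diff(2)[OF g\<phi> gp]) simp
    also have "cmod \<dots> \<le> unit_integral (\<lambda>x. e * cmod (g x))"
      unfolding set_lebesgue_integral_def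
    proof (rule Bochner_Integration.integral_norm_bound_integral)
      show "integrable lborel (\<lambda>x. indicator {0..1} x *\<^sub>R (g x * of_real (\<phi> (fourier_mode 1 x)) - g x * of_real (p (fourier_mode 1 x))))"
        using set_integral_diff(1)[OF g\<phi> gp] by (simp add: set_integrable_def)
      show "integrable lborel (\<lambda>x. indicator {0..1} x *\<^sub>R (e * cmod (g x)))"
        using set_integrable_mult_right[OF set_integrable_norm[OF g], of e] by (simp add: set_integrable_def)
      fix x
      have "cmod (g x * of_real (\<phi> (fourier_mode 1 x)) - g x * of_real (p (fourier_mode 1 x)))
          = cmod (g x) * \<bar>\<phi> (fourier_mode 1 x) - p (fourier_mode 1 x)\<bar>"
        by (simp add: norm_mult flip: right_diff_distrib of_real_diff)
      also have "\<dots> \<le> cmod (g x) * e"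
        using p(2)[OF sphere, of x] by (intro mult_left_mono) auto
      finally show "norm (indicator {0..1} x *\<^sub>R (g x * of_real (\<phi> (fourier_mode 1 x)) - g x * of_real (p (fourier_mode 1 x))))
          \<le> indicator {0..1} x *\<^sub>R (e * cmod (g x))"
        by (simp add: indicator_def mult.commute)
    qed
    finally show ?thesis by simp
  qed
  define G where "G = unit_integral (\<lambda>x. cmod (g x))"
  have "0 \<le> G" unfolding G_def set_lebesgue_integral_def by (intro integral_nonneg_AE) (simp add: indicator_def)
  have "cmod (unit_integral (\<lambda>x. g x * of_real (\<phi> (fourier_mode 1 x)))) \<le> 0 + e" if "0 < e" for e
  proof -
    have "e / (G + 1) * G \<le> e"
      using that \<open>0 \<le> G\<close> by (simp add: field_simps)
    then show ?thesis
      using bound[of "e / (G + 1)"] that \<open>0 \<le> G\<close> by (simp add: G_def)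
  qed
  then have "cmod (unit_integral (\<lambda>x. g x * of_real (\<phi> (fourier_mode 1 x)))) \<le> 0"
    by (rule field_le_epsilon)
  then show ?thesis by simp
qed

lemma fourier_mode_inj: "inj_on (fourier_mode 1) {0<..<1}"
proof (rule inj_onI)
  fix x y :: real assume xy: "x \<in> {0<..<1}" "y \<in> {0<..<1}" "fourier_mode 1 x = fourier_mode 1 y"
  then have "cis (2 * pi * x) = cis (2 * pi * y)" by (simp add: fourier_mode_def)
  then have "sin (2 * pi * x) = sin (2 * pi * y) \<and> cos (2 * pi * x) = cos (2 * pi * y)"
    by (simp add: complex_eq_iff)
  then obtain n :: int where "2 * pi * x = 2 * pi * y + 2 * pi * n"
    using sin_cos_eq_iff by blast
  then have "2 * pi * (x - y - n) = 0" by (simp add: algebra_simps)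
  then have "x - y = n" by simp
  then have "\<bar>real_of_int n\<bar> < 1" using xy by auto
  then have "n = 0" by linarith
  with \<open>x - y = n\<close> show "x = y" by simp
qed

text \<open>The indicator function of a closed set is a pointwise limit of continuous functions of the distance to
  it. The distance is taken on the circle, where the continuous functions live; inside the open interval
  the passage to the circle is injective.\<close>

lemma closed_set_orthogonal:
  fixes C :: "real set"
  assumes g: "set_integrable lborel {0..1} g" and zero: "\<And>k. unit_integral (\<lambda>x. g x * fourier_mode k x) = 0"
    and C: "closed C" "C \<subseteq> {0<..<1}"
  shows "(LINT x:C|lborel. g x) = 0"
proof (cases "C = {}")
  case True
  then show ?thesis by (simp add: set_lebesgue_integral_def)
next
  case False
  have "C \<subseteq> {0..1}" using C(2) by force
  then have "bounded C" by (rule bounded_subset[OF bounded_closed_interval])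
  then have "compact C" using C(1) by (simp add: compact_eq_bounded_closed)
  define F where "F = fourier_mode 1 ` C"
  have "compact F"
    unfolding F_def using \<open>compact C\<close>
    by (intro compact_continuous_image) (auto simp: fourier_mode_def[abs_def] intro!: continuous_intros)
  then have F: "closed F" "F \<noteq> {}" using False by (auto simp: F_def compact_imp_closed)
  define \<phi> where "\<phi> n z = max 0 (1 - real n * infdist z F)" for n and z :: complex
  have cont: "continuous_on UNIV (\<phi> n)" for n
    unfolding \<phi>_def[abs_def] by (intro continuous_intros)
  have \<phi>_range: "0 \<le> \<phi> n z" "\<phi> n z \<le> 1" for n z
    by (auto simp: \<phi>_def infdist_nonneg)
  have lim: "(\<lambda>n. \<phi> n z) \<longlonglongrightarrow> indicator F z" for z
  proof (cases "z \<in> F")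
    case True
    then show ?thesis by (simp add: \<phi>_def)
  next
    case False
    then have pos: "0 < infdist z F"
      using F in_closed_iff_infdist_zero[of F z] infdist_nonneg[of z F] by (simp add: less_le)
    have "\<forall>\<^sub>F n in sequentially. \<phi> n z = 0"
      using eventually_gt_at_top[of "nat \<lceil>1 / infdist z F\<rceil>"]
    proof eventually_elim
      case (elim n)
      then have "1 / infdist z F \<le> real n" by linarith
      then show ?case using pos by (simp add: \<phi>_def field_simps)
    qed
    with False show ?thesis by (simp add: tendsto_eventually)
  qed
  have C_meas: "C \<in> sets borel" using C(1) by simp
  have "(\<lambda>n. \<integral>x. indicator {0..1} x *\<^sub>R (g x * of_real (\<phi> n (fourier_mode 1 x))) \<partial>lborel)
      \<longlonglongrightarrow> (\<integral>x. indicator C x *\<^sub>R g x \<partial>lborel)"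
  proof (rule integral_dominated_convergence[where w = "\<lambda>x. cmod (indicator {0..1} x *\<^sub>R g x)"])
    have "set_integrable lborel C g"
      using g by (rule set_integrable_subset) (use C C_meas in auto)
    then show "(\<lambda>x. indicator C x *\<^sub>R g x) \<in> borel_measurable lborel"
      unfolding set_integrable_def by (rule borel_measurable_integrable)
    show "(\<lambda>x. indicator {0..1} x *\<^sub>R (g x * of_real (\<phi> n (fourier_mode 1 x)))) \<in> borel_measurable lborel" for n
    proof -
      have "\<phi> n \<in> borel_measurable borel" using cont by (rule borel_measurable_continuous_onI)
      then have "(\<lambda>x. of_real (\<phi> n (fourier_mode 1 x)) :: complex) \<in> borel_measurable borel" by measurable
      then have "set_integrable lborel {0..1} (\<lambda>x. g x * of_real (\<phi> n (fourier_mode 1 x)))"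
        using \<phi>_range by (intro set_integrable_bounded_mult[OF g, where B = 1]) auto
      then show ?thesis unfolding set_integrable_def by (rule borel_measurable_integrable)
    qed
    show "integrable lborel (\<lambda>x. cmod (indicator {0..1} x *\<^sub>R g x))"
      using g unfolding set_integrable_def by (rule integrable_norm)
    show "AE x in lborel. norm (indicator {0..1} x *\<^sub>R (g x * of_real (\<phi> n (fourier_mode 1 x)))) \<le> cmod (indicator {0..1} x *\<^sub>R g x)" for n
      using \<phi>_range[of n] by (intro AE_I2) (auto simp: indicator_def norm_mult intro!: mult_left_le)
    show "AE x in lborel. (\<lambda>n. indicator {0..1} x *\<^sub>R (g x * of_real (\<phi> n (fourier_mode 1 x)))) \<longlonglongrightarrow> indicator C x *\<^sub>R g x"
      using AE_not_endpoints[of 0] AE_not_endpoints[of 1]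
    proof eventually_elim
      case (elim x)
      show ?case
      proof (cases "x \<in> {0<..<1}")
        case True
        have "fourier_mode 1 x \<in> F \<longleftrightarrow> x \<in> C"
          unfolding F_def by (rule inj_on_image_mem_iff[OF fourier_mode_inj True C(2)])
        then have "indicator F (fourier_mode 1 x) = (indicator C x :: real)" by (simp add: indicator_def)
        then have "(\<lambda>n. g x * of_real (\<phi> n (fourier_mode 1 x))) \<longlonglongrightarrow> g x * of_real (indicator C x)"
          using lim[of "fourier_mode 1 x"] by (intro tendsto_intros) simp
        then show ?thesis using True by (simp add: scaleR_conv_of_real mult.commute)
      next
        case False
        with elim C(2) have "x \<notin> {0..1}" "x \<notin> C" by auto
        then show ?thesis by simp
      qed
    qed
  qed
  moreover have "(\<integral>x. indicator {0..1} x *\<^sub>R (g x * of_real (\<phi> n (fourier_mode 1 x))) \<partial>lborel) = 0" for n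
    using continuous_orthogonal[OF g zero cont] by (simp add: set_lebesgue_integral_def)
  ultimately have "(\<lambda>n. 0) \<longlonglongrightarrow> (\<integral>x. indicator C x *\<^sub>R g x \<partial>lborel)" by simp
  then show ?thesis
    using LIMSEQ_unique[OF tendsto_const] by (fastforce simp: set_lebesgue_integral_def)
qed

text \<open>Closed sets approximate \<open>{x. 0 < u x}\<close> from inside, and a positive function with integral zero over a
  set forces that set to be null.\<close>

lemma AE_nonpos_of_closed_integrals:
  fixes u :: "real \<Rightarrow> real"
  assumes [measurable]: "u \<in> borel_measurable borel" and u: "set_integrable lborel {0..1} u"
    and zero: "\<And>C. closed C \<Longrightarrow> C \<subseteq> {0<..<1} \<Longrightarrow> (LINT x:C|lborel. u x) = 0"
  shows "AE x in lborel. x \<in> {0<..<1} \<longrightarrow> u x \<le> 0"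
proof -
  define P where "P = {x. x \<in> {0<..<1} \<and> 0 < u x}"
  have P: "P \<in> sets borel" unfolding P_def by measurable
  have small: "emeasure lborel P < ennreal e" if "0 < e" for e
  proof -
    have "P \<in> sets lebesgue" using P by simp
    then obtain T where T: "closed T" "T \<subseteq> P" "P - T \<in> lmeasurable" "emeasure lebesgue (P - T) < ennreal e"
      by (rule sets_lebesgue_inner_closed[OF _ \<open>0 < e\<close>])
    have T_meas: "T \<in> sets borel" using T(1) by simp
    have T01: "T \<subseteq> {0<..<1}" using T(2) by (auto simp: P_def)
    have int: "integrable lborel (\<lambda>x. indicator T x *\<^sub>R u x)"
      using set_integrable_subset[OF u, of T] T01 T_meas by (force simp: set_integrable_def)
    have "(\<integral>x. indicator T x *\<^sub>R u x \<partial>lborel) = 0"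
      using zero[OF T(1) T01] by (simp add: set_lebesgue_integral_def)
    then have "AE x in lborel. indicator T x *\<^sub>R u x = 0"
      using int T(2) by (subst (asm) integral_nonneg_eq_0_iff_AE) (auto simp: P_def indicator_def intro!: AE_I2)
    then have "AE x in lborel. x \<notin> T"
      by eventually_elim (use T(2) in \<open>auto simp: P_def indicator_def split: if_splits\<close>)
    then have "T \<in> null_sets lborel" using T_meas by (subst AE_iff_null_sets) auto
    then have "emeasure lborel P = emeasure lborel (P - T)"
      using P by (intro emeasure_Diff_null_set[symmetric]) auto
    also have "\<dots> = emeasure lebesgue (P - T)" using P T_meas by simp
    finally show ?thesis using T(4) by simp
  qed
  have "emeasure lborel P = 0"
  proof (rule ccontr)
    assume "emeasure lborel P \<noteq> 0"
    then have "0 < emeasure lborel P" by (simp add: zero_less_iff_neq_zero)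
    moreover have "emeasure lborel P < \<top>" using small[of 1] by (simp add: less_top order_less_trans)
    ultimately obtain e where "0 < e" "emeasure lborel P = ennreal e"
      by (cases "emeasure lborel P") (auto simp: ennreal_less_zero_iff)
    then show False using small[of e] by simp
  qed
  then have "P \<in> null_sets lborel" using P by auto
  then have "AE x in lborel. x \<notin> P" by (rule AE_not_in)
  then show ?thesis by eventually_elim (auto simp: P_def)
qed

text \<open>The real and the imaginary part, each with both signs, are nonpositive.\<close>

lemma fourier_uniqueness:
  assumes [measurable]: "g \<in> borel_measurable borel" and g: "set_integrable lborel {0..1} g"
    and zero: "\<And>k. unit_integral (\<lambda>x. g x * fourier_mode k x) = 0"
  shows "AE x in lborel. x \<in> {0..1} \<longrightarrow> g x = 0"
proof -
  have part: "AE x in lborel. x \<in> {0<..<1} \<longrightarrow> f (g x) \<le> 0" if f: "bounded_linear f" for f :: "complex \<Rightarrow> real"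
  proof (rule AE_nonpos_of_closed_integrals)
    have "f \<in> borel_measurable borel"
      using f by (intro borel_measurable_continuous_onI linear_continuous_on)
    then show "(\<lambda>x. f (g x)) \<in> borel_measurable borel" by measurable
    have scale: "f (indicator A x *\<^sub>R g x) = indicator A x *\<^sub>R f (g x)" for A :: "real set" and x
      using linear_scale[OF bounded_linear.linear[OF f]] by simp
    show "set_integrable lborel {0..1} (\<lambda>x. f (g x))"
      using integrable_bounded_linear[OF f g[unfolded set_integrable_def]] by (simp add: set_integrable_def scale)
    fix C :: "real set" assume C: "closed C" "C \<subseteq> {0<..<1}"
    have "set_integrable lborel C g"
      using g by (rule set_integrable_subset) (use C in auto)
    then have "f (LINT x:C|lborel. g x) = (LINT x:C|lborel. f (g x))"
      unfolding set_lebesgue_integral_def set_integrable_def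
      by (subst integral_bounded_linear[OF f, symmetric]) (simp_all add: scale)
    then show "(LINT x:C|lborel. f (g x)) = 0"
      using closed_set_orthogonal[OF g zero C] linear_0[OF bounded_linear.linear[OF f]] by simp
  qed
  have "AE x in lborel. x \<in> {0<..<1} \<longrightarrow> Re (g x) \<le> 0" "AE x in lborel. x \<in> {0<..<1} \<longrightarrow> - Re (g x) \<le> 0"
    "AE x in lborel. x \<in> {0<..<1} \<longrightarrow> Im (g x) \<le> 0" "AE x in lborel. x \<in> {0<..<1} \<longrightarrow> - Im (g x) \<le> 0"
    by (rule part, intro bounded_linear_Re bounded_linear_Im bounded_linear_minus)+
  then show ?thesis
    using AE_not_endpoints[of 0] AE_not_endpoints[of 1]
  proof eventually_elim
    case (elim x)
    show ?case
    proof
      assume "x \<in> {0..1}"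
      with elim have "x \<in> {0<..<1}" by auto
      with elim show "g x = 0" by (auto simp: complex_eq_iff)
    qed
  qed
qed

section \<open>Eigenfunctions of the graphon Laplacian\<close>

text \<open>The sampled matrices see the values of \<open>R\<close>, whereas integrals are taken of its periodic Borel version
  \<open>\<rho>\<close>. They agree at almost every point of the interval, and \<open>R\<close> is continuous there.\<close>

locale ring_kernel =
  fixes W :: "real \<Rightarrow> real \<Rightarrow> real" and R \<rho> :: "real \<Rightarrow> real"
  assumes W: "\<And>x y. x \<in> {0..1} \<Longrightarrow> y \<in> {0..1} \<Longrightarrow> W x y = R \<bar>x - y\<bar>"
    and R_range: "\<And>s. s \<in> {0..1} \<Longrightarrow> R s \<in> {0..1}"
    and R_sym: "\<And>s. s \<in> {0..1} \<Longrightarrow> R s = R (1 - s)"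
    and \<rho>_measurable [measurable]: "\<rho> \<in> borel_measurable borel"
    and \<rho>_range: "\<And>s. \<rho> s \<in> {0..1}"
    and \<rho>_periodic: "\<And>s. \<rho> (s + 1) = \<rho> s"
    and \<rho>_R: "AE s in lborel. s \<in> {0<..<1} \<longrightarrow> isCont R s \<and> \<rho> s = R s"
begin

text \<open>For \<open>y < x\<close> the symmetry \<open>R s = R (1 - s)\<close> turns the distance \<open>x - y\<close> into \<open>y - x + 1\<close>, which periodicity
  identifies with \<open>y - x\<close>.\<close>

lemma kernel_AE:
  assumes x: "x \<in> {0..1}"
  shows "AE y in lborel. y \<in> {0..1} \<longrightarrow> W x y = \<rho> (y - x)"
proof -
  have shift: "AE y in lborel. y - a \<in> {0<..<1} \<longrightarrow> \<rho> (y - a) = R (y - a)" for a :: real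
  proof -
    have "AE y in lborel. - a + 1 * y \<in> {0<..<1} \<longrightarrow> isCont R (- a + 1 * y) \<and> \<rho> (- a + 1 * y) = R (- a + 1 * y)"
      using \<rho>_R by (rule AE_lborel_affine) simp
    then show ?thesis by eventually_elim simp
  qed
  show ?thesis
    using shift[of x] shift[of "x - 1"] AE_not_endpoints[of x] AE_not_endpoints[of 0] AE_not_endpoints[of 1]
  proof eventually_elim
    case (elim y)
    show ?case
    proof
      assume y: "y \<in> {0..1}"
      show "W x y = \<rho> (y - x)"
      proof (cases "x < y")
        case True
        then have "y - x \<in> {0<..<1}" using x y elim by auto
        moreover have "W x y = R (y - x)" using W[OF x y] True by simp
        ultimately show ?thesis using elim(1) by simp
      next
        case False
        then have "y < x" using elim by simp
        then have yx: "y - (x - 1) \<in> {0<..<1}" using x y elim by auto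
        have "W x y = R (x - y)" using W[OF x y] \<open>y < x\<close> by simp
        also have "\<dots> = R (y - (x - 1))" using R_sym[of "x - y"] x y \<open>y < x\<close> by (simp add: algebra_simps)
        also have "\<dots> = \<rho> (y - (x - 1))" using elim(2) yx by simp
        also have "\<dots> = \<rho> (y - x)" using \<rho>_periodic[of "y - x"] by (simp add: algebra_simps)
        finally show ?thesis .
      qed
    qed
  qed
qed

definition mode_coeff :: "int \<Rightarrow> complex" where
  "mode_coeff k = unit_integral (\<lambda>s. of_real (\<rho> s) * fourier_mode k s)"

abbreviation mode_eigenvalue :: "int \<Rightarrow> complex" where
  "mode_eigenvalue k \<equiv> mode_coeff k - mode_coeff 0"

lemma norm_\<rho>_mode: "cmod (of_real (\<rho> s) * fourier_mode k t) \<le> 1"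
  using \<rho>_range[of s] by (simp add: norm_mult)

text \<open>Writing \<open>y = x + (y - x)\<close> splits the mode into a constant factor and a periodic function of \<open>y - x\<close>.\<close>

lemma mode_convolution:
  assumes x: "x \<in> {0..1}"
  shows "unit_integral (\<lambda>y. of_real (\<rho> (y - x)) * fourier_mode k y) = mode_coeff k * fourier_mode k x"
proof -
  have "unit_integral (\<lambda>y. of_real (\<rho> (y - x)) * fourier_mode k y)
      = unit_integral (\<lambda>y. fourier_mode k x * (of_real (\<rho> (y - x)) * fourier_mode k (y - x)))"
  proof -
    have "of_real (\<rho> (y - x)) * fourier_mode k y = fourier_mode k x * (of_real (\<rho> (y - x)) * fourier_mode k (y - x))" for y
      using fourier_mode_add[of k x "y - x"] by simp
    then show ?thesis by (intro arg_cong[where f = unit_integral] ext)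
  qed
  also have "\<dots> = fourier_mode k x * unit_integral (\<lambda>y. of_real (\<rho> (y - x)) * fourier_mode k (y - x))"
    by (rule set_integral_mult_right)
  also have "unit_integral (\<lambda>y. of_real (\<rho> (y - x)) * fourier_mode k (y - x)) = mode_coeff k"
    unfolding mode_coeff_def using x norm_\<rho>_mode
    by (intro unit_integral_periodic_shift[where g = "\<lambda>s. of_real (\<rho> s) * fourier_mode k s"])
      (auto simp: \<rho>_periodic fourier_mode_periodic)
  finally show ?thesis by (simp add: mult.commute)
qed

text \<open>The same for integration over the other variable, which reflects the kernel; this is the form that the
  adjoint of the convolution takes on modes.\<close>

lemma mode_convolution':
  assumes y: "y \<in> {0..1}"
  shows "unit_integral (\<lambda>x. of_real (\<rho> (y - x)) * fourier_mode (- k) x) = mode_coeff k * fourier_mode (- k) y"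
proof -
  have "of_real (\<rho> (y - x)) * fourier_mode (- k) x = fourier_mode (- k) y * (of_real (\<rho> (y - x)) * fourier_mode k (y - x))" for x
    using fourier_mode_add[of "- k" y "x - y"] fourier_mode_uminus[of k "x - y"] by simp
  then have "unit_integral (\<lambda>x. of_real (\<rho> (y - x)) * fourier_mode (- k) x)
      = unit_integral (\<lambda>x. fourier_mode (- k) y * (of_real (\<rho> (y - x)) * fourier_mode k (y - x)))"
    by (intro arg_cong[where f = unit_integral] ext)
  also have "\<dots> = fourier_mode (- k) y * unit_integral (\<lambda>x. of_real (\<rho> (y - x)) * fourier_mode k (y - x))"
    by (rule set_integral_mult_right)
  also have "unit_integral (\<lambda>x. of_real (\<rho> (y - x)) * fourier_mode k (y - x)) = mode_coeff k"
    unfolding mode_coeff_def using y norm_\<rho>_mode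
    by (intro unit_integral_periodic_reflect[where g = "\<lambda>s. of_real (\<rho> s) * fourier_mode k s"])
      (auto simp: \<rho>_periodic fourier_mode_periodic)
  finally show ?thesis by (simp add: mult.commute)
qed

text \<open>On functions with a Borel representative the Laplacian is a convolution minus the constant
  degree \<open>mode_coeff 0\<close>.\<close>

lemma laplacian_convolution:
  assumes f'[measurable]: "f' \<in> borel_measurable borel" and int: "set_integrable lborel {0..1} f'"
    and eq: "AE y in lborel. y \<in> {0..1} \<longrightarrow> f y = f' y" and x: "x \<in> {0..1}"
  shows "graphon_laplacian W f x = unit_integral (\<lambda>y. of_real (\<rho> (y - x)) * f' y) - mode_coeff 0 * f x"
proof -
  have "graphon_laplacian W f x = unit_integral (\<lambda>y. of_real (\<rho> (y - x)) * (f' y - f x))"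
    unfolding graphon_laplacian_def
  proof (rule integral_unit_leb)
    show "AE y in lborel. y \<in> {0..1} \<longrightarrow> of_real (W x y) * (f y - f x) = of_real (\<rho> (y - x)) * (f' y - f x)"
      using kernel_AE[OF x] eq by eventually_elim simp
  qed simp
  also have "\<dots> = unit_integral (\<lambda>y. f' y * of_real (\<rho> (y - x)) - f x * (of_real (\<rho> (y - x)) * fourier_mode 0 y))"
    by (simp add: algebra_simps)
  also have "\<dots> = unit_integral (\<lambda>y. f' y * of_real (\<rho> (y - x))) - unit_integral (\<lambda>y. f x * (of_real (\<rho> (y - x)) * fourier_mode 0 y))"
  proof (rule set_integral_diff(2))
    show "set_integrable lborel {0..1} (\<lambda>y. f' y * of_real (\<rho> (y - x)))"
      using \<rho>_range by (intro set_integrable_bounded_mult[OF int, where B = 1]) auto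
    show "set_integrable lborel {0..1} (\<lambda>y. f x * (of_real (\<rho> (y - x)) * fourier_mode 0 y))"
      by (rule bounded_set_integrable[where B = "cmod (f x)"]) (use \<rho>_range norm_\<rho>_mode in \<open>auto simp: norm_mult intro!: mult_left_le\<close>)
  qed
  also have "unit_integral (\<lambda>y. f x * (of_real (\<rho> (y - x)) * fourier_mode 0 y)) = f x * mode_coeff 0"
    using mode_convolution[OF x, of 0] by (subst set_integral_mult_right) simp
  finally show ?thesis by (simp add: mult.commute)
qed

lemma mode_integrable: "set_integrable lborel {0..1} (fourier_mode k)"
  by (rule bounded_set_integrable[where B = 1]) auto

lemma laplacian_mode:
  assumes "x \<in> {0..1}"
  shows "graphon_laplacian W (fourier_mode k) x = mode_eigenvalue k * fourier_mode k x"
  using laplacian_convolution[OF fourier_mode_measurable mode_integrable _ assms, of "fourier_mode k" k]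
    mode_convolution[OF assms, of k]
  by (simp add: algebra_simps)

lemma mode_eigenspace:
  "fourier_mode k \<in> L2_eigenspace (graphon_laplacian W) (mode_eigenvalue k)"
proof -
  have "(fourier_mode k) \<in> borel_measurable lebesgue"
    using fourier_mode_measurable by (simp add: measurable_completion)
  then have "fourier_mode k \<in> borel_measurable unit_leb"
    by (rule measurable_restrict_space1)
  moreover have "integrable unit_leb (\<lambda>x. (cmod (fourier_mode k x))\<^sup>2)"
    by (simp add: integrable_restrict_space)
  moreover have "AE x in unit_leb. graphon_laplacian W (fourier_mode k) x = mode_eigenvalue k * fourier_mode k x"
    using laplacian_mode by (intro AE_I2) simp
  ultimately show ?thesis
    by (simp add: L2_eigenspace_def L2_def L2_eq_def)
qed

lemma L2_representative:
  assumes "f \<in> L2"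
  obtains f' where "f' \<in> borel_measurable borel" "AE y in lborel. y \<in> {0..1} \<longrightarrow> f y = f' y"
    "set_integrable lborel {0..1} f'"
proof -
  have f: "f \<in> borel_measurable unit_leb" and f2: "integrable unit_leb (\<lambda>x. (cmod (f x))\<^sup>2)"
    using assms by (auto simp: L2_def)
  obtain f' where f'[measurable]: "f' \<in> borel_measurable borel" and eq: "AE y in lborel. y \<in> {0..1} \<longrightarrow> f y = f' y"
    using borel_representative[OF f] by blast
  have "integrable lebesgue (\<lambda>x. indicator {0..1} x *\<^sub>R (cmod (f x))\<^sup>2)"
    using f2 by (simp add: integrable_restrict_space)
  then have "integrable lebesgue (\<lambda>x. indicator {0..1} x *\<^sub>R (cmod (f' x))\<^sup>2)"
  proof (rule integrable_cong_AE_imp)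
    have "(\<lambda>x. indicator {0..1} x *\<^sub>R (cmod (f' x))\<^sup>2) \<in> borel_measurable lborel" by simp
    then show "(\<lambda>x. indicator {0..1} x *\<^sub>R (cmod (f' x))\<^sup>2) \<in> borel_measurable lebesgue"
      by (rule measurable_completion)
    show "AE x in lebesgue. indicator {0..1} x *\<^sub>R (cmod (f x))\<^sup>2 = indicator {0..1} x *\<^sub>R (cmod (f' x))\<^sup>2"
      unfolding AE_completion_iff using eq by eventually_elim (auto simp: indicator_def)
  qed
  then have sq: "integrable lborel (\<lambda>x. indicator {0..1} x *\<^sub>R (cmod (f' x))\<^sup>2)"
    by (subst (asm) integrable_completion) simp_all
  have "set_integrable lborel {0..1} f'"
    unfolding set_integrable_def
  proof (rule Bochner_Integration.integrable_bound)
    show "integrable lborel (\<lambda>x. indicator {0..1 :: real} x + indicator {0..1} x *\<^sub>R (cmod (f' x))\<^sup>2)"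
      using sq by (intro Bochner_Integration.integrable_add) simp_all
    have "t \<le> 1 + t\<^sup>2" for t :: real
      using sum_squares_bound[of t 1] by (simp add: power2_eq_square) (smt (verit) zero_le_square)
    then show "AE x in lborel. norm (indicator {0..1} x *\<^sub>R f' x) \<le> norm (indicator {0..1 :: real} x + indicator {0..1} x *\<^sub>R (cmod (f' x))\<^sup>2)"
      by (intro AE_I2) (simp add: indicator_def)
  qed simp
  with f' eq show ?thesis by (rule that)
qed

text \<open>Fubini's theorem moves the convolution onto the Fourier mode.\<close>

lemma convolution_coefficient:
  assumes f'[measurable]: "f' \<in> borel_measurable borel" and int: "set_integrable lborel {0..1} f'"
  shows "unit_integral (\<lambda>x. unit_integral (\<lambda>y. of_real (\<rho> (y - x)) * f' y) * fourier_mode (- k) x)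
    = mode_coeff k * unit_integral (\<lambda>y. f' y * fourier_mode (- k) y)"
proof -
  define F where "F x y = (indicator {0..1} x *\<^sub>R fourier_mode (- k) x) * ((indicator {0..1} y *\<^sub>R f' y) * of_real (\<rho> (y - x)))" for x y
  have F_meas: "case_prod F \<in> borel_measurable (lborel \<Otimes>\<^sub>M lborel)"
    unfolding F_def[abs_def] by measurable
  have int': "integrable lborel (\<lambda>y. indicator {0..1} y *\<^sub>R f' y)" using int by (simp add: set_integrable_def)
  have "integrable (lborel \<Otimes>\<^sub>M lborel) (case_prod F)"
  proof (rule lborel_pair.Fubini_integrable[OF F_meas])
    define G where "G = (\<integral>y. cmod (indicator {0..1} y *\<^sub>R f' y) \<partial>lborel)"
    have slice: "integrable lborel (\<lambda>y. F x y)" for x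
    proof -
      have "integrable lborel (\<lambda>y. indicator {0..1} y *\<^sub>R (f' y * of_real (\<rho> (y - x))))"
        using set_integrable_bounded_mult[OF int, of "\<lambda>y. of_real (\<rho> (y - x))" 1] \<rho>_range by (simp add: set_integrable_def)
      then have "integrable lborel (\<lambda>y. (indicator {0..1} x *\<^sub>R fourier_mode (- k) x) * (indicator {0..1} y *\<^sub>R (f' y * of_real (\<rho> (y - x)))))"
        by (rule integrable_mult_right)
      then show ?thesis by (simp add: F_def)
    qed
    then show "AE x in lborel. integrable lborel (\<lambda>y. case_prod F (x, y))" by simp
    show "integrable lborel (\<lambda>x. \<integral>y. norm (case_prod F (x, y)) \<partial>lborel)"
    proof (rule Bochner_Integration.integrable_bound)
      show "integrable lborel (\<lambda>x. indicator {0..1 :: real} x * G)"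
        by (intro integrable_mult_left) simp
      show "(\<lambda>x. \<integral>y. norm (case_prod F (x, y)) \<partial>lborel) \<in> borel_measurable lborel"
        using F_meas by (intro lborel.borel_measurable_lebesgue_integral) simp
      have "norm (\<integral>y. norm (F x y) \<partial>lborel) \<le> norm (indicator {0..1} x * G)" for x
      proof -
        have "cmod (F x y) \<le> indicator {0..1} x * cmod (indicator {0..1} y *\<^sub>R f' y)" for y
          using \<rho>_range[of "y - x"] by (auto simp: F_def norm_mult indicator_def intro: mult_left_le)
        then have "(\<integral>y. norm (F x y) \<partial>lborel) \<le> (\<integral>y. indicator {0..1} x * cmod (indicator {0..1} y *\<^sub>R f' y) \<partial>lborel)"
          using slice[of x] int' by (intro integral_mono integrable_norm integrable_mult_right) auto
        also have "\<dots> = indicator {0..1} x * G" by (simp add: G_def)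
        finally have "(\<integral>y. norm (F x y) \<partial>lborel) \<le> indicator {0..1} x * G" .
        moreover have "0 \<le> (\<integral>y. norm (F x y) \<partial>lborel)" by simp
        ultimately show ?thesis by simp
      qed
      then show "AE x in lborel. norm (\<integral>y. norm (case_prod F (x, y)) \<partial>lborel) \<le> norm (indicator {0..1} x * G)" by simp
    qed
  qed
  from lborel_pair.Fubini_integral[OF this]
  have fubini: "(\<integral>x. (\<integral>y. F x y \<partial>lborel) \<partial>lborel) = (\<integral>y. (\<integral>x. F x y \<partial>lborel) \<partial>lborel)" ..
  have inner: "(\<integral>y. F x y \<partial>lborel) = indicator {0..1} x *\<^sub>R (unit_integral (\<lambda>y. of_real (\<rho> (y - x)) * f' y) * fourier_mode (- k) x)" for x
  proof -
    have "F x = (\<lambda>y. (indicator {0..1} x *\<^sub>R fourier_mode (- k) x) * (indicator {0..1} y *\<^sub>R (of_real (\<rho> (y - x)) * f' y)))"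
      by (intro ext) (simp add: F_def mult.commute)
    then have "(\<integral>y. F x y \<partial>lborel)
        = (indicator {0..1} x *\<^sub>R fourier_mode (- k) x) * unit_integral (\<lambda>y. of_real (\<rho> (y - x)) * f' y)"
      by (simp only: set_lebesgue_integral_def Bochner_Integration.integral_mult_right_zero)
    then show ?thesis by (simp add: mult.commute)
  qed
  have outer: "(\<integral>x. F x y \<partial>lborel) = indicator {0..1} y *\<^sub>R (mode_coeff k * (f' y * fourier_mode (- k) y))" for y
  proof (cases "y \<in> {0..1}")
    case True
    have "(\<lambda>x. F x y) = (\<lambda>x. (indicator {0..1} y *\<^sub>R f' y) * (indicator {0..1} x *\<^sub>R (of_real (\<rho> (y - x)) * fourier_mode (- k) x)))"
      by (intro ext) (simp add: F_def mult_ac)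
    then have "(\<integral>x. F x y \<partial>lborel) = (indicator {0..1} y *\<^sub>R f' y) * unit_integral (\<lambda>x. of_real (\<rho> (y - x)) * fourier_mode (- k) x)"
      by (simp only: set_lebesgue_integral_def Bochner_Integration.integral_mult_right_zero)
    then show ?thesis unfolding mode_convolution'[OF True] using True by (simp add: mult_ac)
  qed (simp add: F_def)
  have "unit_integral (\<lambda>x. unit_integral (\<lambda>y. of_real (\<rho> (y - x)) * f' y) * fourier_mode (- k) x)
      = (\<integral>x. (\<integral>y. F x y \<partial>lborel) \<partial>lborel)"
    unfolding inner by (simp add: set_lebesgue_integral_def)
  also have "\<dots> = unit_integral (\<lambda>y. mode_coeff k * (f' y * fourier_mode (- k) y))"
    unfolding fubini outer set_lebesgue_integral_def ..
  also have "\<dots> = mode_coeff k * unit_integral (\<lambda>y. f' y * fourier_mode (- k) y)"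
    by (rule set_integral_mult_right)
  finally show ?thesis .
qed

text \<open>The \<open>k\<close>-th Fourier coefficient \<open>F\<close> of both sides of the eigenvalue equation gives
  \<open>(mode_eigenvalue k - z) * F = 0\<close>.\<close>

lemma eigenfunction_coefficient:
  assumes f: "f \<in> L2_eigenspace (graphon_laplacian W) z"
    and f'[measurable]: "f' \<in> borel_measurable borel" and int: "set_integrable lborel {0..1} f'"
    and eq: "AE y in lborel. y \<in> {0..1} \<longrightarrow> f y = f' y" and k: "mode_eigenvalue k \<noteq> z"
  shows "unit_integral (\<lambda>y. f' y * fourier_mode (- k) y) = 0"
proof -
  define F where "F = unit_integral (\<lambda>y. f' y * fourier_mode (- k) y)"
  have conv_meas[measurable]: "(\<lambda>x. unit_integral (\<lambda>y. of_real (\<rho> (y - x)) * f' y)) \<in> borel_measurable borel"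
  proof -
    have "(\<lambda>x. \<integral>y. indicator {0..1} y *\<^sub>R (of_real (\<rho> (y - x)) * f' y) \<partial>lborel) \<in> borel_measurable borel"
      by (intro lborel.borel_measurable_lebesgue_integral) measurable
    then show ?thesis by (simp add: set_lebesgue_integral_def)
  qed
  have "AE x in lborel. x \<in> {0..1} \<longrightarrow> graphon_laplacian W f x = z * f x"
    using f by (simp add: L2_eigenspace_def L2_eq_def AE_unit_leb)
  then have "AE x in lborel. x \<in> {0..1} \<longrightarrow>
      unit_integral (\<lambda>y. of_real (\<rho> (y - x)) * f' y) * fourier_mode (- k) x = (z + mode_coeff 0) * (f' x * fourier_mode (- k) x)"
    using eq
  proof eventually_elim
    case (elim x)
    then show ?case using laplacian_convolution[OF f' int eq, of x] by (auto simp: algebra_simps)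
  qed
  then have "unit_integral (\<lambda>x. unit_integral (\<lambda>y. of_real (\<rho> (y - x)) * f' y) * fourier_mode (- k) x)
      = unit_integral (\<lambda>x. (z + mode_coeff 0) * (f' x * fourier_mode (- k) x))"
    by (intro unit_integral_cong_AE) measurable
  then have "mode_coeff k * F = (z + mode_coeff 0) * F"
    unfolding convolution_coefficient[OF f' int] by (simp add: F_def)
  then have "(mode_eigenvalue k - z) * F = 0" by (simp add: algebra_simps)
  with k show ?thesis by (simp add: F_def)
qed

lemma mode_combination_coefficient:
  assumes "finite T"
  shows "unit_integral (\<lambda>y. (\<Sum>s\<in>T. d s * fourier_mode s y) * fourier_mode (- k) y) = (if k \<in> T then d k else 0)"
proof -
  have "unit_integral (\<lambda>y. (\<Sum>s\<in>T. d s * fourier_mode s y) * fourier_mode (- k) y)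
      = (\<integral>y. (\<Sum>s\<in>T. d s * (indicator {0..1} y *\<^sub>R fourier_mode (s + - k) y)) \<partial>lborel)"
    unfolding set_lebesgue_integral_def
    by (intro Bochner_Integration.integral_cong refl)
      (simp add: sum_distrib_right scaleR_sum_right mult.assoc fourier_mode_mult)
  also have "\<dots> = (\<Sum>s\<in>T. d s * unit_integral (fourier_mode (s + - k)))"
  proof -
    have "integrable lborel (\<lambda>y. d s * (indicator {0..1} y *\<^sub>R fourier_mode (s + - k) y))" for s
      using mode_integrable by (intro integrable_mult_right) (simp only: set_integrable_def)
    then show ?thesis
      by (simp only: Bochner_Integration.integral_sum set_lebesgue_integral_def Bochner_Integration.integral_mult_right_zero)
  qed
  also have "\<dots> = (\<Sum>s\<in>T. if s = k then d s else 0)"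
    by (intro sum.cong refl) (simp add: unit_integral_fourier_mode)
  finally show ?thesis using assms by (simp add: sum.delta)
qed

text \<open>All eigenfunctions are combinations of Fourier modes, by uniqueness of Fourier coefficients.\<close>

lemma eigenfunction_expansion:
  assumes f: "f \<in> L2_eigenspace (graphon_laplacian W) z" and S: "finite S" "S = {k. mode_eigenvalue k = z}"
  shows "\<exists>d. L2_eq f (\<lambda>x. \<Sum>s\<in>S. d s * fourier_mode s x)"
proof -
  have "f \<in> L2" using f by (simp add: L2_eigenspace_def)
  then obtain f' where f'[measurable]: "f' \<in> borel_measurable borel" and eq: "AE y in lborel. y \<in> {0..1} \<longrightarrow> f y = f' y"
    and int: "set_integrable lborel {0..1} f'"
    by (rule L2_representative)
  define d where "d s = unit_integral (\<lambda>y. f' y * fourier_mode (- s) y)" for s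
  define p where "p x = (\<Sum>s\<in>S. d s * fourier_mode s x)" for x
  have p_meas[measurable]: "p \<in> borel_measurable borel"
    unfolding p_def[abs_def] by measurable
  have p_int: "set_integrable lborel {0..1} p"
    using norm_sum[of "\<lambda>s. d s * fourier_mode s _" S]
    by (intro bounded_set_integrable[where B = "\<Sum>s\<in>S. cmod (d s)"] p_meas)
      (auto simp: p_def norm_mult intro: order_trans[OF norm_sum])
  have "AE x in lborel. x \<in> {0..1} \<longrightarrow> f' x - p x = 0"
  proof (rule fourier_uniqueness)
    show "set_integrable lborel {0..1} (\<lambda>x. f' x - p x)"
      using int p_int by (rule set_integral_diff(1))
    fix k
    have "unit_integral (\<lambda>x. (f' x - p x) * fourier_mode (- (- k)) x)
        = unit_integral (\<lambda>x. f' x * fourier_mode (- (- k)) x) - unit_integral (\<lambda>x. p x * fourier_mode (- (- k)) x)"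
      unfolding left_diff_distrib
      by (intro set_integral_diff(2) set_integrable_bounded_mult[OF int, where B = 1] set_integrable_bounded_mult[OF p_int, where B = 1]) auto
    also have "unit_integral (\<lambda>x. p x * fourier_mode (- (- k)) x) = (if - k \<in> S then d (- k) else 0)"
      unfolding p_def by (rule mode_combination_coefficient[OF S(1)])
    also have "unit_integral (\<lambda>x. f' x * fourier_mode (- (- k)) x) = (if - k \<in> S then d (- k) else 0)"
      using eigenfunction_coefficient[OF f f' int eq, of "- k"] S(2) by (auto simp: d_def)
    finally show "unit_integral (\<lambda>x. (f' x - p x) * fourier_mode k x) = 0" by simp
  qed measurable
  then have "AE x in lborel. x \<in> {0..1} \<longrightarrow> f x = p x"
    using eq by eventually_elim auto
  then show ?thesis by (auto simp: L2_eq_def AE_unit_leb p_def)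
qed

lemma mode_combination_zero:
  assumes "finite T" and zero: "AE x in unit_leb. (\<Sum>s\<in>T. d s * fourier_mode s x) = 0" and "k \<in> T"
  shows "d k = 0"
proof -
  have "d k = unit_integral (\<lambda>y. (\<Sum>s\<in>T. d s * fourier_mode s y) * fourier_mode (- k) y)"
    using mode_combination_coefficient[OF assms(1), of d k] assms(3) by simp
  also have "\<dots> = unit_integral (\<lambda>y. 0)"
  proof (rule unit_integral_cong_AE)
    show "AE x in lborel. x \<in> {0..1} \<longrightarrow> (\<Sum>s\<in>T. d s * fourier_mode s x) * fourier_mode (- k) x = 0"
      using zero unfolding AE_unit_leb by eventually_elim auto
  qed measurable
  finally show ?thesis by (simp add: set_lebesgue_integral_def)
qed

text \<open>Both directions count dimensions. More than \<open>m\<close> modes in the eigenspace would be linearly dependent,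
  contrary to their orthogonality. If there were fewer than \<open>m\<close>, the basis elements \<open>e k\<close>, which are
  combinations of modes, would be dependent, contrary to the uniqueness of coefficients.\<close>

lemma multiplicity_modes:
  assumes mult: "L2_multiplicity (graphon_laplacian W) z m"
  shows "finite {k. mode_eigenvalue k = z}" and "card {k. mode_eigenvalue k = z} = m"
proof -
  define S where "S = {k. mode_eigenvalue k = z}"
  obtain e where e_basis: "(\<forall>k<m. e k \<in> L2_eigenspace (graphon_laplacian W) z) \<and>
      (\<forall>f\<in>L2_eigenspace (graphon_laplacian W) z.
        \<exists>!c. c \<in> {..<m} \<rightarrow>\<^sub>E UNIV \<and> L2_eq f (\<lambda>x. \<Sum>k<m. c k * e k x))"
    using mult unfolding L2_multiplicity_def by (rule exE)
  have e: "e k \<in> L2_eigenspace (graphon_laplacian W) z" if "k < m" for k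
    using e_basis[THEN conjunct1] that by simp
  have basis: "\<exists>!c. c \<in> {..<m} \<rightarrow>\<^sub>E UNIV \<and> L2_eq f (\<lambda>x. \<Sum>k<m. c k * e k x)"
    if "f \<in> L2_eigenspace (graphon_laplacian W) z" for f
    using e_basis[THEN conjunct2, THEN bspec, OF that] .
  have upper: "card T \<le> m" if T: "finite T" "T \<subseteq> S" for T
  proof (rule ccontr)
    assume "\<not> card T \<le> m"
    have "\<exists>c. L2_eq (fourier_mode s) (\<lambda>x. \<Sum>k<m. c k * e k x)" if "s \<in> T" for s
    proof -
      have "fourier_mode s \<in> L2_eigenspace (graphon_laplacian W) z"
        using mode_eigenspace[of s] that T(2) by (auto simp: S_def)
      from ex1_implies_ex[OF basis[OF this]] show ?thesis by blast
    qed
    then have "\<exists>c. \<forall>s\<in>T. L2_eq (fourier_mode s) (\<lambda>x. \<Sum>k<m. c s k * e k x)"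
      by (intro bchoice ballI)
    then obtain c where c: "\<And>s. s \<in> T \<Longrightarrow> L2_eq (fourier_mode s) (\<lambda>x. \<Sum>k<m. c s k * e k x)"
      by blast
    obtain d s0 where d: "s0 \<in> T" "d s0 \<noteq> 0" "\<And>k. k < m \<Longrightarrow> (\<Sum>s\<in>T. d s * c s k) = 0"
      using underdetermined_system[of "{..<m}" T c] T(1) \<open>\<not> card T \<le> m\<close> by auto
    have "AE x in unit_leb. \<forall>s\<in>T. fourier_mode s x = (\<Sum>k<m. c s k * e k x)"
      using c by (intro AE_finite_allI T(1)) (simp add: L2_eq_def)
    then have "AE x in unit_leb. (\<Sum>s\<in>T. d s * fourier_mode s x) = 0"
    proof eventually_elim
      case (elim x)
      then have "(\<Sum>s\<in>T. d s * fourier_mode s x) = (\<Sum>s\<in>T. \<Sum>k<m. d s * c s k * e k x)"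
        by (simp add: sum_distrib_left mult.assoc)
      also have "\<dots> = (\<Sum>k<m. (\<Sum>s\<in>T. d s * c s k) * e k x)"
        by (subst sum.swap) (simp add: sum_distrib_right)
      finally show ?case using d(3) by simp
    qed
    with mode_combination_zero[OF T(1)] d(1,2) show False by blast
  qed
  have fin: "finite S"
  proof (rule ccontr)
    assume "infinite S"
    then obtain T where "T \<subseteq> S" "finite T" "card T = Suc m"
      using infinite_arbitrarily_large by blast
    with upper[of T] show False by simp
  qed
  have "m \<le> card S"
  proof (rule ccontr)
    assume "\<not> m \<le> card S"
    have "\<exists>d. L2_eq (e k) (\<lambda>x. \<Sum>s\<in>S. d s * fourier_mode s x)" if "k < m" for k
      using eigenfunction_expansion[OF e[OF that] fin S_def] .
    then have "\<exists>D. \<forall>k\<in>{..<m}. L2_eq (e k) (\<lambda>x. \<Sum>s\<in>S. D k s * fourier_mode s x)"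
      by (intro bchoice ballI) simp
    then obtain D where D: "\<And>k. k < m \<Longrightarrow> L2_eq (e k) (\<lambda>x. \<Sum>s\<in>S. D k s * fourier_mode s x)"
      by blast
    obtain d k0 where d: "k0 < m" "d k0 \<noteq> 0" "\<And>s. s \<in> S \<Longrightarrow> (\<Sum>k<m. d k * D k s) = 0"
      using underdetermined_system[of S "{..<m}" D] fin \<open>\<not> m \<le> card S\<close> by auto
    have "AE x in unit_leb. \<forall>k\<in>{..<m}. e k x = (\<Sum>s\<in>S. D k s * fourier_mode s x)"
      using D by (intro AE_finite_allI) (simp_all add: L2_eq_def)
    then have zero: "AE x in unit_leb. 0 = (\<Sum>k<m. d k * e k x)"
    proof eventually_elim
      case (elim x)
      then have "(\<Sum>k<m. d k * e k x) = (\<Sum>k<m. \<Sum>s\<in>S. d k * D k s * fourier_mode s x)"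
        by (simp add: sum_distrib_left mult.assoc)
      also have "\<dots> = (\<Sum>s\<in>S. (\<Sum>k<m. d k * D k s) * fourier_mode s x)"
        by (subst sum.swap) (simp add: sum_distrib_right)
      finally show ?case using d(3) by simp
    qed
    have "(\<lambda>x. 0) \<in> L2_eigenspace (graphon_laplacian W) z"
      by (simp add: L2_eigenspace_def L2_def L2_eq_def graphon_laplacian_def)
    from basis[OF this] have uniq: "c = c'"
      if "c \<in> {..<m} \<rightarrow>\<^sub>E UNIV" "L2_eq (\<lambda>x. 0) (\<lambda>x. \<Sum>k<m. c k * e k x)"
        "c' \<in> {..<m} \<rightarrow>\<^sub>E UNIV" "L2_eq (\<lambda>x. 0) (\<lambda>x. \<Sum>k<m. c' k * e k x)" for c c'
      using that by blast
    have "restrict d {..<m} = restrict (\<lambda>_. 0) {..<m}"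
    proof (rule uniq)
      show "L2_eq (\<lambda>x. 0) (\<lambda>x. \<Sum>k<m. restrict d {..<m} k * e k x)"
        using zero by (simp add: L2_eq_def)
      show "L2_eq (\<lambda>x. 0) (\<lambda>x. \<Sum>k<m. restrict (\<lambda>_. 0) {..<m} k * e k x)"
        by (simp add: L2_eq_def)
    qed auto
    then have "restrict d {..<m} k0 = restrict (\<lambda>_. 0) {..<m} k0" by simp
    with d(1,2) show False by simp
  qed
  with upper[OF fin] fin show "finite {k. mode_eigenvalue k = z}" "card {k. mode_eigenvalue k = z} = m"
    by (auto simp: S_def)
qed

end

text \<open>A bounded left inverse of \<open>T - z\<close> maps the null function \<open>T f - z f\<close> to a null function, but also to \<open>f\<close>.\<close>

lemma eigenvalue_in_spectrum:
  assumes "L2_eigenvalue T z"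
  shows "z \<in> L2_spectrum T"
proof (rule ccontr)
  assume "z \<notin> L2_spectrum T"
  then obtain S where S: "L2_bounded_linear S" "\<And>f. f \<in> L2 \<Longrightarrow> L2_eq (S (\<lambda>x. T f x - z * f x)) f"
    by (auto simp: L2_spectrum_def L2_resolvent_set_def)
  obtain f where f: "f \<in> L2" "L2_eq (T f) (\<lambda>x. z * f x)" "\<not> L2_eq f (\<lambda>x. 0)"
    using assms by (auto simp: L2_eigenvalue_def L2_eigenspace_def)
  obtain K where K: "\<And>f. f \<in> L2 \<Longrightarrow> L2_norm (S f) \<le> K * L2_norm f"
    using S(1) unfolding L2_bounded_linear_def by blast
  define h where "h x = T f x - z * f x" for x
  have h0: "AE x in unit_leb. h x = 0"
    using f(2) by (simp add: L2_eq_def h_def)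
  have "(\<lambda>x. indicator {0..1} x *\<^sub>R h x) \<in> borel_measurable lebesgue"
  proof (rule lebesgue_measurable_AE_eq)
    show "AE x in lborel. indicator {0..1} x *\<^sub>R h x = 0"
      using h0 unfolding AE_unit_leb by eventually_elim (auto simp: indicator_def)
  qed simp
  then have h_meas: "h \<in> borel_measurable unit_leb"
    by (subst borel_measurable_restrict_space_iff) auto
  have h_sq: "AE x in unit_leb. (cmod (h x))\<^sup>2 = 0"
    using h0 by eventually_elim simp
  have "integrable unit_leb (\<lambda>x. (cmod (h x))\<^sup>2)"
    using h_meas h_sq by (subst integrable_cong_AE[where g = "\<lambda>_. 0"]) auto
  with h_meas have h_L2: "h \<in> L2" by (simp add: L2_def)
  have "L2_norm h = 0"
    unfolding L2_norm_def using h_meas h_sq by (subst integral_cong_AE[where g = "\<lambda>_. 0"]) auto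
  with K[OF h_L2] have "L2_norm (S h) \<le> 0" by simp
  moreover have Sh: "S h \<in> L2" using S(1) h_L2 by (auto simp: L2_bounded_linear_def)
  moreover have "0 \<le> (LINT x|unit_leb. (cmod (S h x))\<^sup>2)" by simp
  ultimately have "(LINT x|unit_leb. (cmod (S h x))\<^sup>2) = 0"
    by (simp add: L2_norm_def)
  then have "AE x in unit_leb. (cmod (S h x))\<^sup>2 = 0"
    using Sh by (subst (asm) integral_nonneg_eq_0_iff_AE) (auto simp: L2_def)
  moreover have "AE x in unit_leb. S h x = f x"
    using S(2)[OF f(1)] by (simp add: L2_eq_def h_def[abs_def])
  ultimately have "AE x in unit_leb. f x = 0"
    by eventually_elim simp
  with f(3) show False by (simp add: L2_eq_def)
qed

context ring_kernel
begin

lemma coeff_eigenvalue: "L2_eigenvalue (graphon_laplacian W) (mode_eigenvalue k)"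
proof -
  have "\<not> L2_eq (fourier_mode k) (\<lambda>x. 0)"
  proof
    assume "L2_eq (fourier_mode k) (\<lambda>x. 0)"
    then have "AE x in unit_leb. (\<Sum>s\<in>{k}. 1 * fourier_mode s x) = 0" by (simp add: L2_eq_def)
    from mode_combination_zero[OF _ this] show False by simp
  qed
  then show ?thesis using mode_eigenspace[of k] by (auto simp: L2_eigenvalue_def)
qed

lemma coeff_gap:
  assumes "L2_isolated_eigenvalue (graphon_laplacian W) z"
  shows "\<exists>g>0. \<forall>k. mode_eigenvalue k = z \<or> g \<le> cmod (mode_eigenvalue k - z)"
proof -
  obtain U where U: "open U" "U \<inter> L2_spectrum (graphon_laplacian W) = {z}"
    using assms by (auto simp: L2_isolated_eigenvalue_def isolated_in_def)
  then have "z \<in> U" by auto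
  then obtain g where g: "0 < g" "ball z g \<subseteq> U"
    using U(1) by (auto simp: open_contains_ball)
  have "mode_eigenvalue k = z \<or> g \<le> cmod (mode_eigenvalue k - z)" for k
  proof (rule ccontr)
    assume *: "\<not> ?thesis"
    then have "mode_eigenvalue k \<in> ball z g" by (simp add: dist_norm norm_minus_commute)
    then have "mode_eigenvalue k \<in> U \<inter> L2_spectrum (graphon_laplacian W)"
      using g(2) eigenvalue_in_spectrum[OF coeff_eigenvalue] by blast
    with U(2) * show False by auto
  qed
  with g(1) show ?thesis by blast
qed

end

section \<open>Eigenvalues of the sampled Laplacian\<close>

text \<open>Sums over the vertices are reindexed by the offset from a fixed vertex, taken modulo \<open>N\<close>.\<close>

lemma cyclic_shift_bij:
  assumes "i < (N :: nat)"
  shows "bij_betw (\<lambda>r. (i + r) mod N) {..<N} {..<N}"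
proof -
  have inj: "inj_on (\<lambda>r. (i + r) mod N) {..<N}"
  proof (rule inj_onI)
    fix r s assume rs: "r \<in> {..<N}" "s \<in> {..<N}" "(i + r) mod N = (i + s) mod N"
    have "(i + t) mod N = (if i + t < N then i + t else i + t - N)" if "t < N" for t
      using assms that by (simp add: mod_if)
    with rs assms show "r = s" by (auto split: if_splits)
  qed
  moreover have "(\<lambda>r. (i + r) mod N) ` {..<N} \<subseteq> {..<N}"
    using assms by auto
  ultimately show ?thesis
    by (simp add: bij_betw_def card_image card_subset_eq)
qed

lemma fourier_mode_shift_sample:
  assumes "0 < (N :: nat)"
  shows "fourier_mode (k + int N) (real j / real N) = fourier_mode k (real j / real N)"
proof -
  have "2 * pi * real_of_int (int N) * (real j / real N) = 2 * pi * real_of_int 1 * real_of_int (int j)"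
    using assms by simp
  then have "fourier_mode (int N) (real j / real N) = fourier_mode 1 (of_int (int j))"
    by (simp only: fourier_mode_def)
  then have "fourier_mode (int N) (real j / real N) = 1"
    by (simp only: fourier_mode_int)
  then show ?thesis by (simp flip: fourier_mode_mult)
qed

lemma fourier_mode_mod:
  assumes "0 < N"
  shows "fourier_mode k (real (j mod N) / real N) = fourier_mode k (real j / real N)"
proof -
  have "real j = real (j mod N) + real N * real (j div N)"
    by (metis mod_mult_div_eq of_nat_add of_nat_mult)
  then have "real j / real N = real (j mod N) / real N + of_int (int (j div N))"
    using assms by (simp add: add_divide_distrib)
  then show ?thesis by (simp only: fourier_mode_add fourier_mode_int mult_1_right)
qed

lemma fourier_mode_power: "fourier_mode (int a) x = fourier_mode 1 x ^ a"
proof (induction a)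
  case (Suc a)
  have "fourier_mode (int (Suc a)) x = fourier_mode (1 + int a) x" by simp
  then show ?case using Suc by (simp flip: fourier_mode_mult)
qed simp

lemma roots_of_unity_sum:
  assumes "i < N" "j < N"
  shows "(\<Sum>a<N. fourier_mode (int a) ((real i - real j) / real N)) = (if i = j then of_nat N else 0)"
proof (cases "i = j")
  case False
  define x where "x = (real i - real j) / real N"
  have N: "0 < N" using assms by simp
  have "fourier_mode 1 x \<noteq> 1"
  proof
    assume "fourier_mode 1 x = 1"
    then have "cos (2 * pi * x) = 1" by (simp add: fourier_mode_def complex_eq_iff)
    then obtain n :: int where "2 * pi * x = of_int n * 2 * pi"
      by (auto simp: cos_one_2pi_int)
    then have "2 * pi * (x - of_int n) = 0" by (simp add: algebra_simps)
    then have "x = of_int n" by simp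
    then have "real i - real j = of_int n * real N"
      using N by (simp add: x_def field_simps)
    then have "int i - int j = n * int N" by (metis of_int_diff of_int_eq_iff of_int_mult of_int_of_nat_eq)
    then have "int N dvd int i - int j" by simp
    moreover have "\<bar>int i - int j\<bar> < int N" using assms by auto
    ultimately have "int i - int j = 0" using zdvd_not_zless by (metis abs_dvd_iff dvd_abs_iff abs_ge_zero dvd_imp_le_int linorder_not_less abs_of_nat)
    with False show False by simp
  qed
  moreover have "fourier_mode 1 x ^ N = 1"
  proof -
    have "2 * pi * real_of_int (int N) * x = 2 * pi * real_of_int 1 * real_of_int (int i - int j)"
      using N by (simp add: x_def)
    then have "fourier_mode (int N) x = fourier_mode 1 (of_int (int i - int j))"
      by (simp only: fourier_mode_def)
    then show ?thesis by (simp only: fourier_mode_int fourier_mode_power)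
  qed
  ultimately have "(\<Sum>a<N. fourier_mode 1 x ^ a) = 0"
    by (simp add: geometric_sum)
  with False show ?thesis by (simp add: fourier_mode_power x_def)
qed simp

lemma sampled_laplacian_carrier: "sampled_laplacian W N \<in> carrier_mat N N"
  by (auto simp: graph_laplacian_def deg_matrix_def det_adjacency_def intro!: minus_carrier_mat)

text \<open>Residues modulo \<open>N\<close>, taken as close to zero as possible.\<close>

definition centred_residues :: "nat \<Rightarrow> int set" where
  "centred_residues N = {k. - int N < 2 * k \<and> 2 * k \<le> int N}"

lemma centred_residues_bij:
  "bij_betw (\<lambda>a. if 2 * a \<le> N then int a else int a - int N) {..<N} (centred_residues N)"
proof (rule bij_betw_byWitness[where f' = "\<lambda>k. nat (if 0 \<le> k then k else k + int N)"])
qed (auto simp: centred_residues_def)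

context ring_kernel
begin

definition sample_coeff :: "nat \<Rightarrow> int \<Rightarrow> complex" where
  "sample_coeff N k = sample_mean N (\<lambda>s. of_real (R s) * fourier_mode k s)"

abbreviation sample_eigenvalue :: "nat \<Rightarrow> int \<Rightarrow> complex" where
  "sample_eigenvalue N k \<equiv> sample_coeff N k - sample_coeff N 0"

lemma norm_R: "s \<in> {0..1} \<Longrightarrow> cmod (of_real (R s)) \<le> 1"
  using R_range[of s] by simp

lemma sample_coeff_tendsto: "(\<lambda>N. sample_coeff N k) \<longlonglongrightarrow> mode_coeff k"
  unfolding sample_coeff_def mode_coeff_def
proof (rule riemann_sum_tendsto)
  show "cmod (of_real (R s) * fourier_mode k s) \<le> 1" if "s \<in> {0..1}" for s
    using norm_R[OF that] by (simp add: norm_mult)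
  show "AE s in lborel. s \<in> {0<..<1} \<longrightarrow> isCont (\<lambda>s. of_real (R s) * fourier_mode k s) s \<and>
      of_real (\<rho> s) * fourier_mode k s = of_real (R s) * fourier_mode k s"
    using \<rho>_R
  proof eventually_elim
    case (elim s)
    have "continuous_on UNIV (fourier_mode k)"
      unfolding fourier_mode_def[abs_def] by (intro continuous_intros)
    then have "isCont (fourier_mode k) s"
      by (simp add: continuous_on_eq_continuous_at)
    with elim show ?case by (auto intro!: continuous_intros)
  qed
qed measurable

lemma sample_coeff_decay:
  assumes "0 < \<epsilon>"
  obtains K N0 where "0 < K" "\<And>N k. N0 \<le> N \<Longrightarrow> K \<le> \<bar>k\<bar> \<Longrightarrow> 2 * \<bar>k\<bar> \<le> int N \<Longrightarrow> cmod (sample_coeff N k) < \<epsilon>"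
proof (rule discrete_fourier_decay[where h = "\<lambda>s. complex_of_real (R s)" and g = "\<lambda>s. complex_of_real (\<rho> s)" and B = 1 and \<epsilon> = \<epsilon>])
  show "AE s in lborel. s \<in> {0<..<1} \<longrightarrow> isCont (\<lambda>s. complex_of_real (R s)) s \<and>
      complex_of_real (\<rho> s) = complex_of_real (R s)"
    using \<rho>_R by eventually_elim (auto intro!: continuous_intros)
  show "cmod (complex_of_real (\<rho> s)) \<le> 1" for s using \<rho>_range[of s] by simp
  fix K N0 assume K: "0 < K" "\<And>N k. N0 \<le> N \<Longrightarrow> K \<le> \<bar>k\<bar> \<Longrightarrow> 2 * \<bar>k\<bar> \<le> int N \<Longrightarrow>
    cmod (sample_mean N (\<lambda>s. complex_of_real (R s) * cis (2 * pi * real_of_int k * s))) < \<epsilon>"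
  then show thesis by (intro that[of K N0]) (auto simp: sample_coeff_def fourier_mode_def)
qed (use norm_R assms in auto)

text \<open>The Riemann-Lebesgue lemma follows from its discrete version, since \<open>mode_coeff k\<close> is the limit of
  \<open>sample_coeff N k\<close> and the bound does not depend on \<open>N\<close>.\<close>

lemma mode_coeff_decay:
  assumes "0 < \<epsilon>"
  obtains K where "\<And>k. K \<le> \<bar>k\<bar> \<Longrightarrow> cmod (mode_coeff k) \<le> \<epsilon>"
proof (rule sample_coeff_decay[OF assms])
  fix K N0 assume K: "\<And>N k. N0 \<le> N \<Longrightarrow> K \<le> \<bar>k\<bar> \<Longrightarrow> 2 * \<bar>k\<bar> \<le> int N \<Longrightarrow> cmod (sample_coeff N k) < \<epsilon>"
  have "cmod (mode_coeff k) \<le> \<epsilon>" if "K \<le> \<bar>k\<bar>" for k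
  proof (rule LIMSEQ_le_const2[OF tendsto_norm[OF sample_coeff_tendsto]])
    have "cmod (sample_coeff N k) \<le> \<epsilon>" if "max N0 (nat (2 * \<bar>k\<bar>)) \<le> N" for N
      using K[of N k] that \<open>K \<le> \<bar>k\<bar>\<close> by (intro less_imp_le) auto
    then show "\<exists>N. \<forall>n\<ge>N. cmod (sample_coeff n k) \<le> \<epsilon>" by blast
  qed
  then show thesis by (rule that)
qed

text \<open>The sampled Laplacian is circulant, because the symmetry of \<open>R\<close> makes its entries depend on \<open>i - j\<close>
  modulo \<open>N\<close> only. In the Laplacian the diagonal of the adjacency matrix cancels, so that it may
  be taken to be \<open>R 0\<close>.\<close>

lemma circulant_eigenvector:
  assumes i: "i < N"
  shows "(\<Sum>j<N. of_real (sampled_laplacian W N $$ (i, j)) * fourier_mode k (real j / real N))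
    = of_nat N * sample_eigenvalue N k * fourier_mode k (real i / real N)"
proof -
  have N: "0 < N" using i by simp
  define v where "v j = fourier_mode k (real j / real N)" for j
  define A where "A j = R (\<bar>real i - real j\<bar> / real N)" for j
  have adj: "det_adjacency W N $$ (i, j) = (if i = j then 0 else A j)" if "j < N" for j
  proof -
    have "W (real (i + 1) / real N) (real (j + 1) / real N) = R \<bar>real (i + 1) / real N - real (j + 1) / real N\<bar>"
      using i that by (intro W) auto
    also have "real (i + 1) / real N - real (j + 1) / real N = (real i - real j) / real N"
      using N by (simp flip: diff_divide_distrib)
    finally show ?thesis
      using i that N by (simp add: det_adjacency_def sample_def A_def)
  qed
  have lap: "sampled_laplacian W N $$ (i, j)
      = (if i = j then 0 else A j) - (if i = j then (\<Sum>l<N. if i = l then 0 else A l) else 0)" if "j < N" for j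
    using i that adj by (auto simp: graph_laplacian_def deg_matrix_def mat_diag_def det_adjacency_def[of W N] intro!: sum.cong)
  have "(\<Sum>j<N. of_real (sampled_laplacian W N $$ (i, j)) * v j)
      = (\<Sum>j<N. of_real (if i = j then 0 else A j) * v j - (if i = j then of_real (\<Sum>l<N. if i = l then 0 else A l) * v j else 0))"
    by (intro sum.cong refl) (auto simp: lap left_diff_distrib)
  also have "\<dots> = (\<Sum>j<N. of_real (if i = j then 0 else A j) * v j) - of_real (\<Sum>l<N. if i = l then 0 else A l) * v i"
    using i by (simp add: sum_subtractf sum.delta)
  also have "\<dots> = (\<Sum>j<N. of_real (if i = j then 0 else A j) * (v j - v i))"
    by (simp add: right_diff_distrib sum_subtractf sum_distrib_right)
  also have "\<dots> = (\<Sum>j<N. of_real (A j) * (v j - v i))"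
    by (intro sum.cong) auto
  also have "\<dots> = (\<Sum>r<N. of_real (A ((i + r) mod N)) * (v ((i + r) mod N) - v i))"
    by (rule sum.reindex_bij_betw[OF cyclic_shift_bij[OF i], symmetric])
  also have "\<dots> = (\<Sum>r<N. (of_real (R (real r / real N)) * fourier_mode k (real r / real N) - of_real (R (real r / real N))) * v i)"
  proof (intro sum.cong refl)
    fix r assume r: "r \<in> {..<N}"
    have "A ((i + r) mod N) = R (real r / real N)"
    proof (cases "i + r < N")
      case False
      then have "(i + r) mod N = i + r - N" using i r by (simp add: mod_if)
      then have "\<bar>real i - real ((i + r) mod N)\<bar> / real N = 1 - real r / real N"
        using False r N by (simp add: field_simps)
      then show ?thesis using R_sym[of "real r / real N"] r N by (simp add: A_def)
    qed (simp add: A_def)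
    moreover have "v ((i + r) mod N) = v i * fourier_mode k (real r / real N)"
      by (simp add: v_def fourier_mode_mod[OF N] add_divide_distrib fourier_mode_add)
    ultimately show "of_real (A ((i + r) mod N)) * (v ((i + r) mod N) - v i)
        = (of_real (R (real r / real N)) * fourier_mode k (real r / real N) - of_real (R (real r / real N))) * v i"
      by (simp add: algebra_simps)
  qed
  also have "\<dots> = (of_nat N * sample_coeff N k - of_nat N * sample_coeff N 0) * v i"
  proof -
    have "of_nat N * (X /\<^sub>R real N) = X" for X :: complex
      using N by (simp add: scaleR_conv_of_real)
    then show ?thesis
      by (simp only: sample_coeff_def sum_subtractf sum_distrib_right[symmetric] fourier_mode_0 mult_1_right)
  qed
  finally show ?thesis by (simp add: v_def right_diff_distrib)
qed

lemma circulant_proots: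
  assumes N: "0 < N"
  shows "proots (char_poly (map_mat complex_of_real (sampled_laplacian W N)))
    = image_mset (\<lambda>a. of_nat N * (sample_eigenvalue N (int a))) (mset_set {..<N})"
proof (rule proots_char_poly_diagonalised)
  define P where "P = Matrix.mat N N (\<lambda>(j, a). fourier_mode (int a) (real j / real N))"
  define Q where "Q = Matrix.mat N N (\<lambda>(a, j). fourier_mode (- int a) (real j / real N) / of_nat N)"
  show "map_mat complex_of_real (sampled_laplacian W N) \<in> carrier_mat N N"
    by (simp add: sampled_laplacian_carrier)
  show "P \<in> carrier_mat N N" "Q \<in> carrier_mat N N" by (simp_all add: P_def Q_def)
  show "P * Q = 1\<^sub>m N"
  proof (rule eq_matI)
    fix i j assume "i < dim_row (1\<^sub>m N :: complex mat)" "j < dim_col (1\<^sub>m N :: complex mat)"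
    then have ij: "i < N" "j < N" by simp_all
    have "(P * Q) $$ (i, j) = (\<Sum>a<N. fourier_mode (int a) (real i / real N) * (fourier_mode (- int a) (real j / real N) / of_nat N))"
      using ij by (simp add: P_def Q_def scalar_prod_def lessThan_atLeast0)
    also have "\<dots> = (\<Sum>a<N. fourier_mode (int a) ((real i - real j) / real N)) / of_nat N"
      unfolding sum_divide_distrib
    proof (intro sum.cong refl)
      fix a
      have "fourier_mode (int a) (real i / real N) * fourier_mode (- int a) (real j / real N) = fourier_mode (int a) ((real i - real j) / real N)"
        using fourier_mode_add[of "int a" "real i / real N" "- (real j / real N)"]
        by (simp add: fourier_mode_uminus diff_divide_distrib)
      then show "fourier_mode (int a) (real i / real N) * (fourier_mode (- int a) (real j / real N) / of_nat N)
          = fourier_mode (int a) ((real i - real j) / real N) / of_nat N" by simp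
    qed
    also have "\<dots> = 1\<^sub>m N $$ (i, j)"
      using ij N by (simp add: roots_of_unity_sum)
    finally show "(P * Q) $$ (i, j) = 1\<^sub>m N $$ (i, j)" .
  qed (simp_all add: P_def Q_def)
  fix i a assume "i < N" "a < N"
  then show "(\<Sum>j<N. map_mat complex_of_real (sampled_laplacian W N) $$ (i, j) * P $$ (j, a))
      = of_nat N * (sample_eigenvalue N (int a)) * P $$ (i, a)"
    using circulant_eigenvector[of i N "int a"] carrier_matD[OF sampled_laplacian_carrier[of W N]]
    by (simp add: P_def)
qed

lemma sample_coeff_periodic: "0 < N \<Longrightarrow> sample_coeff N (k + int N) = sample_coeff N k"
  by (simp add: sample_coeff_def fourier_mode_shift_sample)

text \<open>A real eigenbasis and the Fourier modes diagonalise the same matrix, so that both list the roots of its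
  characteristic polynomial with multiplicities.\<close>

lemma card_circulant_eigenvalues:
  assumes N: "0 < N" and u: "eigen_family N (entries (sampled_laplacian W N)) N u l"
  shows "num_near N l \<mu> \<delta>
    = card {k \<in> centred_residues N. cmod (sample_eigenvalue N k - of_real \<mu>) < \<delta>}"
proof -
  define L where "L = sampled_laplacian W N"
  have L: "L \<in> carrier_mat N N"
    unfolding L_def by (rule sampled_laplacian_carrier)
  have fam: "eigen_family N (entries L) N u l" using u by (simp add: L_def)
  define U where "U = Matrix.mat N N (\<lambda>(j, a). complex_of_real (u a j))"
  have U: "U \<in> carrier_mat N N" "transpose_mat U \<in> carrier_mat N N" by (simp_all add: U_def)
  have "transpose_mat U * U = 1\<^sub>m N"
  proof (rule eq_matI)
    fix a b assume "a < dim_row (1\<^sub>m N :: complex mat)" "b < dim_col (1\<^sub>m N :: complex mat)"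
    then have ab: "a < N" "b < N" by simp_all
    have "(transpose_mat U * U) $$ (a, b) = of_real (ip N (u a) (u b))"
      using ab by (simp add: U_def scalar_prod_def ip_def lessThan_atLeast0)
    then show "(transpose_mat U * U) $$ (a, b) = 1\<^sub>m N $$ (a, b)"
      using fam ab by (simp add: eigen_family_def orthonormal_family_def)
  qed (simp_all add: U_def)
  then have UU: "U * transpose_mat U = 1\<^sub>m N"
    by (rule mat_mult_left_right_inverse[OF U(2,1)])
  have "proots (char_poly (map_mat complex_of_real L)) = image_mset (\<lambda>a. complex_of_real (l a)) (mset_set {..<N})"
  proof (rule proots_char_poly_diagonalised[OF _ U UU])
    show "map_mat complex_of_real L \<in> carrier_mat N N" using L by simp
    fix i a assume ia: "i < N" "a < N"
    have "(\<Sum>j<N. map_mat complex_of_real L $$ (i, j) * U $$ (j, a)) = of_real (app N (entries L) (u a) i)"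
      using ia L by (simp add: U_def app_def entries_def)
    then show "(\<Sum>j<N. map_mat complex_of_real L $$ (i, j) * U $$ (j, a)) = of_real (l a) * U $$ (i, a)"
      using fam ia by (simp add: U_def eigen_family_def)
  qed
  then have eq: "image_mset (\<lambda>a. complex_of_real (l a)) (mset_set {..<N})
      = image_mset (\<lambda>a. of_nat N * (sample_eigenvalue N (int a))) (mset_set {..<N})"
    using circulant_proots[OF N] by (simp add: L_def)
  define P where "P z \<longleftrightarrow> cmod (z / of_nat N - of_real \<mu>) < \<delta>" for z
  have "card {a \<in> {..<N}. P (complex_of_real (l a))} = size (filter_mset P (image_mset (\<lambda>a. complex_of_real (l a)) (mset_set {..<N})))"
    by (simp add: filter_mset_image_mset filter_mset_mset_set)
  also have "\<dots> = card {a \<in> {..<N}. P (of_nat N * (sample_eigenvalue N (int a)))}"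
    unfolding eq by (simp add: filter_mset_image_mset filter_mset_mset_set)
  also have "\<dots> = card {k \<in> centred_residues N. P (of_nat N * (sample_eigenvalue N k))}"
  proof (rule bij_betw_same_card)
    define \<tau> where "\<tau> a = (if 2 * a \<le> N then int a else int a - int N)" for a
    have "sample_coeff N (\<tau> a) = sample_coeff N (int a)" for a
      using sample_coeff_periodic[OF N, of "int a - int N"] by (simp add: \<tau>_def)
    moreover have bij: "bij_betw \<tau> {..<N} (centred_residues N)"
      unfolding \<tau>_def[abs_def] by (rule centred_residues_bij)
    ultimately show "bij_betw \<tau> {a \<in> {..<N}. P (of_nat N * (sample_eigenvalue N (int a)))}
        {k \<in> centred_residues N. P (of_nat N * (sample_eigenvalue N k))}"
      by (intro bij_betw_Collect) simp_all
  qed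
  finally have card: "card {a \<in> {..<N}. P (complex_of_real (l a))}
      = card {k \<in> centred_residues N. P (of_nat N * (sample_eigenvalue N k))}" .
  have "P (complex_of_real (l a)) \<longleftrightarrow> \<bar>l a / real N - \<mu>\<bar> < \<delta>" for a
  proof -
    have "complex_of_real (l a) / of_nat N - of_real \<mu> = of_real (l a / real N - \<mu>)" by simp
    then show ?thesis unfolding P_def by (simp only: norm_of_real)
  qed
  then show ?thesis using card N by (simp add: P_def num_near_def)
qed

text \<open>Frequencies below a cutoff are controlled by convergence of the coefficients. Beyond the cutoff
  both kinds of coefficients are small, and the eigenvalues are near \<open>- mode_coeff 0\<close>. That
  accumulation point is itself separated from an eigenvalue of finite multiplicity.\<close>

lemma circulant_eigenvalues_near:
  assumes fin: "finite {k. mode_eigenvalue k = z}" and "0 < g"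
    and gap: "\<And>k. mode_eigenvalue k = z \<or> g \<le> cmod (mode_eigenvalue k - z)"
    and \<delta>: "0 < \<delta>" "\<delta> \<le> g / 2"
  shows "\<exists>N0. \<forall>N\<ge>N0. {k \<in> centred_residues N. cmod (sample_eigenvalue N k - z) < \<delta>}
      = {k. mode_eigenvalue k = z} \<and>
    {k \<in> centred_residues N. cmod (sample_eigenvalue N k - z) < g / 2}
      = {k. mode_eigenvalue k = z}"
proof -
  define S where "S = {k. mode_eigenvalue k = z}"
  obtain B where B: "\<And>k. k \<in> S \<Longrightarrow> \<bar>k\<bar> < B"
  proof -
    have "\<bar>k\<bar> < Max (insert 0 (abs ` S)) + 1" if "k \<in> S" for k
    proof -
      have "\<bar>k\<bar> \<le> Max (insert 0 (abs ` S))" using that fin by (intro Max_ge) (auto simp: S_def)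
      then show ?thesis by simp
    qed
    then show thesis by (rule that)
  qed
  \<comment> \<open>the accumulation point \<open>- mode_coeff 0\<close> of the eigenvalues has distance at least \<open>g\<close> from \<open>z\<close>\<close>
  have limit: "g \<le> cmod (mode_coeff 0 + z) + \<epsilon>" if "0 < \<epsilon>" for \<epsilon>
  proof -
    obtain K where K: "\<And>k. K \<le> \<bar>k\<bar> \<Longrightarrow> cmod (mode_coeff k) \<le> \<epsilon>"
      using mode_coeff_decay[OF \<open>0 < \<epsilon>\<close>] by blast
    define k where "k = max \<bar>K\<bar> \<bar>B\<bar>"
    have k: "K \<le> \<bar>k\<bar>" "B \<le> \<bar>k\<bar>" by (auto simp: k_def)
    then have "k \<notin> S" using B[of k] by auto
    then have "g \<le> cmod (mode_coeff k - (mode_coeff 0 + z))" using gap[of k] by (simp add: S_def algebra_simps)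
    also have "\<dots> \<le> cmod (mode_coeff k) + cmod (mode_coeff 0 + z)" by (rule norm_triangle_ineq4)
    finally show ?thesis using K[OF k(1)] by simp
  qed
  then have limit: "g \<le> cmod (mode_coeff 0 + z)" by (rule field_le_epsilon)
  obtain K0 N1 where K0: "\<And>N k. N1 \<le> N \<Longrightarrow> K0 \<le> \<bar>k\<bar> \<Longrightarrow> 2 * \<bar>k\<bar> \<le> int N \<Longrightarrow> cmod (sample_coeff N k) < g / 4"
    using sample_coeff_decay[of "g / 4"] \<open>0 < g\<close> by (metis zero_less_divide_iff zero_less_numeral)
  define K where "K = max \<bar>K0\<bar> \<bar>B\<bar>"
  have "\<forall>\<^sub>F N in sequentially. \<forall>k\<in>{-K..K}. cmod (sample_coeff N k - mode_coeff k) < \<delta> / 2"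
    using \<delta>(1) by (intro eventually_ball_finite ballI)
      (auto intro!: order_tendstoD(2) tendsto_norm_zero LIM_zero sample_coeff_tendsto)
  then obtain N2 where "\<forall>N\<ge>N2. \<forall>k\<in>{-K..K}. cmod (sample_coeff N k - mode_coeff k) < \<delta> / 2"
    unfolding eventually_sequentially by (rule exE)
  then have N2: "cmod (sample_coeff N k - mode_coeff k) < \<delta> / 2" if "N2 \<le> N" "k \<in> {-K..K}" for N k
    using that by blast
  show ?thesis
  proof (intro exI[of _ "max (max N1 N2) (nat (2 * K + 1))"] allI impI)
    fix N assume N: "max (max N1 N2) (nat (2 * K + 1)) \<le> N"
    define D where "D k = sample_eigenvalue N k - z" for k
    have near0: "cmod (sample_coeff N 0 - mode_coeff 0) < \<delta> / 2" using N N2[of N 0] by (simp add: K_def)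
    have S_res: "S \<subseteq> centred_residues N"
    proof
      fix k assume "k \<in> S"
      then have "\<bar>k\<bar> < K" using B[of k] by (simp add: K_def)
      then show "k \<in> centred_residues N" using N by (auto simp: centred_residues_def)
    qed
    have inside: "cmod (D k) < \<delta>" if "k \<in> S" for k
    proof -
      have "k \<in> {-K..K}" using B[OF that] by (auto simp: K_def)
      then have "cmod (sample_coeff N k - mode_coeff k) < \<delta> / 2" using N N2[of N k] by simp
      moreover have "D k = (sample_coeff N k - mode_coeff k) - (sample_coeff N 0 - mode_coeff 0)"
        using that by (simp add: D_def S_def algebra_simps)
      ultimately show ?thesis
        using near0 norm_triangle_ineq4[of "sample_coeff N k - mode_coeff k" "sample_coeff N 0 - mode_coeff 0"] by simp
    qed
    have outside: "g / 2 \<le> cmod (D k)" if k: "k \<in> centred_residues N" "k \<notin> S" for k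
    proof (cases "k \<in> {-K..K}")
      case True
      then have 1: "cmod (sample_coeff N k - mode_coeff k) < \<delta> / 2" using N N2[of N k] by simp
      have "g \<le> cmod (mode_eigenvalue k - z)" using gap[of k] k(2) by (simp add: S_def)
      also have "mode_eigenvalue k - z = D k - ((sample_coeff N k - mode_coeff k) - (sample_coeff N 0 - mode_coeff 0))"
        by (simp add: D_def algebra_simps)
      also have "cmod \<dots> \<le> cmod (D k) + (cmod (sample_coeff N k - mode_coeff k) + cmod (sample_coeff N 0 - mode_coeff 0))"
        by (intro order_trans[OF norm_triangle_ineq4] add_left_mono norm_triangle_ineq4)
      finally show ?thesis using 1 near0 \<delta>(2) by simp
    next
      case False
      then have "K0 \<le> \<bar>k\<bar>" by (auto simp: K_def)
      moreover have "2 * \<bar>k\<bar> \<le> int N" using k(1) by (auto simp: centred_residues_def)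
      ultimately have 1: "cmod (sample_coeff N k) < g / 4" using K0[of N k] N by simp
      have "g \<le> cmod (mode_coeff 0 + z)" by (rule limit)
      also have "mode_coeff 0 + z = sample_coeff N k - (sample_coeff N 0 - mode_coeff 0) - D k"
        by (simp add: D_def)
      also have "cmod \<dots> \<le> (cmod (sample_coeff N k) + cmod (sample_coeff N 0 - mode_coeff 0)) + cmod (D k)"
        by (intro order_trans[OF norm_triangle_ineq4] add_right_mono norm_triangle_ineq4)
      finally show ?thesis using 1 near0 \<delta>(2) by simp
    qed
    have "\<And>k. k \<in> S \<Longrightarrow> cmod (D k) < g / 2" using inside \<delta>(2) by fastforce
    moreover have "\<And>k. k \<in> centred_residues N \<Longrightarrow> k \<notin> S \<Longrightarrow> \<not> cmod (D k) < \<delta>"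
      using outside \<delta>(2) by fastforce
    ultimately have "{k \<in> centred_residues N. cmod (D k) < \<delta>} = S \<and> {k \<in> centred_residues N. cmod (D k) < g / 2} = S"
      using inside outside S_res by fastforce
    then show "{k \<in> centred_residues N. cmod (sample_eigenvalue N k - z) < \<delta>}
        = {k. mode_eigenvalue k = z} \<and>
      {k \<in> centred_residues N. cmod (sample_eigenvalue N k - z) < g / 2}
        = {k. mode_eigenvalue k = z}"
      by (simp add: D_def S_def)
  qed
qed

end

lemma sampled_eigenvalues_near:
  assumes "ring_graphon W" and "ae_continuous W"
    and iso: "L2_isolated_eigenvalue (graphon_laplacian W) (of_real \<mu>)"
    and mult: "L2_multiplicity (graphon_laplacian W) (of_real \<mu>) m"
  obtains g where "0 < g" "\<And>\<delta>. 0 < \<delta> \<Longrightarrow> \<delta> \<le> g \<Longrightarrow> \<exists>N0. \<forall>N\<ge>N0. \<forall>u l.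
    eigen_family N (entries (sampled_laplacian W N)) N u l \<longrightarrow>
    num_near N l \<mu> \<delta> = m \<and> num_near N l \<mu> g = m"
proof -
  obtain R where R: "\<And>s. s \<in> {0..1} \<Longrightarrow> R s \<in> {0..1}" "\<And>s. s \<in> {0..1} \<Longrightarrow> R s = R (1 - s)"
    and W: "\<And>x y. x \<in> {0..1} \<Longrightarrow> y \<in> {0..1} \<Longrightarrow> W x y = R \<bar>x - y\<bar>"
    and cont: "AE s in lborel. s \<in> {0<..<1} \<longrightarrow> isCont R s"
    using ring_graphon_kernel[OF assms(1,2)] by blast
  obtain \<rho> where \<rho>: "\<rho> \<in> borel_measurable borel" "\<And>s. \<rho> s \<in> {0..1}" "\<And>s. \<rho> (s + 1) = \<rho> s"
    "AE s in lborel. s \<in> {0<..<1} \<longrightarrow> isCont R s \<and> \<rho> s = R s"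
    using borel_version[OF R(1) cont] by blast
  interpret ring_kernel W R \<rho>
    by unfold_locales (fact W R \<rho>)+
  define S where "S = {k. mode_eigenvalue k = of_real \<mu>}"
  have S: "finite S" "card S = m" using multiplicity_modes[OF mult] by (simp_all add: S_def)
  obtain g where g: "0 < g" "\<And>k. mode_eigenvalue k = of_real \<mu> \<or> g \<le> cmod (mode_eigenvalue k - of_real \<mu>)"
    using coeff_gap[OF iso] by blast
  show thesis
  proof (rule that[of "g / 2"])
    fix \<delta> :: real assume "0 < \<delta>" "\<delta> \<le> g / 2"
    from circulant_eigenvalues_near[OF S(1)[unfolded S_def] g this] obtain N0 where N0:
      "\<forall>N\<ge>N0. {k \<in> centred_residues N. cmod (sample_eigenvalue N k - of_real \<mu>) < \<delta>} = S \<and>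
        {k \<in> centred_residues N. cmod (sample_eigenvalue N k - of_real \<mu>) < g / 2} = S"
      unfolding S_def[symmetric] by (rule exE)
    show "\<exists>N0. \<forall>N\<ge>N0. \<forall>u l.
      eigen_family N (entries (sampled_laplacian W N)) N u l \<longrightarrow>
      num_near N l \<mu> \<delta> = m \<and> num_near N l \<mu> (g / 2) = m"
    proof (intro exI[of _ "max 1 N0"] allI impI)
      fix N u l
      assume N: "max 1 N0 \<le> N" and u: "eigen_family N (entries (sampled_laplacian W N)) N u l"
      then have "0 < N" "N0 \<le> N" by auto
      show "num_near N l \<mu> \<delta> = m \<and> num_near N l \<mu> (g / 2) = m"
        unfolding card_circulant_eigenvalues[OF \<open>0 < N\<close> u] using N0[rule_format, OF \<open>N0 \<le> N\<close>] S(2)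
        by (simp only: simp_thms)
    qed
  qed (use g(1) in simp)
qed

section \<open>Comparison of the deterministic and the random Laplacian\<close>

lemma graph_laplacian_carrier: "A \<in> carrier_mat N N \<Longrightarrow> graph_laplacian A \<in> carrier_mat N N"
  by (auto simp: graph_laplacian_def deg_matrix_def intro!: minus_carrier_mat)

lemma graph_laplacian_symmetric:
  assumes A: "A \<in> carrier_mat N N" and sym: "\<And>i j. i < N \<Longrightarrow> j < N \<Longrightarrow> A $$ (i, j) = A $$ (j, i)"
  shows "symmetric N (entries (graph_laplacian A))"
  unfolding symmetric_def entries_def
proof (intro allI impI)
  fix i j assume ij: "i < N" "j < N"
  show "graph_laplacian A $$ (i, j) = graph_laplacian A $$ (j, i)"
    using A ij sym[OF ij] by (cases "i = j") (auto simp: graph_laplacian_def deg_matrix_def mat_diag_def)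
qed

lemma num_near_scaled:
  assumes "0 < N"
  shows "num_near N l \<mu> \<delta> = card {a. a < N \<and> \<bar>l a - \<mu> * N\<bar> < \<delta> * N}"
proof -
  have "\<bar>l a / real N - \<mu>\<bar> < \<delta> \<longleftrightarrow> \<bar>l a - \<mu> * N\<bar> < \<delta> * N" for a
  proof -
    have "l a / real N - \<mu> = (l a - \<mu> * N) / N" using assms by (simp add: diff_divide_distrib)
    then show ?thesis using assms by (simp add: abs_divide pos_divide_less_eq)
  qed
  then show ?thesis by (simp add: num_near_def)
qed

lemma num_near_mono: "\<delta> \<le> \<delta>' \<Longrightarrow> num_near N l \<mu> \<delta> \<le> num_near N l \<mu> \<delta>'"
  unfolding num_near_def by (intro card_mono) auto

lemma num_near_perturbed:
  fixes r s :: real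
  assumes N: "0 < N" and K: "symmetric N K" "eigen_family N K N u l" and L: "symmetric N L" "eigen_family N L N v k"
    and close: "operator_close N \<epsilon> K L" and r: "0 < r" "r < s" "\<epsilon> < (s - r) * N"
  shows "num_near N l \<mu> r \<le> num_near N k \<mu> s"
proof -
  have "card {a. a < N \<and> \<bar>l a - \<mu> * N\<bar> < r * N} \<le> card {a. a < N \<and> \<bar>l a - \<mu> * N\<bar> \<le> r * N}"
    by (intro card_mono) auto
  also have "\<dots> \<le> card {a. a < N \<and> \<bar>k a - \<mu> * N\<bar> < s * N}"
    using r N by (intro card_eigenvalues_perturbed[OF K L close]) (auto simp: left_diff_distrib)
  finally show ?thesis by (simp add: num_near_scaled[OF N])
qed

text \<open>Equal counts for the radii \<open>\<delta> / 2\<close> and \<open>g\<close> express a gap in the spectrum of \<open>K\<close>. They squeeze the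
  counts for \<open>L\<close>, whose radii \<open>\<delta>\<close> and \<open>g / 2\<close> lie between them with a margin of more than \<open>\<epsilon>\<close>.\<close>

lemma num_near_close:
  assumes N: "0 < N" and K: "symmetric N K" "eigen_family N K N u l" and L: "symmetric N L" "eigen_family N L N v k"
    and close: "operator_close N \<epsilon> K L"
    and counts: "num_near N l \<mu> (\<delta> / 2) = m" "num_near N l \<mu> g = m"
    and \<delta>: "0 < \<delta>" "\<delta> \<le> g / 2" "\<epsilon> < \<delta> / 2 * N"
  shows "num_near N k \<mu> \<delta> = m" "num_near N k \<mu> (g / 2) = m"
proof -
  have "\<epsilon> < (g - g / 2) * N"
    using \<delta>(3) mult_right_mono[of "\<delta> / 2" "g - g / 2" "real N"] \<delta>(1,2) by simp
  then have "num_near N k \<mu> (g / 2) \<le> m"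
    using \<delta> counts(2) num_near_perturbed[OF N L K operator_close_sym[OF close], where r = "g / 2" and s = g and \<mu> = \<mu>] by simp
  moreover have "m \<le> num_near N k \<mu> \<delta>"
    using \<delta> counts(1) num_near_perturbed[OF N K L close, where r = "\<delta> / 2" and s = \<delta> and \<mu> = \<mu>] by simp
  moreover have "num_near N k \<mu> \<delta> \<le> num_near N k \<mu> (g / 2)"
    using \<delta>(2) by (rule num_near_mono)
  ultimately show "num_near N k \<mu> \<delta> = m" "num_near N k \<mu> (g / 2) = m"
    by linarith+
qed

text \<open>A column of \<open>V\<close> belongs to an eigenvalue of \<open>K\<close> within \<open>\<delta> N \<le> g N / 4\<close> of \<open>\<mu> N\<close> and solves the eigenvalue
  equation of \<open>L\<close> up to \<open>\<epsilon>\<close>. The eigenvalues of \<open>L\<close> that do not belong to \<open>V'\<close> are at distance at least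
  \<open>g N / 2\<close> from \<open>\<mu> N\<close>, which leaves a gap \<open>g N / 4\<close>.\<close>

lemma close_eigenvectors:
  fixes \<mu> \<epsilon> \<delta> g :: real
  assumes N: "0 < N" and K: "K \<in> carrier_mat N N" and L: "L \<in> carrier_mat N N"
    and L_sym: "symmetric N (entries L)"
    and close: "operator_close N \<epsilon> (entries K) (entries L)"
    and counts: "\<And>v k. eigen_family N (entries L) N v k \<Longrightarrow> num_near N k \<mu> (g / 2) = m"
    and \<delta>: "0 < \<delta>" "\<delta> \<le> g / 4"
    and V: "length (eigenvalues_near K \<mu> \<delta>) = m" "eigenvector_matrix K (eigenvalues_near K \<mu> \<delta>) V"
    and V': "length (eigenvalues_near L \<mu> \<delta>) = m" "eigenvector_matrix L (eigenvalues_near L \<mu> \<delta>) V'"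
    and small: "real m * (\<epsilon> / (g / 4 * N))\<^sup>2 < 1"
  shows "\<exists>Q \<in> carrier_mat m m. orthonormal_columns Q \<and>
    frobenius_norm (V' * Q - V) \<le> sqrt (2 * (real m * (\<epsilon> / (g / 4 * N))\<^sup>2))"
proof -
  define \<kappa> where "\<kappa> k = eigenvalues_near K \<mu> \<delta> ! k" for k
  have V_carr: "V \<in> carrier_mat N m" and V_fam: "eigen_family N (entries K) m (\<lambda>k i. V $$ (i, k)) \<kappa>"
    using eigenvector_matrix_eigen_family[OF K V(2)] by (simp_all add: V(1) \<kappa>_def[abs_def])
  have V'_carr: "V' \<in> carrier_mat N m"
    and V'_fam: "eigen_family N (entries L) m (\<lambda>k i. V' $$ (i, k)) (\<lambda>k. eigenvalues_near L \<mu> \<delta> ! k)"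
    using eigenvector_matrix_eigen_family[OF L V'(2)] by (simp_all add: V'(1))
  have "m \<le> N"
  proof -
    obtain v k where "eigen_family N (entries L) N v k"
      using eigenbasis_exists[OF L_sym] by blast
    from counts[OF this] have "m = num_near N k \<mu> (g / 2)" by simp
    also have "\<dots> \<le> card {..<N}" unfolding num_near_def by (intro card_mono) auto
    finally show ?thesis by simp
  qed
  from eigen_completion[OF L_sym this V'_fam] obtain u l where
    u: "eigen_family N (entries L) N u l" and
    ul: "\<And>a. a < m \<Longrightarrow> u a = (\<lambda>i. V' $$ (i, a))" "\<And>a. a < m \<Longrightarrow> l a = eigenvalues_near L \<mu> \<delta> ! a"
    by auto
  have near: "\<bar>l a / real N - \<mu>\<bar> < \<delta>" if "a < m" for a
    using eigenvalues_near_nth[of a L \<mu> \<delta>] that V'(1) ul(2)[OF that] L by simp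
  have "{..<m} = {a. a < N \<and> \<bar>l a / real N - \<mu>\<bar> < g / 2}"
  proof (rule card_subset_eq)
    show "{..<m} \<subseteq> {a. a < N \<and> \<bar>l a / real N - \<mu>\<bar> < g / 2}"
      using near \<delta> \<open>m \<le> N\<close> by fastforce
  qed (use counts[OF u] in \<open>auto simp: num_near_def\<close>)
  then have far: "g / 2 \<le> \<bar>l a / real N - \<mu>\<bar>" if "m \<le> a" "a < N" for a
    using that by (metis (mono_tags, lifting) lessThan_iff linorder_not_less mem_Collect_eq)
  have Nr: "0 < real N" using N by simp
  have "(\<Sum>a\<in>{m..<N}. (ip N (\<lambda>i. V $$ (i, k)) (u a))\<^sup>2) \<le> (\<epsilon> / (g / 4 * N))\<^sup>2" if k: "k < m" for k
  proof (rule residual_far_component[OF L_sym u])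
    fix a assume a: "m \<le> a" "a < N"
    have "\<bar>\<kappa> k / real N - \<mu>\<bar> < \<delta>"
      using eigenvalues_near_nth[of k K \<mu> \<delta>] k V(1) K by (simp add: \<kappa>_def)
    then have "g / 4 \<le> \<bar>l a / real N - \<kappa> k / real N\<bar>" using far[OF a] \<delta>(2) by linarith
    then show "g / 4 * real N \<le> \<bar>l a - \<kappa> k\<bar>"
      using Nr by (simp add: diff_divide_distrib[symmetric] abs_divide pos_le_divide_eq)
  next
    have "L2_set (\<lambda>i. app N (entries L) (\<lambda>i. V $$ (i, k)) i - \<kappa> k * V $$ (i, k)) {..<N}
        = L2_set (\<lambda>i. app N (entries L) (\<lambda>i. V $$ (i, k)) i - app N (entries K) (\<lambda>i. V $$ (i, k)) i) {..<N}"
      using V_fam k by (intro L2_set_cong) (auto simp: eigen_family_def)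
    also have "\<dots> \<le> \<epsilon> * L2_set (\<lambda>i. V $$ (i, k)) {..<N}"
      using close by (simp add: operator_close_def)
    also have "L2_set (\<lambda>i. V $$ (i, k)) {..<N} = 1"
    proof -
      have "(L2_set (\<lambda>i. V $$ (i, k)) {..<N})\<^sup>2 = 1"
        using V_fam k by (simp add: ip_self_eq_L2_set[symmetric] eigen_family_def orthonormal_family_def)
      then show ?thesis using L2_set_nonneg[of "\<lambda>i. V $$ (i, k)" "{..<N}"] by (simp add: power2_eq_1_iff)
    qed
    finally show "L2_set (\<lambda>i. app N (entries L) (\<lambda>i. V $$ (i, k)) i - \<kappa> k * V $$ (i, k)) {..<N} \<le> \<epsilon>" by simp
  qed (use \<delta> Nr \<open>m \<le> N\<close> in auto)
  then have "(\<Sum>k<m. \<Sum>a\<in>{m..<N}. (ip N (\<lambda>i. V $$ (i, k)) (u a))\<^sup>2) \<le> (\<Sum>k<m. (\<epsilon> / (g / 4 * N))\<^sup>2)"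
    by (intro sum_mono) auto
  then have "(\<Sum>k<m. \<Sum>a\<in>{m..<N}. (ip N (\<lambda>i. V $$ (i, k)) (u a))\<^sup>2) \<le> real m * (\<epsilon> / (g / 4 * N))\<^sup>2" by simp
  moreover have "orthonormal_family N N u" "orthonormal_family N m (\<lambda>k i. V $$ (i, k))"
    using u V_fam by (simp_all add: eigen_family_def)
  ultimately obtain Q where "(\<forall>k<m. \<forall>k'<m. (\<Sum>a<m. Q a k * Q a k') = (if k = k' then 1 else 0)) \<and>
      (\<Sum>i<N. \<Sum>k<m. ((\<Sum>a<m. u a i * Q a k) - V $$ (i, k))\<^sup>2) \<le> 2 * (real m * (\<epsilon> / (g / 4 * N))\<^sup>2)"
    using orthonormal_alignment[of N u m "\<lambda>k i. V $$ (i, k)"] \<open>m \<le> N\<close> small by blast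
  then have Q: "\<And>k k'. k < m \<Longrightarrow> k' < m \<Longrightarrow> (\<Sum>a<m. Q a k * Q a k') = (if k = k' then 1 else 0)"
    and Q_close: "(\<Sum>i<N. \<Sum>k<m. ((\<Sum>a<m. u a i * Q a k) - V $$ (i, k))\<^sup>2) \<le> 2 * (real m * (\<epsilon> / (g / 4 * N))\<^sup>2)"
    by blast+
  define QM where "QM = Matrix.mat m m (\<lambda>(a, k). Q a k)"
  have QM: "QM \<in> carrier_mat m m" by (simp add: QM_def)
  have "transpose_mat QM * QM = 1\<^sub>m m"
    using Q by (intro eq_matI) (auto simp: QM_def scalar_prod_def lessThan_atLeast0)
  then have "orthonormal_columns QM" using QM by (simp add: orthonormal_columns_def)
  moreover have "frobenius_norm (V' * QM - V) \<le> sqrt (2 * (real m * (\<epsilon> / (g / 4 * N))\<^sup>2))"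
  proof -
    have "(V' * QM - V) $$ (i, k) = (\<Sum>a<m. u a i * Q a k) - V $$ (i, k)" if "i < N" "k < m" for i k
    proof -
      have "(V' * QM) $$ (i, k) = (\<Sum>a<m. V' $$ (i, a) * Q a k)"
        using that V'_carr by (simp add: QM_def scalar_prod_def lessThan_atLeast0)
      then show ?thesis using that V_carr V'_carr QM ul(1) by simp
    qed
    then have "(\<Sum>i<dim_row (V' * QM - V). \<Sum>k<dim_col (V' * QM - V). ((V' * QM - V) $$ (i, k))\<^sup>2)
        = (\<Sum>i<N. \<Sum>k<m. ((\<Sum>a<m. u a i * Q a k) - V $$ (i, k))\<^sup>2)"
      using V_carr by (intro sum.cong) auto
    with Q_close show ?thesis by (simp add: frobenius_norm_def)
  qed
  ultimately show ?thesis using QM by blast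
qed

lemma eventually_powr_less:
  fixes \<gamma> c :: real
  assumes "\<gamma> < 1/2" "0 < c"
  shows "\<forall>\<^sub>F N in sequentially. 2 * real N powr (1/2 + \<gamma>) < c * real N"
proof -
  have "\<forall>\<^sub>F x in at_top. 2 * x powr (1/2 + \<gamma>) < c * x"
    using assms by real_asymp
  from eventually_compose_filterlim[OF this filterlim_real_sequentially] show ?thesis .
qed

theorem theorem2p8:
  fixes W :: "real \<Rightarrow> real \<Rightarrow> real" and \<mu> :: real and m :: nat
  assumes "ring_graphon W" and "ae_continuous W"
    and "L2_isolated_eigenvalue (graphon_laplacian W) (of_real \<mu>)"
    and "L2_multiplicity (graphon_laplacian W) (of_real \<mu>) m" and "1 \<le> m"
  shows "\<exists>\<delta>0 > 0. \<exists>(N0 :: real \<Rightarrow> real \<Rightarrow> nat) (C :: real \<Rightarrow> real).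
    \<forall>\<delta> \<in> {0 <..< \<delta>0}. \<forall>\<gamma> \<in> {0 <..< 1/2}.
      N0 \<delta> \<gamma> \<ge> 1 \<and> C \<gamma> > 0 \<and>
      (\<forall>N \<ge> N0 \<delta> \<gamma>.
        let Ld = graph_laplacian (det_adjacency W N);
            p = 1 - 2 * real N * exp (- C \<gamma> * real N powr (2 * \<gamma>))
        in length (eigenvalues_near Ld \<mu> \<delta>) = m \<and>
           (\<forall>(M :: 'w measure) A. random_adjacency W N M A \<longrightarrow>
              (let Lr = (\<lambda>\<omega>. graph_laplacian (A \<omega>)) in
                measure M {\<omega> \<in> space M. length (eigenvalues_near (Lr \<omega>) \<mu> \<delta>) = m} \<ge> p \<and>
                (\<forall>V. eigenvector_matrix Ld (eigenvalues_near Ld \<mu> \<delta>) V \<longrightarrow>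
                  measure M {\<omega> \<in> space M.
                    length (eigenvalues_near (Lr \<omega>) \<mu> \<delta>) = m \<and>
                    (\<forall>V'. eigenvector_matrix (Lr \<omega>) (eigenvalues_near (Lr \<omega>) \<mu> \<delta>) V' \<longrightarrow>
                      (\<exists>Q \<in> carrier_mat m m. orthonormal_columns Q \<and>
                        frobenius_norm (V' * Q - V)
                          \<le> sqrt (8 * real m) / ((\<delta>0 - \<delta>) * real N powr (1/2 - \<gamma>))))} \<ge> p))))"
proof -
  have graphon: "graphon W" using assms(1) by (simp add: ring_graphon_def)
  obtain g where g: "0 < g" and counts: "\<And>\<delta>. 0 < \<delta> \<Longrightarrow> \<delta> \<le> g \<Longrightarrow> \<exists>N0. \<forall>N\<ge>N0. \<forall>u l.
    eigen_family N (entries (sampled_laplacian W N)) N u l \<longrightarrow>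
    num_near N l \<mu> \<delta> = m \<and> num_near N l \<mu> g = m"
    using sampled_eigenvalues_near[OF assms(1-4)] by blast
  \<comment> \<open>the residual argument needs the gap \<open>g / 4\<close> that remains between the windows of radius \<open>\<delta>\<close> and \<open>g / 2\<close>\<close>
  define \<delta>0 where "\<delta>0 = g / 4"
  define count where "count N \<delta> B \<longleftrightarrow> length (eigenvalues_near (graph_laplacian B) \<mu> \<delta>) = m" for N :: nat and \<delta> B
  define align where "align N \<delta> \<gamma> V B \<longleftrightarrow> (\<forall>V'. eigenvector_matrix (graph_laplacian B) (eigenvalues_near (graph_laplacian B) \<mu> \<delta>) V' \<longrightarrow>
      (\<exists>Q \<in> carrier_mat m m. orthonormal_columns Q \<and>
        frobenius_norm (V' * Q - V) \<le> sqrt (8 * real m) / ((\<delta>0 - \<delta>) * real N powr (1/2 - \<gamma>))))" for N \<delta> \<gamma> V B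
  define Ld where "Ld N = sampled_laplacian W N" for N
  define good where "good \<delta> \<gamma> N \<longleftrightarrow> count N \<delta> (det_adjacency W N) \<and>
    (\<forall>(M :: 'w measure) A. random_adjacency W N M A \<longrightarrow>
      1 - 2 * real N * exp (- (1/2) * real N powr (2 * \<gamma>)) \<le> measure M {\<omega> \<in> space M. count N \<delta> (A \<omega>)} \<and>
      (\<forall>V. eigenvector_matrix (Ld N) (eigenvalues_near (Ld N) \<mu> \<delta>) V \<longrightarrow>
        1 - 2 * real N * exp (- (1/2) * real N powr (2 * \<gamma>)) \<le> measure M {\<omega> \<in> space M. count N \<delta> (A \<omega>) \<and> align N \<delta> \<gamma> V (A \<omega>)}))"
    for \<delta> \<gamma> N
  have main: "\<exists>n\<ge>1. \<forall>N\<ge>n. good \<delta> \<gamma> N" if \<delta>: "0 < \<delta>" "\<delta> < \<delta>0" and \<gamma>: "0 < \<gamma>" "\<gamma> < 1/2" for \<delta> \<gamma>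
  proof -
    obtain N1 where N1: "\<forall>N\<ge>N1. \<forall>(M :: 'w measure) A. random_adjacency W N M A \<longrightarrow>
        1 - 2 * real N * exp (- (1/2) * real N powr (2 * \<gamma>)) \<le> measure M {\<omega> \<in> space M. laplacian_close W N (2 * real N powr (1/2 + \<gamma>)) (A \<omega>)}"
      using laplacian_concentration[OF graphon \<gamma>(1)] by (rule exE)
    have "0 < \<delta> / 2" "\<delta> / 2 \<le> g" using \<delta> g by (simp_all add: \<delta>0_def)
    from counts[OF this] obtain N2 where N2: "\<forall>N\<ge>N2. \<forall>u l.
        eigen_family N (entries (sampled_laplacian W N)) N u l \<longrightarrow>
        num_near N l \<mu> (\<delta> / 2) = m \<and> num_near N l \<mu> g = m"
      by (rule exE)
    \<comment> \<open>the first bound preserves the number of eigenvalues, the second makes the alignment possible\<close>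
    have "\<forall>\<^sub>F N in sequentially. 2 * real N powr (1/2 + \<gamma>) < \<delta> / 2 * real N \<and>
        2 * real N powr (1/2 + \<gamma>) < g / (4 * (real m + 1)) * real N"
      using \<delta> g \<gamma> by (intro eventually_conj eventually_powr_less) auto
    then obtain N3 where N3: "\<forall>N\<ge>N3. 2 * real N powr (1/2 + \<gamma>) < \<delta> / 2 * real N \<and>
        2 * real N powr (1/2 + \<gamma>) < g / (4 * (real m + 1)) * real N"
      unfolding eventually_sequentially by (rule exE)
    have "good \<delta> \<gamma> N" if N_ge: "max 1 (max N1 (max N2 N3)) \<le> N" for N
    proof -
      have N: "0 < N" "N1 \<le> N" "N2 \<le> N" "N3 \<le> N" using N_ge by auto
      have Nr: "0 < real N" using N(1) by simp
      define \<epsilon> where "\<epsilon> = 2 * real N powr (1/2 + \<gamma>)"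
      have \<epsilon>: "0 \<le> \<epsilon>" "\<epsilon> < \<delta> / 2 * N" "\<epsilon> < g / (4 * (real m + 1)) * N"
        using N3 N(4) by (simp_all add: \<epsilon>_def)
      have det: "det_adjacency W N \<in> carrier_mat N N" by (simp add: det_adjacency_def)
      have Ld: "Ld N \<in> carrier_mat N N" unfolding Ld_def by (rule graph_laplacian_carrier[OF det])
      have det_sym: "det_adjacency W N $$ (i, j) = det_adjacency W N $$ (j, i)" if "i < N" "j < N" for i j
        using graphon that by (auto simp: det_adjacency_def graphon_def sample_def)
      have Ld_sym: "symmetric N (entries (Ld N))"
        unfolding Ld_def using det det_sym by (rule graph_laplacian_symmetric)
      obtain u l where ul: "eigen_family N (entries (Ld N)) N u l"
        using eigenbasis_exists[OF Ld_sym] by blast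
      have cd: "num_near N l \<mu> (\<delta> / 2) = m" "num_near N l \<mu> g = m"
        using N2 N(3) ul unfolding Ld_def by blast+
      have "num_near N l \<mu> \<delta> = m"
        by (rule num_near_close(1)[OF N(1) Ld_sym ul Ld_sym ul _ cd, where \<epsilon> = 0])
          (use \<delta> Nr in \<open>auto simp: \<delta>0_def operator_close_def L2_set_def\<close>)
      then have count_det: "length (eigenvalues_near (Ld N) \<mu> \<delta>) = m"
        by (simp only: length_eigenvalues_near[OF Ld proots_eigen_family[OF Ld ul]])
      have rand_count: "count N \<delta> B \<and> (\<forall>v k. eigen_family N (entries (graph_laplacian B)) N v k \<longrightarrow>
            num_near N k \<mu> (g / 2) = m)"
        if B: "B \<in> carrier_mat N N" and B_sym: "symmetric N (entries (graph_laplacian B))"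
          and close: "laplacian_close W N (2 * real N powr (1/2 + \<gamma>)) B" for B
      proof -
        have cl: "operator_close N \<epsilon> (entries (Ld N)) (entries (graph_laplacian B))"
          using close by (simp add: Ld_def \<epsilon>_def)
        have \<delta>g: "\<delta> \<le> g / 2" using \<delta> g by (simp add: \<delta>0_def)
        have both: "num_near N k \<mu> \<delta> = m" "num_near N k \<mu> (g / 2) = m"
          if "eigen_family N (entries (graph_laplacian B)) N v k" for v k
          using num_near_close[OF N(1) Ld_sym ul B_sym that cl cd \<delta>(1) \<delta>g \<epsilon>(2)] by auto
        obtain v k where vk: "eigen_family N (entries (graph_laplacian B)) N v k"
          using eigenbasis_exists[OF B_sym] by blast
        have "count N \<delta> B"
          unfolding count_def length_eigenvalues_near[OF graph_laplacian_carrier[OF B] proots_eigen_family[OF graph_laplacian_carrier[OF B] vk]]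
          by (rule both(1)[OF vk])
        with both(2) show ?thesis by blast
      qed
      have rand_align: "align N \<delta> \<gamma> V B"
        if B: "B \<in> carrier_mat N N" and B_sym: "symmetric N (entries (graph_laplacian B))" and cl: "laplacian_close W N (2 * real N powr (1/2 + \<gamma>)) B"
          and V: "eigenvector_matrix (Ld N) (eigenvalues_near (Ld N) \<mu> \<delta>) V" for B V
        unfolding align_def
      proof (intro allI impI)
        fix V' assume V': "eigenvector_matrix (graph_laplacian B) (eigenvalues_near (graph_laplacian B) \<mu> \<delta>) V'"
        define q where "q = \<epsilon> / (g / 4 * N)"
        have q: "0 \<le> q" "q < 1 / (real m + 1)"
          using \<epsilon> g Nr by (simp_all add: q_def field_simps)
        have "real m * q\<^sup>2 < 1"
        proof -
          have "q * (real m + 1) < 1" using q(2) by (simp add: pos_less_divide_eq)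
          then have "q * real m < 1" using q(1) by (simp add: algebra_simps)
          moreover have "q < 1" using q(2) by (rule less_le_trans) simp
          ultimately have "q * (q * real m) \<le> q * 1" "q * 1 < 1" using q(1) by (intro mult_left_mono, auto)
          then show ?thesis by (simp add: power2_eq_square mult_ac)
        qed
        then obtain Q where Q: "Q \<in> carrier_mat m m" "orthonormal_columns Q"
          and frob: "frobenius_norm (V' * Q - V) \<le> sqrt (2 * (real m * q\<^sup>2))"
          using close_eigenvectors[OF N(1) Ld graph_laplacian_carrier[OF B] B_sym, of \<epsilon> \<mu> g m \<delta> V V']
            rand_count[OF B B_sym cl] cl \<delta> count_det V V'
          by (auto simp: q_def count_def Ld_def \<epsilon>_def \<delta>0_def)
        have "sqrt (2 * (real m * q\<^sup>2)) = sqrt (2 * real m) * q"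
          using q(1) by (simp add: real_sqrt_mult)
        also have "\<dots> = sqrt (2 * real m) * 2 * (real N powr (1/2 + \<gamma>) / N) / (g / 4)"
          by (simp add: q_def \<epsilon>_def mult_ac)
        \<comment> \<open>the factor \<open>2\<close> of the concentration bound turns \<open>sqrt (2 m)\<close> into \<open>sqrt (8 m)\<close>\<close>
        also have "sqrt (2 * real m) * 2 = sqrt (8 * real m)"
          using real_sqrt_mult[of 4 "2 * real m"] by simp
        also have "real N powr (1/2 + \<gamma>) / N = 1 / real N powr (1/2 - \<gamma>)"
        proof -
          have "real N powr (1/2 + \<gamma>) * real N powr (1/2 - \<gamma>) = real N"
            using Nr by (simp flip: powr_add)
          then show ?thesis using Nr by (simp add: field_simps)
        qed
        also have "sqrt (8 * real m) * (1 / real N powr (1/2 - \<gamma>)) / (g / 4)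
            = sqrt (8 * real m) / (g / 4 * real N powr (1/2 - \<gamma>))" by simp
        also have "\<dots> \<le> sqrt (8 * real m) / ((\<delta>0 - \<delta>) * real N powr (1/2 - \<gamma>))"
          using \<delta> g Nr by (intro divide_left_mono mult_right_mono mult_pos_pos) (auto simp: \<delta>0_def)
        finally show "\<exists>Q \<in> carrier_mat m m. orthonormal_columns Q \<and>
            frobenius_norm (V' * Q - V) \<le> sqrt (8 * real m) / ((\<delta>0 - \<delta>) * real N powr (1/2 - \<gamma>))"
          using Q frob by (intro bexI[of _ Q]) auto
      qed
      show ?thesis
        unfolding good_def
      proof (intro conjI allI impI)
        show "count N \<delta> (det_adjacency W N)"
          using count_det by (simp add: count_def Ld_def)
        fix M :: "'w measure" and A assume random: "random_adjacency W N M A"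
        then interpret random_graph W N M A using graphon by unfold_locales
        have B: "A \<omega> \<in> carrier_mat N N" "symmetric N (entries (graph_laplacian (A \<omega>)))" if "\<omega> \<in> space M" for \<omega>
          using A_carrier[OF that] A_sym[OF that] by (auto intro: graph_laplacian_symmetric)
        have conc: "1 - 2 * real N * exp (- (1/2) * real N powr (2 * \<gamma>)) \<le> prob {\<omega> \<in> space M. laplacian_close W N (2 * real N powr (1/2 + \<gamma>)) (A \<omega>)}"
          using N1 N(2) random by blast
        also have "\<dots> \<le> prob {\<omega> \<in> space M. count N \<delta> (A \<omega>)}"
          using rand_count B by (intro finite_measure_mono event_measurable) blast
        finally show "1 - 2 * real N * exp (- (1/2) * real N powr (2 * \<gamma>)) \<le> prob {\<omega> \<in> space M. count N \<delta> (A \<omega>)}" .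
        fix V assume V: "eigenvector_matrix (Ld N) (eigenvalues_near (Ld N) \<mu> \<delta>) V"
        note conc
        also have "prob {\<omega> \<in> space M. laplacian_close W N (2 * real N powr (1/2 + \<gamma>)) (A \<omega>)} \<le> prob {\<omega> \<in> space M. count N \<delta> (A \<omega>) \<and> align N \<delta> \<gamma> V (A \<omega>)}"
          using rand_count rand_align[OF _ _ _ V] B
          by (intro finite_measure_mono event_measurable[where P = "\<lambda>B. count N \<delta> B \<and> align N \<delta> \<gamma> V B"]) blast
        finally show "1 - 2 * real N * exp (- (1/2) * real N powr (2 * \<gamma>))
            \<le> prob {\<omega> \<in> space M. count N \<delta> (A \<omega>) \<and> align N \<delta> \<gamma> V (A \<omega>)}" .
      qed
    qed
    then show ?thesis by (intro exI[of _ "max 1 (max N1 (max N2 N3))"]) auto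
  qed
  define N0 where "N0 \<delta> \<gamma> = (SOME n. 1 \<le> n \<and> (\<forall>N\<ge>n. good \<delta> \<gamma> N))" for \<delta> \<gamma>
  have N0: "1 \<le> N0 \<delta> \<gamma>" "\<And>N. N0 \<delta> \<gamma> \<le> N \<Longrightarrow> good \<delta> \<gamma> N"
    if "\<delta> \<in> {0<..<\<delta>0}" "\<gamma> \<in> {0<..<1/2}" for \<delta> \<gamma>
    using someI_ex[OF main[of \<delta> \<gamma>]] that unfolding N0_def by auto
  have "0 < \<delta>0" using g by (simp add: \<delta>0_def)
  then show ?thesis
    unfolding Let_def
    using N0 unfolding good_def count_def align_def Ld_def
    by (intro exI[of _ \<delta>0] exI[of _ N0] exI[of _ "\<lambda>_. 1/2"] conjI ballI allI impI) auto
qed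

end
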